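(* Let $X$ be a Markov process on a finite set $\Omega_0$ with intensity matrix $\lambda$, let $\{\Gamma_k,k\in K\}$ be a finite nonempty collection of subsets of $\Omega_0$ with $\Omega_0\setminus\bigcup_{k\in K}\Gamma_k\ne\emptyset$, and let the initial distribution $\alpha$ put its full mass on this set. Let $\tau_k=\inf\{u\in(0,\infty):X_u\in\Gamma_k\}$, let $\{\mathscr{F}_u\}$ be the filtration generated by $X$, let $u_0\in\mathbb{R}_+$ be deterministic, and let $\bar V_{u_0}=\{k\in K:\tau_k\ge u_0\}$ (the complement in $K$ of $V_{u_0}=\{k\in K:\tau_k<u_0\}$). Then the regular conditional density of $(\tau_k-u_0)_{k\in\bar V_{u_0}}$ given $\mathscr{F}_{u_0}$ is $f(\delta_{X_{u_0}},t,\bar V_{u_0})$; that is, for every nonempty $A\subset K$, every partition $s'$ of $A$ and every Borel $U\subset R_{s'}\subset\mathbb{R}_+^A$, $P_\alpha$-almost surely on the event $\{\bar V_{u_0}=A\}$, $$P_\alpha\big((\tau_k-u_0)_{k\in A}\in U\,\big|\,\mathscr{F}_{u_0}\big)=\int_U f(\delta_{X_{u_0}},t,A)\,d_{s'}t .$$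
   Context: Process: $\Omega_0$ is a finite set and $X=(X_u)_{u\ge 0}$ is an $\Omega_0$-valued continuous time process (right-continuous, piecewise constant paths) on a measurable space $(\Omega,\mathscr{F})$ with measures $P_i$, $i\in\Omega_0$, such that $P_i(X_0=i)=1$ and under each $P_i$, $X$ is a time-homogeneous Markov process with intensity matrix $\lambda$ (with $-\lambda(i,i)=\sum_{j\ne i}\lambda(i,j)$). $P_\alpha=\sum_i\alpha(i)P_i$. $\delta_i$ is the unit row vector (point mass) at $i\in\Omega_0$. Matrices: for $a,b\subset\Omega_0$, $\boldsymbol{\lambda}(a,b)$ is the $\Omega_0\times\Omega_0$ matrix with entries $\lambda(i,j)$ if $i\in a,j\in b$, and $0$ otherwise; $\boldsymbol{\lambda}(a)=\boldsymbol{\lambda}(a,a)$; $\mathbf 1$ is the column vector of ones; $\prod_{n=1}^m M_n=M_1\cdots M_m$. Partitions: for a nonempty finite index set $A\subset K$, a partition $s=(s(1),\dots,s(|s|))$ of $A$ is an ordered sequence of disjoint nonempty subsets of $A$ with union $A$; $s(n,1)$ is an (arbitrary) first element of $s(n)$. $L^ms=(s(m+1),\dots,s(|s|))$, and for an ordered sequence $s$ of disjoint nonempty subsets, $S(s)=\bigcup_n\bigcup_{k\in s(n)}\Gamma_k$. $R_s$ is the set of $t\in\mathbb{R}_+^A$ with $t_{k_1}=t_{k_2}$ for $k_1,k_2$ in the same component of $s$ and $t_{s(1,1)}<\cdots<t_{s(|s|,1)}$. $d_st$ is the $|s|$-dimensional Lebesgue measure on $R_s$, i.e. the image of Lebesgue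 measure on $\{r\in\mathbb{R}_+^{|s|}:r_1<\dots<r_{|s|}\}$ under $r\mapsto t$, $t_k=r_n$ for $k\in s(n)$. The function $f$: for a row vector $\beta$ indexed by $\Omega_0$, a nonempty $A\subset K$, a partition $s$ of $A$ and $t\in R_s$, $$f(\beta,t,A)=\beta\left(\prod_{n=1}^{|s|}e^{\boldsymbol{\lambda}(W_n)(\bar t_n-\bar t_{n-1})}\boldsymbol{\lambda}(W_n,T_n)\right)\mathbf 1,$$ where $\bar t_n=t_{s(n,1)}$, $\bar t_0=0$, $W_n=\Omega_0\setminus S(L^{n-1}s)$ (with $W_{|s|+1}=\Omega_0$), $T_n=\left[\bigcap_{k\in s(n)}\Gamma_k\right]\cap W_{n+1}$. *)

theory Defs
  imports "HOL-Probability.Probability"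
begin

(* The finite state space is the type 's; matrices indexed by it are real^'s^'s with
   lam $ i $ j the (i,j) entry, and row vectors act by v*.  The indexed family of target
   sets is G :: 'k => 's set, with a finite index set K. *)

section \<open>Markov processes with a given intensity matrix\<close>

definition is_intensity_matrix :: "real^'s::finite^'s \<Rightarrow> bool" where
  "is_intensity_matrix lam \<longleftrightarrow>
     (\<forall>i j. i \<noteq> j \<longrightarrow> 0 \<le> lam $ i $ j) \<and>
     (\<forall>i. - lam $ i $ i = (\<Sum>j\<in>UNIV - {i}. lam $ i $ j))"

definition generated_filtration :: "'w measure \<Rightarrow> (real \<Rightarrow> 'w \<Rightarrow> 's) \<Rightarrow> real \<Rightarrow> 'w measure" where
  "generated_filtration M X u =
     sigma (space M) {X v -` B \<inter> space M | v B. 0 \<le> v \<and> v \<le> u}"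

definition right_continuous_path :: "(real \<Rightarrow> 's) \<Rightarrow> bool" where
  "right_continuous_path x \<longleftrightarrow> (\<forall>u\<ge>0. eventually (\<lambda>v. x v = x u) (at_right u))"

definition piecewise_constant_path :: "(real \<Rightarrow> 's) \<Rightarrow> bool" where
  "piecewise_constant_path x \<longleftrightarrow>
     (\<forall>T\<ge>0. \<exists>S. finite S \<and>
        (\<forall>u v. 0 \<le> u \<and> u \<le> v \<and> v \<le> T \<and> {u..v} \<inter> S = {} \<longrightarrow> x u = x v))"

(* M only serves as the measurable space; its own measure is irrelevant.
   The transition function is p_u(i,j) = P_i(X_u = j), and lam is its derivative at 0. *)

locale markov_process =
  fixes M :: "'w measure"
    and X :: "real \<Rightarrow> 'w \<Rightarrow> 's::finite"
    and P :: "'s \<Rightarrow> 'w measure"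
    and lam :: "real^'s^'s"
  assumes intensity_matrix: "is_intensity_matrix lam"
    and X_measurable: "\<And>u. 0 \<le> u \<Longrightarrow> X u \<in> measurable M (count_space UNIV)"
    and X_right_continuous: "\<And>\<omega>. \<omega> \<in> space M \<Longrightarrow> right_continuous_path (\<lambda>u. X u \<omega>)"
    and X_piecewise_constant: "\<And>\<omega>. \<omega> \<in> space M \<Longrightarrow> piecewise_constant_path (\<lambda>u. X u \<omega>)"
    and P_prob: "\<And>i. prob_space (P i)"
    and P_sets: "\<And>i. sets (P i) = sets M"
    and P_start: "\<And>i. measure (P i) {\<omega>\<in>space M. X 0 \<omega> = i} = 1"
    and markov: "\<And>i j v u. 0 \<le> v \<Longrightarrow> 0 \<le> u \<Longrightarrow>
        AE \<omega> in P i.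
          real_cond_exp (P i) (generated_filtration M X v)
              (indicator {\<omega>\<in>space M. X (v + u) \<omega> = j}) \<omega>
            = measure (P (X v \<omega>)) {\<omega>'\<in>space M. X u \<omega>' = j}"
    and intensity: "\<And>i j.
        ((\<lambda>u. (measure (P i) {\<omega>\<in>space M. X u \<omega> = j} - (if i = j then 1 else 0)) / u)
           \<longlongrightarrow> lam $ i $ j) (at_right 0)"

definition is_distribution :: "real^'s::finite \<Rightarrow> bool" where
  "is_distribution \<alpha> \<longleftrightarrow> (\<forall>i. 0 \<le> \<alpha> $ i) \<and> (\<Sum>i\<in>UNIV. \<alpha> $ i) = 1"

definition mixed_law :: "'w measure \<Rightarrow> ('s::finite \<Rightarrow> 'w measure) \<Rightarrow> real^'s \<Rightarrow> 'w measure" where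
  "mixed_law M P \<alpha> =
     measure_of (space M) (sets M) (\<lambda>B. \<Sum>i\<in>UNIV. ennreal (\<alpha> $ i) * emeasure (P i) B)"

lemma space_mixed_law [simp]: "space (mixed_law M P \<alpha>) = space M"
  and sets_mixed_law [simp, measurable_cong]: "sets (mixed_law M P \<alpha>) = sets M"
  by (simp_all add: mixed_law_def)

lemma emeasure_mixed_law:
  fixes M :: "'w measure"
  assumes "\<And>i. sets (P i) = sets M" "B \<in> sets M"
  shows "emeasure (mixed_law M P \<alpha>) B = (\<Sum>i\<in>UNIV. ennreal (\<alpha> $ i) * emeasure (P i) B)"
  unfolding mixed_law_def
proof (rule emeasure_measure_of_sigma)
  show "sigma_algebra (space M) (sets M)" by (rule sets.sigma_algebra_axioms)
  show "positive (sets M) (\<lambda>B. \<Sum>i\<in>UNIV. ennreal (\<alpha> $ i) * emeasure (P i) B)"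
    by (simp add: positive_def)
  show "countably_additive (sets M) (\<lambda>B. \<Sum>i\<in>UNIV. ennreal (\<alpha> $ i) * emeasure (P i) B)"
  proof (rule countably_additiveI)
    fix C :: "nat \<Rightarrow> 'w set"
    assume C: "range C \<subseteq> sets M" "disjoint_family C"
    have "(\<Sum>n. \<Sum>i\<in>UNIV. ennreal (\<alpha> $ i) * emeasure (P i) (C n))
        = (\<Sum>i\<in>UNIV. \<Sum>n. ennreal (\<alpha> $ i) * emeasure (P i) (C n))"
      by (rule suminf_sum) simp
    also have "\<dots> = (\<Sum>i\<in>UNIV. ennreal (\<alpha> $ i) * emeasure (P i) (\<Union>n. C n))"
      using C assms(1) by (intro sum.cong refl) (simp add: suminf_emeasure)
    finally show "(\<Sum>n. \<Sum>i\<in>UNIV. ennreal (\<alpha> $ i) * emeasure (P i) (C n))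
        = (\<Sum>i\<in>UNIV. ennreal (\<alpha> $ i) * emeasure (P i) (\<Union>n. C n))" .
  qed
qed (fact assms(2))

section \<open>Hitting times\<close>

(* Infinite if the set is never hit, since the infimum of the empty set is top. *)
definition hitting_time ::
  "(real \<Rightarrow> 'w \<Rightarrow> 's) \<Rightarrow> ('k \<Rightarrow> 's set) \<Rightarrow> 'k \<Rightarrow> 'w \<Rightarrow> ereal" where
  "hitting_time X G k \<omega> = Inf (ereal ` {u. 0 < u \<and> X u \<omega> \<in> G k})"

definition not_hit_before ::
  "(real \<Rightarrow> 'w \<Rightarrow> 's) \<Rightarrow> ('k \<Rightarrow> 's set) \<Rightarrow> 'k set \<Rightarrow> real \<Rightarrow> 'w \<Rightarrow> 'k set" where
  "not_hit_before X G K u0 \<omega> = {k\<in>K. ereal u0 \<le> hitting_time X G k \<omega>}"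

section \<open>Ordered partitions of a set of indices\<close>

(* Components are numbered from 0: s ! n is the (n+1)-st component. *)

definition ordered_partition :: "'k set \<Rightarrow> 'k set list \<Rightarrow> bool" where
  "ordered_partition A s \<longleftrightarrow>
     (\<forall>c\<in>set s. c \<noteq> {}) \<and>
     (\<forall>m<length s. \<forall>n<length s. m \<noteq> n \<longrightarrow> s ! m \<inter> s ! n = {}) \<and>
     \<Union>(set s) = A"

definition first_elem :: "'k set \<Rightarrow> 'k" where
  "first_elem c = (SOME k. k \<in> c)"

(* Elements of R^A are extensional functions, as in PiM A. *)
definition region :: "'k set \<Rightarrow> 'k set list \<Rightarrow> ('k \<Rightarrow> real) set" where
  "region A s = {t \<in> A \<rightarrow>\<^sub>E {0..}.
     (\<forall>c\<in>set s. \<forall>k\<in>c. \<forall>l\<in>c. t k = t l) \<and>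
     (\<forall>m n. m < n \<and> n < length s \<longrightarrow> t (first_elem (s ! m)) < t (first_elem (s ! n)))}"

definition ordered_cone :: "nat \<Rightarrow> (nat \<Rightarrow> real) set" where
  "ordered_cone m = {r \<in> {..<m} \<rightarrow>\<^sub>E {0..}. \<forall>i j. i < j \<and> j < m \<longrightarrow> r i < r j}"

definition component_index :: "'k set list \<Rightarrow> 'k \<Rightarrow> nat" where
  "component_index s k = (THE n. n < length s \<and> k \<in> s ! n)"

(* The measure d_s t, regarded as a measure on all of R^A carried by region A s. *)
definition region_measure :: "'k set \<Rightarrow> 'k set list \<Rightarrow> ('k \<Rightarrow> real) measure" where
  "region_measure A s =
     distr (restrict_space (\<Pi>\<^sub>M n\<in>{..<length s}. (lborel :: real measure)) (ordered_cone (length s)))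
       (\<Pi>\<^sub>M k\<in>A. borel) (\<lambda>r. \<lambda>k\<in>A. r (component_index s k))"

section \<open>The density\<close>

definition sub_matrix :: "real^'s::finite^'s \<Rightarrow> 's set \<Rightarrow> 's set \<Rightarrow> real^'s^'s" where
  "sub_matrix lam a b = (\<chi> i j. if i \<in> a \<and> j \<in> b then lam $ i $ j else 0)"

(* The multiplication of the type real^'s^'s is componentwise, so exp is not the matrix
   exponential. *)
primrec matrix_power :: "real^'s::finite^'s \<Rightarrow> nat \<Rightarrow> real^'s^'s" where
  "matrix_power B 0 = mat 1"
| "matrix_power B (Suc n) = B ** matrix_power B n"

definition matrix_exp :: "real^'s::finite^'s \<Rightarrow> real^'s^'s" where
  "matrix_exp B = (\<Sum>n. (1 / fact n) *\<^sub>R matrix_power B n)"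

definition ordered_matrix_prod :: "(nat \<Rightarrow> real^'s::finite^'s) \<Rightarrow> nat \<Rightarrow> real^'s^'s" where
  "ordered_matrix_prod B m = foldr (**) (map B [0..<m]) (mat 1)"

definition target_union :: "('k \<Rightarrow> 's set) \<Rightarrow> 'k set list \<Rightarrow> 's set" where
  "target_union G s = (\<Union>c\<in>set s. \<Union>k\<in>c. G k)"

(* With components numbered from 1, waiting_set G s n is W_{n+1} and arrival_set G s n is
   T_{n+1}; drop n s is the shifted sequence L^n s. *)
definition waiting_set :: "('k \<Rightarrow> 's set) \<Rightarrow> 'k set list \<Rightarrow> nat \<Rightarrow> 's set" where
  "waiting_set G s n = UNIV - target_union G (drop n s)"

definition arrival_set :: "('k \<Rightarrow> 's set) \<Rightarrow> 'k set list \<Rightarrow> nat \<Rightarrow> 's set" where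
  "arrival_set G s n = (\<Inter>k\<in>s ! n. G k) \<inter> waiting_set G s (Suc n)"

(* The n-th value of t along the components numbered from 1, started at 0 for n = 0. *)
definition level_time :: "'k set list \<Rightarrow> ('k \<Rightarrow> real) \<Rightarrow> nat \<Rightarrow> real" where
  "level_time s t n = (if n = 0 then 0 else t (first_elem (s ! (n - 1))))"

(* f(beta,t,A) for t in region A s.  The partition s is an explicit argument; it determines A,
   and is itself determined by A and t. *)
definition hitting_density ::
  "real^'s::finite^'s \<Rightarrow> ('k \<Rightarrow> 's set) \<Rightarrow> 'k set list \<Rightarrow> real^'s \<Rightarrow> ('k \<Rightarrow> real) \<Rightarrow> real" where
  "hitting_density lam G s \<beta> t =
     (\<beta> v* ordered_matrix_prod
        (\<lambda>n. matrix_exp ((level_time s t (Suc n) - level_time s t n) *\<^sub>R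
                 sub_matrix lam (waiting_set G s n) (waiting_set G s n))
             ** sub_matrix lam (waiting_set G s n) (arrival_set G s n))
        (length s)) \<bullet> vec 1"

end

theory Submission
  imports Defs
begin

text \<open>Given the state at time \<open>u0\<close>, the Markov property on the path space reduces the claim to the law of
the hitting times under \<open>P i\<close> for a state \<open>i\<close> outside all the targets; a target that is still unhit at
\<open>u0\<close> is not occupied at \<open>u0\<close> since there are almost surely no fixed jump times.  That law is compared
with the density on boxes of pairwise separated time windows, which form an intersection-stable
generator of the cone of increasing vectors.  The event that the \<open>n\<close>-th group of targets is hit
exactly in the \<open>n\<close>-th window is a concatenation of two kinds of path events between deterministic
times: staying in a set, and jumping once from \<open>W\<close> through \<open>T\<close> into \<open>W'\<close>.  Two jumps in time \<open>h\<close> have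
probability \<open>O(h\<^sup>2)\<close>, so the kernels of these events have known derivatives at \<open>0\<close>; the semigroup law
then identifies the first with a matrix exponential, and the Duhamel equation the second with the
integral of \<open>exp (r A) B exp ((t - r) D)\<close> over \<open>0 \<le> r \<le> t\<close>.\<close>

section \<open>Square matrices as a Banach algebra\<close>

text \<open>The intensity is known only as a derivative at time 0, so no differential equation is
  solved. Two families obeying the same composition law are compared instead: after damping by exp
  (- c t), the norm of their difference is subadditive in t, and a subadditive nonnegative function
  with F h / h tending to 0 vanishes. Two obstacles shape the rest. The product sigma-algebra on
  paths sees only countably many times, whereas staying and jumping refer to all of them; hence path
  events are predicates matched with a measurable set on right-continuous paths only. And the
  assumed Markov property concerns a single later time, so it is extended first to cylinders and
  then to all measurable path sets. In the integration over boxes the density carries a trailing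
  exponential up to the end of the last window, so that every induction step starts at a
  deterministic time. It drops out at the end, because the last waiting set is the whole space and
  the rows of a transition matrix sum to 1.\<close>

lemma matrix_add_rdistrib:
  fixes A B :: "'a::semiring_1^'n^'m" and C :: "'a^'p^'n"
  shows "(A + B) ** C = A ** C + B ** C"
  by (simp add: vec_eq_iff matrix_matrix_mult_def sum.distrib distrib_right)

(* The product of the type real^'n^'n is componentwise; the copy carries the matrix product
   and the operator norm, so that the library's exp applies to it. *)
typedef (overloaded) 'n sqmat = "UNIV :: (real^'n::finite^'n) set"
  morphisms of_sqmat to_sqmat ..

setup_lifting type_definition_sqmat

instantiation sqmat :: (finite) ring_1
begin
lift_definition zero_sqmat :: "'a sqmat" is 0 .
lift_definition one_sqmat :: "'a sqmat" is "mat 1" .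
lift_definition plus_sqmat :: "'a sqmat \<Rightarrow> 'a sqmat \<Rightarrow> 'a sqmat" is "(+)" .
lift_definition minus_sqmat :: "'a sqmat \<Rightarrow> 'a sqmat \<Rightarrow> 'a sqmat" is "(-)" .
lift_definition uminus_sqmat :: "'a sqmat \<Rightarrow> 'a sqmat" is uminus .
lift_definition times_sqmat :: "'a sqmat \<Rightarrow> 'a sqmat \<Rightarrow> 'a sqmat" is "(**)" .
instance
proof
  fix a b c :: "'a sqmat"
  show "a * b * c = a * (b * c)" by transfer (simp add: matrix_mul_assoc)
  show "(a + b) * c = a * c + b * c"
    by transfer (simp add: vec_eq_iff matrix_matrix_mult_def sum.distrib distrib_right)
  show "a * (b + c) = a * b + a * c" by transfer (rule matrix_add_ldistrib)
  show "(0::'a sqmat) \<noteq> 1" by transfer (simp add: vec_eq_iff mat_def)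
qed (transfer; simp)+
end

instantiation sqmat :: (finite) real_algebra_1
begin
lift_definition scaleR_sqmat :: "real \<Rightarrow> 'a sqmat \<Rightarrow> 'a sqmat" is "scaleR" .
instance
  by standard
    (transfer; simp add: scaleR_add_right scaleR_add_left scalar_matrix_assoc matrix_scalar_ac; fail)+
end

instantiation sqmat :: (finite) real_normed_algebra_1
begin
lift_definition norm_sqmat :: "'a sqmat \<Rightarrow> real" is "\<lambda>A. onorm ((*v) A)" .
definition dist_sqmat :: "'a sqmat \<Rightarrow> 'a sqmat \<Rightarrow> real" where "dist_sqmat A B = norm (A - B)"
definition sgn_sqmat :: "'a sqmat \<Rightarrow> 'a sqmat" where "sgn_sqmat A = A /\<^sub>R norm A"
definition uniformity_sqmat :: "('a sqmat \<times> 'a sqmat) filter" where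
  "uniformity_sqmat = (INF e\<in>{0 <..}. principal {(x, y). dist x y < e})"
definition open_sqmat :: "'a sqmat set \<Rightarrow> bool" where
  "open_sqmat S = (\<forall>x\<in>S. \<forall>\<^sub>F (x', y) in uniformity. x' = x \<longrightarrow> y \<in> S)"
instance
proof
  fix x y :: "'a sqmat" and a :: real
  show "norm x = 0 \<longleftrightarrow> x = 0"
  proof transfer
    fix x :: "real^'a^'a"
    have "onorm ((*v) x) = 0 \<longleftrightarrow> (\<forall>v. x *v v = 0)"
      by (rule onorm_eq_0) (rule matrix_vector_mul_bounded_linear)
    then show "onorm ((*v) x) = 0 \<longleftrightarrow> x = 0"
      by (simp add: matrix_eq)
  qed
  show "norm (x + y) \<le> norm x + norm y"
  proof transfer
    fix x y :: "real^'a^'a"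
    show "onorm ((*v) (x + y)) \<le> onorm ((*v) x) + onorm ((*v) y)"
      unfolding matrix_vector_mult_add_rdistrib
      by (rule onorm_triangle) (rule matrix_vector_mul_bounded_linear)+
  qed
  show "norm (a *\<^sub>R x) = \<bar>a\<bar> * norm x"
  proof transfer
    fix a and x :: "real^'a^'a"
    show "onorm ((*v) (a *\<^sub>R x)) = \<bar>a\<bar> * onorm ((*v) x)"
      using onorm_scaleR[OF matrix_vector_mul_bounded_linear[of x], of a]
      by (simp add: scaleR_matrix_vector_assoc)
  qed
  show "norm (x * y) \<le> norm x * norm y"
  proof transfer
    fix x y :: "real^'a^'a"
    have "onorm ((*v) x \<circ> (*v) y) \<le> onorm ((*v) x) * onorm ((*v) y)"
      by (rule onorm_compose) (simp_all add: matrix_vector_mul_bounded_linear)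
    then show "onorm ((*v) (x ** y)) \<le> onorm ((*v) x) * onorm ((*v) y)"
      by (simp add: o_def matrix_vector_mul_assoc)
  qed
  show "norm (1::'a sqmat) = 1"
  proof transfer
    have "(*v) (mat 1) = (\<lambda>x::real^'a. x)" by (simp add: fun_eq_iff)
    then show "onorm ((*v) (mat 1 :: real^'a^'a)) = 1" using onorm_id[where 'a="real^'a"] by simp
  qed
qed (rule dist_sqmat_def sgn_sqmat_def uniformity_sqmat_def open_sqmat_def)+
end

text \<open>Each entry is at most the operator norm, so the vector norm is at most the square of
  \<open>CARD('n)\<close> times it. With the converse bound, automatic in finite dimension, limits
  and completeness pass between the two copies.\<close>

lemma bounded_linear_of_sqmat: "bounded_linear (of_sqmat :: 'n::finite sqmat \<Rightarrow> _)"
proof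
  show "of_sqmat (x + y) = of_sqmat x + of_sqmat y" for x y :: "'n sqmat" by transfer simp
  show "of_sqmat (r *\<^sub>R x) = r *\<^sub>R of_sqmat x" for r and x :: "'n sqmat" by transfer simp
  have "norm A \<le> onorm ((*v) A) * (real CARD('n) * real CARD('n))" for A :: "real^'n^'n"
  proof -
    have "norm A \<le> (\<Sum>i\<in>UNIV. norm (A $ i))" by (simp add: norm_vec_def L2_set_le_sum)
    also have "\<dots> \<le> (\<Sum>i\<in>UNIV. \<Sum>j\<in>UNIV. \<bar>A $ i $ j\<bar>)"
      by (intro sum_mono norm_le_l1_cart)
    also have "\<dots> \<le> (\<Sum>i\<in>(UNIV::'n set). \<Sum>j\<in>(UNIV::'n set). onorm ((*v) A))"
      by (intro sum_mono matrix_component_le_onorm)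
    finally show ?thesis by (simp add: mult_ac)
  qed
  then show "\<exists>K. \<forall>x::'n sqmat. norm (of_sqmat x) \<le> norm x * K"
    unfolding norm_sqmat.rep_eq by blast
qed

lemma linear_to_sqmat: "linear (to_sqmat :: _ \<Rightarrow> 'n::finite sqmat)"
  by (rule linearI; transfer) simp_all

lemma bounded_linear_to_sqmat: "bounded_linear (to_sqmat :: _ \<Rightarrow> 'n::finite sqmat)"
  using linear_to_sqmat linear_conv_bounded_linear by blast

instance sqmat :: (finite) banach
proof
  fix X :: "nat \<Rightarrow> 'a sqmat" assume "Cauchy X"
  then have "Cauchy (\<lambda>n. of_sqmat (X n))"
    by (rule bounded_linear.Cauchy[OF bounded_linear_of_sqmat])
  then obtain L where "(\<lambda>n. of_sqmat (X n)) \<longlonglongrightarrow> L"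
    using Cauchy_convergent_iff convergent_def by blast
  then have "(\<lambda>n. to_sqmat (of_sqmat (X n))) \<longlonglongrightarrow> to_sqmat L"
    by (rule bounded_linear.tendsto[OF bounded_linear_to_sqmat])
  then show "convergent X" by (auto simp: of_sqmat_inverse convergent_def)
qed

lemma of_sqmat_times [simp]: "of_sqmat (A * B) = of_sqmat A ** of_sqmat B"
  by transfer simp

lemma of_sqmat_one [simp]: "of_sqmat 1 = mat 1"
  by transfer simp

lemma of_sqmat_power: "of_sqmat (A ^ n) = matrix_power (of_sqmat A) n"
  by (induction n) simp_all

lemma to_sqmat_inverse' [simp]: "of_sqmat (to_sqmat A) = A"
  by (simp add: to_sqmat_inverse)

text \<open>The only place where the series is used: the functional equation and the derivative of
  the exponential are then inherited from \<open>exp\<close>.\<close>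

lemma matrix_exp_conv_exp: "matrix_exp B = of_sqmat (exp (to_sqmat B))"
proof -
  have "(\<lambda>n. of_sqmat (to_sqmat B ^ n /\<^sub>R fact n)) sums of_sqmat (exp (to_sqmat B))"
    by (intro bounded_linear.sums[OF bounded_linear_of_sqmat] exp_converges)
  then have "(\<lambda>n. (1 / fact n) *\<^sub>R matrix_power B n) sums of_sqmat (exp (to_sqmat B))"
    by (simp add: of_sqmat_power divide_inverse
        linear_scale[OF bounded_linear.linear[OF bounded_linear_of_sqmat]])
  then show ?thesis unfolding matrix_exp_def by (rule sums_unique[symmetric])
qed

lemma to_sqmat_scaleR: "to_sqmat (c *\<^sub>R B) = c *\<^sub>R to_sqmat B"
  by (rule linear_scale[OF linear_to_sqmat])

section \<open>Semigroups determined by their derivative at zero\<close>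

text \<open>Iterated subadditivity gives F t <= n F (t / n), which is t times the difference
  quotient at t / n and tends to 0. This is the uniqueness principle that stands in for a Gronwall
  argument.\<close>

lemma subadditive_vanishing:
  fixes F :: "real \<Rightarrow> real"
  assumes nonneg: "\<And>t. 0 \<le> t \<Longrightarrow> 0 \<le> F t"
    and sub: "\<And>t h. 0 \<le> t \<Longrightarrow> 0 \<le> h \<Longrightarrow> F (t + h) \<le> F t + F h"
    and lim: "((\<lambda>h. F h / h) \<longlongrightarrow> 0) (at_right 0)"
    and t: "0 < t"
  shows "F t = 0"
proof -
  have mult: "F (real (Suc n) * h) \<le> real (Suc n) * F h" if "0 \<le> h" for n h
  proof (induction n)
    case (Suc n)
    have "F (real (Suc (Suc n)) * h) = F (real (Suc n) * h + h)" by (simp add: algebra_simps)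
    also have "\<dots> \<le> F (real (Suc n) * h) + F h" using that by (intro sub) simp_all
    finally show ?case using Suc by (simp add: algebra_simps)
  qed simp
  have "filterlim (\<lambda>n. t / real (Suc n)) (at_right 0) sequentially"
    unfolding filterlim_at
    using t LIMSEQ_Suc[OF lim_const_over_n[of t]] by (simp add: eventually_sequentially)
  then have "(\<lambda>n. F (t / real (Suc n)) / (t / real (Suc n))) \<longlonglongrightarrow> 0"
    by (rule filterlim_compose[OF lim])
  then have "(\<lambda>n. t * (F (t / real (Suc n)) / (t / real (Suc n)))) \<longlonglongrightarrow> t * 0"
    by (rule tendsto_mult_left)
  then have "F t \<le> t * 0"
  proof (rule LIMSEQ_le_const, intro exI allI impI)
    fix n
    have "F t = F (real (Suc n) * (t / real (Suc n)))" by (simp del: of_nat_Suc)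
    also have "\<dots> \<le> real (Suc n) * F (t / real (Suc n))" using t by (intro mult) simp
    also have "\<dots> = t * (F (t / real (Suc n)) / (t / real (Suc n)))" using t by (simp add: field_simps)
    finally show "F t \<le> t * (F (t / real (Suc n)) / (t / real (Suc n)))" .
  qed
  then show ?thesis using nonneg[of t] t by simp
qed

lemma norm_exp_scaleR_le:
  fixes A :: "'a::{real_normed_algebra_1,banach}"
  assumes "0 \<le> t"
  shows "norm (exp (t *\<^sub>R A)) \<le> exp (t * norm A)"
  using norm_exp[of "t *\<^sub>R A"] assms by simp

lemma exp_scaleR_add:
  fixes A :: "'a::{real_normed_algebra_1,banach}"
  shows "exp ((s + t) *\<^sub>R A) = exp (s *\<^sub>R A) * exp (t *\<^sub>R A)"
  by (simp add: scaleR_add_left exp_add_commuting)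

lemma exp_scaleR_deriv_0:
  fixes A :: "'a::{real_normed_algebra_1,banach}"
  shows "((\<lambda>h. (exp (h *\<^sub>R A) - 1) /\<^sub>R h) \<longlongrightarrow> A) (at_right 0)"
proof -
  have "((\<lambda>t. exp (t *\<^sub>R A)) has_vector_derivative A) (at 0 within {0<..})"
    using exp_scaleR_has_vector_derivative_right[of A 0] has_vector_derivative_at_within by fastforce
  then have "((\<lambda>h. (1 / norm (h - 0)) *\<^sub>R (exp (h *\<^sub>R A) - (exp (0 *\<^sub>R A) + (h - 0) *\<^sub>R A))) \<longlongrightarrow> 0)
      (at_right 0)"
    unfolding has_vector_derivative_def has_derivative_within by simp
  then have "((\<lambda>h. (exp (h *\<^sub>R A) - 1) /\<^sub>R h - A) \<longlongrightarrow> 0) (at_right 0)"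
    by (rule Lim_transform_eventually)
      (auto simp: eventually_at_filter algebra_simps divide_inverse)
  then show ?thesis by (simp add: LIM_zero_iff)
qed

text \<open>Both sides are semigroups with the same derivative at 0, and their damped distance
  satisfies the hypotheses of \<open>subadditive_vanishing\<close>.\<close>

lemma semigroup_eq_exp:
  fixes Q :: "real \<Rightarrow> 'a::{real_normed_algebra_1,banach}"
  assumes semi: "\<And>t h. 0 \<le> t \<Longrightarrow> 0 \<le> h \<Longrightarrow> Q (t + h) = Q t * Q h"
    and Q0: "Q 0 = 1"
    and lim: "((\<lambda>h. (Q h - 1) /\<^sub>R h) \<longlongrightarrow> A) (at_right 0)"
    and t: "0 \<le> t"
  shows "Q t = exp (t *\<^sub>R A)"
proof -
  have "((\<lambda>h. norm ((Q h - 1) /\<^sub>R h)) \<longlongrightarrow> norm A) (at_right 0)"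
    by (intro tendsto_norm lim)
  then have "\<forall>\<^sub>F h in at_right 0. norm ((Q h - 1) /\<^sub>R h) < norm A + 1"
    by (rule order_tendstoD) simp
  then obtain d where d: "0 < d" "\<And>h. 0 < h \<Longrightarrow> h < d \<Longrightarrow> norm ((Q h - 1) /\<^sub>R h) < norm A + 1"
    unfolding eventually_at_right_field by auto
  \<comment> \<open>The growth rate must serve both semigroups: \<open>norm A\<close> bounds the
    exponential, and the extra 1 absorbs the error of the difference quotient of \<open>Q\<close>
    near 0.\<close>
  define c where "c = norm A + 1"
  have c: "0 < c" "norm A \<le> c" unfolding c_def using norm_ge_zero[of A] by linarith+
  have small: "norm (Q h) \<le> exp (c * h)" if "0 \<le> h" "h < d" for h
  proof (cases "h = 0")
    case False
    then have "norm (Q h - 1) < c * h"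
      using d(2)[of h] that by (simp add: c_def pos_divide_less_eq mult.commute divide_inverse_commute[symmetric])
    moreover have "norm (Q h) \<le> norm (Q h - 1) + 1"
      using norm_triangle_ineq[of "Q h - 1" 1] by simp
    ultimately have "norm (Q h) \<le> 1 + c * h" by linarith
    also have "\<dots> \<le> exp (c * h)" by (rule exp_ge_add_one_self)
    finally show ?thesis .
  qed (simp add: Q0)
  \<comment> \<open>The bound near 0 spreads to all times by cutting \<open>h\<close> into equal
    pieces shorter than \<open>d\<close>.\<close>
  have bound: "norm (Q h) \<le> exp (c * h)" if "0 \<le> h" for h
  proof -
    have pow: "Q (real n * x) = Q x ^ n" if "0 \<le> x" for n x
    proof (induction n)
      case (Suc n)
      have "Q (real (Suc n) * x) = Q (x + real n * x)" by (simp add: algebra_simps)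
      then show ?case using Suc semi[of x "real n * x"] that by simp
    qed (simp add: Q0)
    obtain n where n: "h / d < real n" using reals_Archimedean2 by blast
    have "0 \<le> h / d" using that d(1) by simp
    then have n0: "0 < real n" using n by linarith
    then have hn: "0 \<le> h / real n" "h / real n < d" using that n d(1) by (simp_all add: field_simps)
    have "norm (Q h) = norm (Q (h / real n) ^ n)" using pow[of "h / real n" n] hn n0 by simp
    also have "\<dots> \<le> norm (Q (h / real n)) ^ n" by (rule norm_power_ineq)
    also have "\<dots> \<le> exp (c * (h / real n)) ^ n" using hn by (intro power_mono small) simp_all
    also have "\<dots> = exp (c * h)" using n0 by (simp flip: exp_of_nat_mult)
    finally show ?thesis .
  qed
  have expb: "norm (exp (h *\<^sub>R A)) \<le> exp (c * h)" if "0 \<le> h" for h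
    using norm_exp_scaleR_le[OF that, of A] mult_right_mono[OF c(2) that]
    by (metis exp_le_cancel_iff mult.commute order_trans)
  define F where "F t = exp (- (c * t)) * norm (Q t - exp (t *\<^sub>R A))" for t
  have "F t = 0" if "0 < t"
  proof (rule subadditive_vanishing[OF _ _ _ that])
    fix t h :: real assume th: "0 \<le> t" "0 \<le> h"
    \<comment> \<open>Telescoping: one factor is exchanged at a time, so each term contains a single
      difference next to a factor of controlled growth.\<close>
    have "Q (t + h) - exp ((t + h) *\<^sub>R A)
        = Q t * (Q h - exp (h *\<^sub>R A)) + (Q t - exp (t *\<^sub>R A)) * exp (h *\<^sub>R A)"
      unfolding semi[OF th] exp_scaleR_add by (simp add: algebra_simps)
    then have "norm (Q (t + h) - exp ((t + h) *\<^sub>R A))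
        \<le> norm (Q t) * norm (Q h - exp (h *\<^sub>R A)) + norm (Q t - exp (t *\<^sub>R A)) * norm (exp (h *\<^sub>R A))"
      by (smt (verit) norm_triangle_ineq norm_mult_ineq)
    also have "\<dots> \<le> exp (c * t) * norm (Q h - exp (h *\<^sub>R A)) + norm (Q t - exp (t *\<^sub>R A)) * exp (c * h)"
      using bound[OF th(1)] expb[OF th(2)] by (intro add_mono mult_mono) simp_all
    finally have "F (t + h) \<le> exp (- (c * (t + h))) *
        (exp (c * t) * norm (Q h - exp (h *\<^sub>R A)) + norm (Q t - exp (t *\<^sub>R A)) * exp (c * h))"
      unfolding F_def by (intro mult_left_mono) simp_all
    also have "\<dots> = F t + F h"
    proof -
      have "exp (- (c * (t + h))) * exp (c * t) = exp (- (c * h))"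
        "exp (- (c * (t + h))) * exp (c * h) = exp (- (c * t))"
        by (simp_all add: mult_exp_exp algebra_simps)
      then show ?thesis unfolding F_def by (simp add: distrib_left flip: mult.assoc)
    qed
    finally show "F (t + h) \<le> F t + F h" .
  next
    have "((\<lambda>h. exp (- (c * h)) * norm ((Q h - 1) /\<^sub>R h - (exp (h *\<^sub>R A) - 1) /\<^sub>R h))
        \<longlongrightarrow> exp (- (c * 0)) * norm (A - A)) (at_right 0)"
      by (intro tendsto_intros lim exp_scaleR_deriv_0)
    then have "((\<lambda>h. exp (- (c * h)) * norm ((Q h - 1) /\<^sub>R h - (exp (h *\<^sub>R A) - 1) /\<^sub>R h))
        \<longlongrightarrow> 0) (at_right 0)" by simp
    then show "((\<lambda>h. F h / h) \<longlongrightarrow> 0) (at_right 0)"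
    proof (rule Lim_transform_eventually)
      show "\<forall>\<^sub>F h in at_right 0. exp (- (c * h)) * norm ((Q h - 1) /\<^sub>R h - (exp (h *\<^sub>R A) - 1) /\<^sub>R h) = F h / h"
        unfolding eventually_at_filter
        by (rule always_eventually)
          (auto simp: F_def divide_inverse simp flip: scaleR_diff_right)
    qed
  qed (simp add: F_def)
  with t show ?thesis by (cases "t = 0") (simp_all add: F_def Q0)
qed

lemma continuous_on_exp_scaleR [continuous_intros]:
  fixes A :: "'a::{real_normed_algebra_1,banach}"
  assumes "continuous_on S f"
  shows "continuous_on S (\<lambda>x. exp (f x *\<^sub>R A))"
proof -
  have "continuous_on UNIV (\<lambda>t. exp (t *\<^sub>R A))"
    by (intro continuous_at_imp_continuous_on ballI
        has_vector_derivative_continuous[OF exp_scaleR_has_vector_derivative_right])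
  from continuous_on_compose2[OF this assms] show ?thesis by simp
qed

text \<open>Multiplying \<open>H\<close> on the right by exp (- t D) turns the equation into the
  identity \<open>Gstep\<close>. The integral \<open>L\<close> of exp (r A) B exp (- r D) satisfies
  the same identity and has the same derivative at 0, so the damped difference vanishes by
  \<open>subadditive_vanishing\<close>.\<close>

lemma Duhamel_unique:
  fixes A D B :: "'a::{real_normed_algebra_1,banach}" and H :: "real \<Rightarrow> 'a"
  assumes step: "\<And>t h. 0 \<le> t \<Longrightarrow> 0 \<le> h \<Longrightarrow>
      H (t + h) = H t * exp (h *\<^sub>R D) + exp (t *\<^sub>R A) * H h"
    and lim: "((\<lambda>h. H h /\<^sub>R h) \<longlongrightarrow> B) (at_right 0)"
    and t: "0 \<le> t"
  shows "((\<lambda>r. exp (r *\<^sub>R A) * B * exp ((t - r) *\<^sub>R D)) has_integral H t) {0..t}"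
proof -
  have H0: "H 0 = 0" using step[of 0 0] by simp
  define g where "g r = exp (r *\<^sub>R A) * B * exp ((- r) *\<^sub>R D)" for r
  have gc: "continuous_on S g" for S unfolding g_def by (intro continuous_intros)
  define L where "L t = integral {0..t} g" for t
  define G where "G t = H t * exp ((- t) *\<^sub>R D)" for t
  have inv: "exp ((- h) *\<^sub>R D) * exp (h *\<^sub>R D) = 1" "exp (h *\<^sub>R D) * exp ((- h) *\<^sub>R D) = 1" for h
    using exp_scaleR_add[of "- h" h D] exp_scaleR_add[of h "- h" D] by simp_all
  have Gstep: "G (t + h) = G t + exp (t *\<^sub>R A) * G h * exp ((- t) *\<^sub>R D)"
    if "0 \<le> t" "0 \<le> h" for t h
  proof -
    have "- (t + h) = - h + - t" by simp
    then have "exp ((- (t + h)) *\<^sub>R D) = exp ((- h) *\<^sub>R D) * exp ((- t) *\<^sub>R D)"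
      by (simp only: exp_scaleR_add)
    then have "G (t + h) = H t * (exp (h *\<^sub>R D) * exp ((- h) *\<^sub>R D)) * exp ((- t) *\<^sub>R D)
        + exp (t *\<^sub>R A) * (H h * exp ((- h) *\<^sub>R D)) * exp ((- t) *\<^sub>R D)"
      unfolding G_def step[OF that] by (simp only: distrib_right mult.assoc)
    then show ?thesis unfolding inv G_def by simp
  qed
  \<comment> \<open>The integral over the second piece is the one over \<open>{0..h}\<close> shifted
    by \<open>t\<close>; the two exponentials release their factors at \<open>t\<close> on opposite
    sides.\<close>
  have Lstep: "L (t + h) = L t + exp (t *\<^sub>R A) * L h * exp ((- t) *\<^sub>R D)"
    if th: "0 \<le> t" "0 \<le> h" for t h
  proof -
    have 1: "(g has_integral L h) {0..h}"
      unfolding L_def by (intro integrable_integral integrable_continuous_real gc)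
    have "((\<lambda>x. exp (t *\<^sub>R A) * (g x * exp ((- t) *\<^sub>R D))) has_integral
        exp (t *\<^sub>R A) * (L h * exp ((- t) *\<^sub>R D))) {0..h}"
      by (intro has_integral_mult_right has_integral_mult_left 1)
    also have "(\<lambda>x. exp (t *\<^sub>R A) * (g x * exp ((- t) *\<^sub>R D))) = (\<lambda>x. g (x + t))"
    proof
      fix x
      have "- (x + t) = - x + - t" by simp
      then have "exp ((- (x + t)) *\<^sub>R D) = exp ((- x) *\<^sub>R D) * exp ((- t) *\<^sub>R D)"
        by (simp only: exp_scaleR_add)
      moreover have "exp ((x + t) *\<^sub>R A) = exp (t *\<^sub>R A) * exp (x *\<^sub>R A)"
        by (simp only: exp_scaleR_add add.commute[of x t])
      ultimately show "exp (t *\<^sub>R A) * (g x * exp ((- t) *\<^sub>R D)) = g (x + t)"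
        by (simp add: g_def mult.assoc)
    qed
    finally have "(g has_integral exp (t *\<^sub>R A) * (L h * exp ((- t) *\<^sub>R D))) {t..t + h}"
      using has_integral_shift_Icc_real[of g t "exp (t *\<^sub>R A) * (L h * exp ((- t) *\<^sub>R D))" 0 h]
      by (simp add: add.commute o_def)
    moreover have "(g has_integral L t) {0..t}"
      unfolding L_def by (intro integrable_integral integrable_continuous_real gc)
    ultimately have "(g has_integral L t + exp (t *\<^sub>R A) * (L h * exp ((- t) *\<^sub>R D))) {0..t + h}"
      using th by (intro has_integral_combine[of 0 t "t + h"]) simp_all
    then show ?thesis unfolding L_def by (simp add: integral_unique mult.assoc)
  qed
  \<comment> \<open>An increment is multiplied by one exponential from each side, so their growth
    rates add.\<close>
  define c where "c = norm A + norm D"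
  define F where "F t = exp (- (c * t)) * norm (G t - L t)" for t
  have "F t = 0" if "0 < t"
  proof (rule subadditive_vanishing[OF _ _ _ that])
    fix t h :: real assume th: "0 \<le> t" "0 \<le> h"
    have "G (t + h) - L (t + h) = (G t - L t) + exp (t *\<^sub>R A) * (G h - L h) * exp ((- t) *\<^sub>R D)"
      unfolding Gstep[OF th] Lstep[OF th] by (simp add: algebra_simps)
    then have "norm (G (t + h) - L (t + h))
        \<le> norm (G t - L t) + norm (exp (t *\<^sub>R A)) * norm (G h - L h) * norm (exp ((- t) *\<^sub>R D))"
      by (smt (verit) norm_triangle_ineq norm_mult_ineq mult_right_mono norm_ge_zero)
    also have "\<dots> \<le> norm (G t - L t) + exp (t * norm A) * norm (G h - L h) * exp (t * norm D)"
      using norm_exp_scaleR_le[OF th(1), of A] norm_exp_scaleR_le[OF th(1), of "- D"]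
      by (intro add_left_mono mult_mono) simp_all
    also have "\<dots> = norm (G t - L t) + exp (c * t) * norm (G h - L h)"
      by (simp add: c_def exp_add algebra_simps)
    finally have "F (t + h) \<le> exp (- (c * (t + h))) * (norm (G t - L t) + exp (c * t) * norm (G h - L h))"
      unfolding F_def by (intro mult_left_mono) simp_all
    also have "\<dots> = exp (- (c * h)) * F t + F h"
    proof -
      have "exp (- (c * (t + h))) = exp (- (c * h)) * exp (- (c * t))"
        "exp (- (c * (t + h))) * exp (c * t) = exp (- (c * h))"
        by (simp_all add: mult_exp_exp algebra_simps)
      then show ?thesis unfolding F_def by (simp add: distrib_left flip: mult.assoc)
    qed
    also have "\<dots> \<le> F t + F h"
    proof -
      have "0 \<le> c" by (simp add: c_def)
      then show ?thesis using th by (intro add_right_mono mult_left_le_one_le) (simp_all add: F_def)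
    qed
    finally show "F (t + h) \<le> F t + F h" .
  next
    have L0: "((\<lambda>h. L h /\<^sub>R h) \<longlongrightarrow> B) (at_right 0)"
    proof -
      have "(L has_vector_derivative g 0) (at 0 within {0..1})"
        unfolding L_def by (rule integral_has_vector_derivative) (simp_all add: gc)
      then have "((\<lambda>h. (1 / norm (h - 0)) *\<^sub>R (L h - (L 0 + (h - 0) *\<^sub>R g 0))) \<longlongrightarrow> 0) (at 0 within {0..1})"
        unfolding has_vector_derivative_def has_derivative_within by simp
      then have "((\<lambda>h. (1 / norm (h - 0)) *\<^sub>R (L h - (L 0 + (h - 0) *\<^sub>R g 0))) \<longlongrightarrow> 0) (at_right 0)"
        by (simp add: at_within_Icc_at_right)
      then have "((\<lambda>h. L h /\<^sub>R h - B) \<longlongrightarrow> 0) (at_right 0)"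
        by (rule Lim_transform_eventually)
          (auto simp: eventually_at_filter algebra_simps divide_inverse L_def g_def)
      then show ?thesis by (simp add: LIM_zero_iff)
    qed
    have "isCont (\<lambda>h. exp ((- h) *\<^sub>R D)) 0"
      by (rule continuous_on_interior[of UNIV]) (intro continuous_intros, simp)
    then have E0: "((\<lambda>h. exp ((- h) *\<^sub>R D)) \<longlongrightarrow> exp ((- 0) *\<^sub>R D)) (at_right 0)"
      unfolding isCont_def by (rule tendsto_mono[OF at_le, rotated]) simp
    have "((\<lambda>h. exp (- (c * h)) * norm (H h /\<^sub>R h * exp ((- h) *\<^sub>R D) - L h /\<^sub>R h))
        \<longlongrightarrow> exp (- (c * 0)) * norm (B * exp ((- 0) *\<^sub>R D) - B)) (at_right 0)"
      by (intro tendsto_intros lim L0 E0)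
    then have "((\<lambda>h. exp (- (c * h)) * norm (H h /\<^sub>R h * exp ((- h) *\<^sub>R D) - L h /\<^sub>R h))
        \<longlongrightarrow> 0) (at_right 0)" by simp
    then show "((\<lambda>h. F h / h) \<longlongrightarrow> 0) (at_right 0)"
    proof (rule Lim_transform_eventually)
      show "\<forall>\<^sub>F h in at_right 0.
          exp (- (c * h)) * norm (H h /\<^sub>R h * exp ((- h) *\<^sub>R D) - L h /\<^sub>R h) = F h / h"
        unfolding eventually_at_filter
        by (rule always_eventually)
          (auto simp: F_def G_def divide_inverse simp flip: scaleR_diff_right)
    qed
  qed (simp add: F_def)
  then have GL: "G t = L t" using t by (cases "t = 0") (simp_all add: F_def G_def L_def H0)
  \<comment> \<open>Undoing the substitution: right multiplication by exp (t D) turns exp (- r D)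
    into exp ((t - r) D).\<close>
  have "(g has_integral L t) {0..t}"
    unfolding L_def by (intro integrable_integral integrable_continuous_real gc)
  then have "((\<lambda>r. g r * exp (t *\<^sub>R D)) has_integral L t * exp (t *\<^sub>R D)) {0..t}"
    by (rule has_integral_mult_left)
  also have "(\<lambda>r. g r * exp (t *\<^sub>R D)) = (\<lambda>r. exp (r *\<^sub>R A) * B * exp ((t - r) *\<^sub>R D))"
  proof
    fix r
    have "t - r = - r + t" by simp
    then have "exp ((t - r) *\<^sub>R D) = exp ((- r) *\<^sub>R D) * exp (t *\<^sub>R D)"
      by (simp only: exp_scaleR_add)
    then show "g r * exp (t *\<^sub>R D) = exp (r *\<^sub>R A) * B * exp ((t - r) *\<^sub>R D)"
      by (simp add: g_def mult.assoc)
  qed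
  also have "L t * exp (t *\<^sub>R D) = H t"
    using inv[of t] by (simp flip: GL add: G_def mult.assoc)
  finally show ?thesis .
qed

section \<open>The matrix exponential\<close>

lemma matrix_exp_scaleR: "matrix_exp (t *\<^sub>R A) = of_sqmat (exp (t *\<^sub>R to_sqmat A))"
  by (simp add: matrix_exp_conv_exp to_sqmat_scaleR)

lemma matrix_exp_0 [simp]: "matrix_exp 0 = mat 1"
  using matrix_exp_scaleR[of 0 0] by simp

lemma matrix_exp_add: "matrix_exp ((s + t) *\<^sub>R A) = matrix_exp (s *\<^sub>R A) ** matrix_exp (t *\<^sub>R A)"
  by (simp add: matrix_exp_scaleR exp_scaleR_add)

lemma continuous_on_matrix_exp [continuous_intros]:
  "continuous_on S f \<Longrightarrow> continuous_on S (\<lambda>x. matrix_exp (f x *\<^sub>R A))"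
  unfolding matrix_exp_scaleR
  by (intro bounded_linear.continuous_on[OF bounded_linear_of_sqmat] continuous_intros)

lemma to_sqmat_mult: "to_sqmat (A ** B) = to_sqmat A * to_sqmat B"
  by (simp add: of_sqmat_inject[symmetric])

lemma to_sqmat_mat_1: "to_sqmat (mat 1) = 1"
  by (simp add: of_sqmat_inject[symmetric])

lemma matrix_semigroup_eq_exp:
  fixes Q :: "real \<Rightarrow> real^'n::finite^'n"
  assumes semi: "\<And>t h. 0 \<le> t \<Longrightarrow> 0 \<le> h \<Longrightarrow> Q (t + h) = Q t ** Q h"
    and Q0: "Q 0 = mat 1"
    and lim: "((\<lambda>h. (Q h - mat 1) /\<^sub>R h) \<longlongrightarrow> A) (at_right 0)"
    and t: "0 \<le> t"
  shows "Q t = matrix_exp (t *\<^sub>R A)"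
proof -
  have "to_sqmat (Q t) = exp (t *\<^sub>R to_sqmat A)"
  proof (rule semigroup_eq_exp[OF _ _ _ t])
    show "((\<lambda>h. (to_sqmat (Q h) - 1) /\<^sub>R h) \<longlongrightarrow> to_sqmat A) (at_right 0)"
      using bounded_linear.tendsto[OF bounded_linear_to_sqmat lim]
      by (simp add: to_sqmat_scaleR linear_diff[OF linear_to_sqmat] to_sqmat_mat_1)
  qed (simp_all add: semi Q0 to_sqmat_mult to_sqmat_mat_1)
  then show ?thesis by (metis matrix_exp_scaleR to_sqmat_inverse')
qed

lemma matrix_Duhamel_unique:
  fixes A D B :: "real^'n::finite^'n" and H :: "real \<Rightarrow> real^'n^'n"
  assumes step: "\<And>t h. 0 \<le> t \<Longrightarrow> 0 \<le> h \<Longrightarrow>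
      H (t + h) = H t ** matrix_exp (h *\<^sub>R D) + matrix_exp (t *\<^sub>R A) ** H h"
    and lim: "((\<lambda>h. H h /\<^sub>R h) \<longlongrightarrow> B) (at_right 0)"
    and t: "0 \<le> t"
  shows "((\<lambda>r. matrix_exp (r *\<^sub>R A) ** B ** matrix_exp ((t - r) *\<^sub>R D)) has_integral H t) {0..t}"
proof -
  have "((\<lambda>r. exp (r *\<^sub>R to_sqmat A) * to_sqmat B * exp ((t - r) *\<^sub>R to_sqmat D))
      has_integral to_sqmat (H t)) {0..t}"
  proof (rule Duhamel_unique[OF _ _ t])
    fix t h :: real assume "0 \<le> t" "0 \<le> h"
    then show "to_sqmat (H (t + h)) = to_sqmat (H t) * exp (h *\<^sub>R to_sqmat D)
        + exp (t *\<^sub>R to_sqmat A) * to_sqmat (H h)"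
      by (simp add: step linear_add[OF linear_to_sqmat] to_sqmat_mult matrix_exp_scaleR of_sqmat_inverse)
  next
    show "((\<lambda>h. to_sqmat (H h) /\<^sub>R h) \<longlongrightarrow> to_sqmat B) (at_right 0)"
      using bounded_linear.tendsto[OF bounded_linear_to_sqmat lim] by (simp add: to_sqmat_scaleR)
  qed
  from has_integral_linear[OF this bounded_linear_of_sqmat]
  show ?thesis by (simp add: o_def matrix_exp_scaleR)
qed

section \<open>Right-continuous paths\<close>

text \<open>A functional of a single path, so that it can be applied to shifted paths as
  well.\<close>

definition hit :: "'s set \<Rightarrow> (real \<Rightarrow> 's) \<Rightarrow> ereal" where
  "hit B x = Inf (ereal ` {u. 0 < u \<and> x u \<in> B})"

lemma hitting_time_conv_hit: "hitting_time X G k \<omega> = hit (G k) (\<lambda>u. X u \<omega>)"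
  by (simp add: hitting_time_def hit_def)

lemma right_continuous_pathE:
  assumes "right_continuous_path x" "0 \<le> u"
  obtains e where "0 < e" "\<And>v. u \<le> v \<Longrightarrow> v < u + e \<Longrightarrow> x v = x u"
proof -
  have "\<forall>\<^sub>F v in at_right u. x v = x u" using assms by (simp add: right_continuous_path_def)
  then obtain b where b: "u < b" "\<And>v. u < v \<Longrightarrow> v < b \<Longrightarrow> x v = x u"
    unfolding eventually_at_right_field by auto
  show ?thesis
  proof (rule that[of "b - u"])
    show "x v = x u" if "u \<le> v" "v < u + (b - u)" for v using b(2)[of v] that by (cases "u = v") auto
  qed (use b in simp)
qed

lemma right_continuous_path_rat:
  assumes "right_continuous_path x" "0 \<le> u" "u < d"
  obtains q where "q \<in> \<rat>" "u < q" "q < d" "x q = x u"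
proof -
  obtain e where e: "0 < e" "\<And>v. u \<le> v \<Longrightarrow> v < u + e \<Longrightarrow> x v = x u"
    by (rule right_continuous_pathE[OF assms(1,2)]) blast
  obtain q where "q \<in> \<rat>" "u < q" "q < min d (u + e)"
    using Rats_dense_in_real[of u "min d (u + e)"] assms e(1) by auto
  with e(2)[of q] show ?thesis by (intro that[of q]) auto
qed

text \<open>The path is constant just to the right of the infimum \<open>r\<close>, and target
  states occur at times arbitrarily close to \<open>r\<close> from that side or at \<open>r\<close>;
  hence the state at \<open>r\<close> is already a target state.\<close>

lemma hit_attained:
  assumes "right_continuous_path x" "hit B x = ereal r"
  shows "0 \<le> r" "x r \<in> B"
proof -
  let ?S = "{u. 0 < u \<and> x u \<in> B}"
  have "0 \<le> hit B x" unfolding hit_def by (intro Inf_greatest) auto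
  then show r: "0 \<le> r" using assms(2) by simp
  obtain e where e: "0 < e" "\<And>v. r \<le> v \<Longrightarrow> v < r + e \<Longrightarrow> x v = x r"
    by (rule right_continuous_pathE[OF assms(1) r]) blast
  have "Inf (ereal ` ?S) < ereal (r + e)" using assms(2) e(1) by (simp add: hit_def)
  then obtain u where u: "0 < u" "x u \<in> B" "u < r + e" unfolding Inf_less_iff by auto
  have "hit B x \<le> ereal u" unfolding hit_def using u by (intro Inf_lower) auto
  then have "r \<le> u" using assms(2) by simp
  then show "x r \<in> B" using e(2)[of u] u by simp
qed

lemma hit_le: "0 < u \<Longrightarrow> x u \<in> B \<Longrightarrow> hit B x \<le> ereal u"
  unfolding hit_def by (intro Inf_lower) auto

text \<open>Starting outside \<open>B\<close> excludes the value 0, which a right-continuous path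
  starting in \<open>B\<close> would have; the rest is attainment of the infimum.\<close>

lemma hit_eq_iff:
  assumes "right_continuous_path x" "x 0 \<notin> B"
  shows "hit B x = ereal r \<longleftrightarrow> 0 < r \<and> x r \<in> B \<and> (\<forall>u. 0 \<le> u \<and> u < r \<longrightarrow> x u \<notin> B)"
proof
  assume h: "hit B x = ereal r"
  have "x u \<notin> B" if "0 \<le> u" "u < r" for u
    using hit_le[of u x B] h that assms(2) by (cases "u = 0") auto
  moreover have "r \<noteq> 0" using hit_attained[OF assms(1) h] assms(2) by auto
  ultimately show "0 < r \<and> x r \<in> B \<and> (\<forall>u. 0 \<le> u \<and> u < r \<longrightarrow> x u \<notin> B)"
    using hit_attained[OF assms(1) h] by auto
next
  assume r: "0 < r \<and> x r \<in> B \<and> (\<forall>u. 0 \<le> u \<and> u < r \<longrightarrow> x u \<notin> B)"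
  show "hit B x = ereal r"
  proof (rule antisym)
    show "hit B x \<le> ereal r" using r by (intro hit_le) auto
    show "ereal r \<le> hit B x" unfolding hit_def
      using r by (intro Inf_greatest) (force simp: not_less[symmetric])
  qed
qed

text \<open>Reads the hitting time off rational times, hence measurably on the path space. On
  right-continuous paths nothing is lost, since every state visited is seen again at a rational time
  slightly later.\<close>

definition rat_hit :: "'s set \<Rightarrow> (real \<Rightarrow> 's) \<Rightarrow> ereal" where
  "rat_hit B x = (INF q\<in>\<rat> \<inter> {0<..}. if x q \<in> B then ereal q else \<infinity>)"

lemma rat_hit_eq:
  assumes "right_continuous_path x"
  shows "rat_hit B x = hit B x"
proof (rule antisym)
  show "hit B x \<le> rat_hit B x"
    unfolding rat_hit_def by (intro INF_greatest) (auto intro: hit_le)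
  show "rat_hit B x \<le> hit B x"
    unfolding hit_def
  proof (rule Inf_greatest)
    fix y assume "y \<in> ereal ` {u. 0 < u \<and> x u \<in> B}"
    then obtain u where u: "y = ereal u" "0 < u" "x u \<in> B" by auto
    show "rat_hit B x \<le> y"
    proof (rule dense_ge)
      fix z assume "y < z"
      then obtain d where d: "u < d" "ereal d \<le> z"
        by (metis ereal_dense2 less_ereal.simps(1) less_imp_le u(1))
      obtain q where q: "q \<in> \<rat>" "u < q" "q < d" "x q = x u"
        by (rule right_continuous_path_rat[OF assms less_imp_le[OF u(2)] d(1)]) blast
      then have "rat_hit B x \<le> (if x q \<in> B then ereal q else \<infinity>)"
        unfolding rat_hit_def using u by (intro INF_lower) auto
      also have "\<dots> \<le> z" using q u d by (auto intro: order_trans[of _ "ereal d"])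
      finally show "rat_hit B x \<le> z" .
    qed
  qed
qed

definition stay :: "'s set \<Rightarrow> real \<Rightarrow> (real \<Rightarrow> 's) \<Rightarrow> bool" where
  "stay W d x \<longleftrightarrow> (\<forall>u\<in>{0..d}. x u \<in> W)"

text \<open>The jump time may equal \<open>d\<close> but not 0, matching half-open windows: when two
  intervals are concatenated, a jump at the junction belongs to the first one only. \<open>T\<close>
  is the landing set and \<open>W'\<close> the set occupied from the landing on.\<close>

definition jump :: "'s set \<Rightarrow> 's set \<Rightarrow> 's set \<Rightarrow> real \<Rightarrow> (real \<Rightarrow> 's) \<Rightarrow> bool" where
  "jump W T W' d x \<longleftrightarrow> (\<exists>r. 0 < r \<and> r \<le> d \<and> (\<forall>u. 0 \<le> u \<and> u < r \<longrightarrow> x u \<in> W) \<and> x r \<in> T \<and>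
      (\<forall>u\<in>{r..d}. x u \<in> W'))"

definition shift_path :: "real \<Rightarrow> (real \<Rightarrow> 's) \<Rightarrow> real \<Rightarrow> 's" where
  "shift_path v x u = x (v + u)"

lemma right_continuous_path_shift:
  assumes "right_continuous_path x" "0 \<le> v"
  shows "right_continuous_path (shift_path v x)"
  unfolding right_continuous_path_def
proof (intro allI impI)
  fix u :: real assume u: "0 \<le> u"
  obtain e where e: "0 < e" "\<And>w. v + u \<le> w \<Longrightarrow> w < v + u + e \<Longrightarrow> x w = x (v + u)"
    using right_continuous_pathE[OF assms(1), of "v + u"] u assms(2) by (metis add_nonneg_nonneg)
  show "\<forall>\<^sub>F w in at_right u. shift_path v x w = shift_path v x u"
    unfolding eventually_at_right_field shift_path_def
  proof (intro exI conjI allI impI)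
    show "u < u + e" using e(1) by simp
    show "x (v + w) = x (v + u)" if "u < w" "w < u + e" for w using that by (intro e(2)) auto
  qed
qed

text \<open>Allows a path event to be evaluated on stopped trajectories, which is how events
  determined up to \<open>d\<close> are placed in the filtration.\<close>

lemma right_continuous_path_stopped:
  assumes "right_continuous_path x" "0 \<le> d"
  shows "right_continuous_path (\<lambda>u. x (min u d))"
  unfolding right_continuous_path_def
proof (intro allI impI)
  fix u :: real assume u: "0 \<le> u"
  obtain e where e: "0 < e" "\<And>w. u \<le> w \<Longrightarrow> w < u + e \<Longrightarrow> x w = x u"
    by (rule right_continuous_pathE[OF assms(1) u]) blast
  show "\<forall>\<^sub>F w in at_right u. x (min w d) = x (min u d)"
    unfolding eventually_at_right_field
  proof (intro exI conjI allI impI)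
    show "u < (if u < d then min d (u + e) else u + 1)" using e(1) by auto
    fix w assume "u < w" "w < (if u < d then min d (u + e) else u + 1)"
    then show "x (min w d) = x (min u d)"
      using e(2)[of w] by (cases "u < d") (auto simp: min_def split: if_splits)
  qed
qed

lemma right_continuous_path_cong:
  assumes "\<And>u. 0 \<le> u \<Longrightarrow> x u = y u"
  shows "right_continuous_path x \<longleftrightarrow> right_continuous_path y"
proof -
  have "(\<forall>\<^sub>F v in at_right u. x v = x u) \<longleftrightarrow> (\<forall>\<^sub>F v in at_right u. y v = y u)" if "0 \<le> u" for u
    using that assms unfolding eventually_at_right_field by (smt (verit))
  then show ?thesis by (simp add: right_continuous_path_def)
qed

lemma stay_cong: "(\<And>u. 0 \<le> u \<Longrightarrow> u \<le> d \<Longrightarrow> x u = y u) \<Longrightarrow> stay W d x \<longleftrightarrow> stay W d y"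
  by (simp add: stay_def)

lemma jump_cong:
  assumes "\<And>u. 0 \<le> u \<Longrightarrow> u \<le> d \<Longrightarrow> x u = y u"
  shows "jump W T W' d x \<longleftrightarrow> jump W T W' d y"
  unfolding jump_def using assms
  by (intro ex_cong1 conj_cong refl) auto

lemma hit_cong: "(\<And>u. 0 < u \<Longrightarrow> x u = y u) \<Longrightarrow> hit B x = hit B y"
  unfolding hit_def by (metis (mono_tags, lifting))

lemma stay_add:
  assumes "0 \<le> t" "0 \<le> h"
  shows "stay W (t + h) x \<longleftrightarrow> stay W t x \<and> stay W h (shift_path t x)"
proof (intro iffI)
  assume "stay W t x \<and> stay W h (shift_path t x)"
  then have 1: "\<And>u. 0 \<le> u \<Longrightarrow> u \<le> t \<Longrightarrow> x u \<in> W" and 2: "\<And>u. 0 \<le> u \<Longrightarrow> u \<le> h \<Longrightarrow> x (t + u) \<in> W"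
    by (auto simp: stay_def shift_path_def)
  show "stay W (t + h) x" unfolding stay_def
  proof
    fix u assume "u \<in> {0..t + h}"
    then show "x u \<in> W" using 1[of u] 2[of "u - t"] by (cases "u \<le> t") auto
  qed
qed (use assms in \<open>auto simp: stay_def shift_path_def\<close>)

text \<open>The jump time lies either in the first interval or in the second. This dichotomy is the
  source of the Duhamel equation for the jump kernel.\<close>

lemma jump_add:
  assumes "0 \<le> t" "0 \<le> h"
  shows "jump W T W' (t + h) x \<longleftrightarrow>
    (jump W T W' t x \<and> stay W' h (shift_path t x)) \<or> (stay W t x \<and> jump W T W' h (shift_path t x))"
    (is "?L \<longleftrightarrow> ?A \<or> ?B")
proof
  assume ?L
  then obtain r where r: "0 < r" "r \<le> t + h" "\<And>u. 0 \<le> u \<Longrightarrow> u < r \<Longrightarrow> x u \<in> W" "x r \<in> T"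
    "\<And>u. r \<le> u \<Longrightarrow> u \<le> t + h \<Longrightarrow> x u \<in> W'" by (auto simp: jump_def)
  show "?A \<or> ?B"
  proof (cases "r \<le> t")
    case True
    then have "jump W T W' t x" unfolding jump_def using r assms by (intro exI[of _ r]) auto
    moreover have "stay W' h (shift_path t x)" unfolding stay_def shift_path_def using True r assms by auto
    ultimately show ?thesis by simp
  next
    case False
    then have "stay W t x" unfolding stay_def using r by auto
    moreover have "jump W T W' h (shift_path t x)"
      unfolding jump_def shift_path_def using False r assms by (intro exI[of _ "r - t"]) auto
    ultimately show ?thesis by simp
  qed
next
  assume "?A \<or> ?B"
  then show ?L
  proof
    assume A: ?A
    then obtain r where r: "0 < r" "r \<le> t" "\<And>u. 0 \<le> u \<Longrightarrow> u < r \<Longrightarrow> x u \<in> W" "x r \<in> T"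
      "\<And>u. r \<le> u \<Longrightarrow> u \<le> t \<Longrightarrow> x u \<in> W'" by (auto simp: jump_def)
    have "x u \<in> W'" if "r \<le> u" "u \<le> t + h" for u
    proof (cases "u \<le> t")
      case False
      then have "shift_path t x (u - t) \<in> W'" using A that by (auto simp: stay_def)
      then show ?thesis by (simp add: shift_path_def)
    qed (use r that in simp)
    then show ?L unfolding jump_def using r assms by (intro exI[of _ r]) auto
  next
    assume B: ?B
    then obtain r where r: "0 < r" "r \<le> h" "\<And>u. 0 \<le> u \<Longrightarrow> u < r \<Longrightarrow> x (t + u) \<in> W" "x (t + r) \<in> T"
      "\<And>u. r \<le> u \<Longrightarrow> u \<le> h \<Longrightarrow> x (t + u) \<in> W'" by (auto simp: jump_def shift_path_def)
    have 1: "x u \<in> W" if "0 \<le> u" "u < t + r" for u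
      using B r(3)[of "u - t"] that by (cases "u \<le> t") (auto simp: stay_def)
    have 2: "x u \<in> W'" if "t + r \<le> u" "u \<le> t + h" for u
      using r(5)[of "u - t"] that by auto
    show ?L unfolding jump_def using r 1 2 assms by (intro exI[of _ "t + r"]) auto
  qed
qed

text \<open>Makes the two alternatives of \<open>jump_add\<close> exclusive, so that their
  probabilities add.\<close>

lemma jump_not_stay: "T \<inter> W = {} \<Longrightarrow> jump W T W' t x \<Longrightarrow> \<not> stay W t x"
  by (force simp: jump_def stay_def)

lemma stay_ends: "stay W d x \<Longrightarrow> 0 \<le> d \<Longrightarrow> x 0 \<in> W \<and> x d \<in> W"
  by (auto simp: stay_def)

lemma jump_ends: "jump W T W' d x \<Longrightarrow> x 0 \<in> W \<and> x d \<in> W'"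
  by (auto simp: jump_def)

text \<open>Phrased through three observation times. The outer two states may coincide, so leaving a
  state and returning to it counts as well.\<close>

definition two_jumps :: "real \<Rightarrow> (real \<Rightarrow> 's) \<Rightarrow> bool" where
  "two_jumps d x \<longleftrightarrow> (\<exists>u v w. 0 \<le> u \<and> u < v \<and> v < w \<and> w \<le> d \<and> x u \<noteq> x v \<and> x v \<noteq> x w)"

lemma not_two_jumpsD:
  "\<not> two_jumps d x \<Longrightarrow> 0 \<le> u \<Longrightarrow> u < v \<Longrightarrow> v < w \<Longrightarrow> w \<le> d \<Longrightarrow> x u = x v \<or> x v = x w"
  by (auto simp: two_jumps_def)

text \<open>Without two jumps, the state at an intermediate time agrees with the state at one of the
  ends.\<close>

lemma stay_if_not_two_jumps:
  assumes "\<not> two_jumps d x" "x 0 \<in> W" "x d \<in> W"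
  shows "stay W d x"
  unfolding stay_def
proof
  fix u assume "u \<in> {0..d}"
  then show "x u \<in> W"
    using not_two_jumpsD[OF assms(1), of 0 u d] assms by (cases "u = 0 \<or> u = d") auto
qed

text \<open>Since \<open>T\<close> avoids \<open>W\<close>, an end state in \<open>T\<close> differs
  from the start; its first hit is then the jump time, with the start state before it and the end
  state from it on.\<close>

lemma jump_iff_not_two_jumps:
  assumes "\<not> two_jumps d x" "right_continuous_path x" "0 \<le> d" "x 0 \<in> W" "T \<inter> W = {}" "T \<subseteq> W'"
  shows "jump W T W' d x \<longleftrightarrow> x d \<in> T"
proof
  assume "jump W T W' d x"
  then obtain r where r: "0 < r" "r \<le> d" "x r \<in> T" by (auto simp: jump_def)
  then have "x 0 \<noteq> x r" using assms by auto
  then show "x d \<in> T" using not_two_jumpsD[OF assms(1), of 0 r d] r by (cases "r = d") auto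
next
  assume xd: "x d \<in> T"
  then have ne: "x 0 \<noteq> x d" using assms by auto
  then have d: "0 < d" using assms(3) by (cases "d = 0") auto
  have "hit {x d} x \<le> ereal d" using d by (intro hit_le) auto
  moreover have "0 \<le> hit {x d} x" unfolding hit_def by (intro Inf_greatest) auto
  ultimately obtain r where hr: "hit {x d} x = ereal r" "r \<le> d"
    by (cases "hit {x d} x") auto
  then have r: "0 < r" "x r = x d" "\<And>u. 0 \<le> u \<Longrightarrow> u < r \<Longrightarrow> x u \<noteq> x d"
    using hit_eq_iff[OF assms(2), of "{x d}" r] ne by auto
  have "x u \<in> W" if "0 \<le> u" "u < r" for u
    using not_two_jumpsD[OF assms(1), of 0 u d] r(3)[OF that] that hr assms(4) by (cases "u = 0") auto
  moreover have "x u \<in> W'" if "r \<le> u" "u \<le> d" for u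
    using not_two_jumpsD[OF assms(1), of 0 r u] r that ne xd assms(6) by (cases "u = r") auto
  ultimately show "jump W T W' d x"
    unfolding jump_def using r hr xd by (intro exI[of _ r]) auto
qed

text \<open>Each of the three states persists for a while to the right, so every fine enough grid
  sees them in order and records a change between consecutive ones. This replaces arbitrary times by
  finitely many for each grid.\<close>

lemma two_jumps_grid:
  assumes "right_continuous_path x" "two_jumps d x" "0 < d"
  shows "\<forall>\<^sub>F N in sequentially. \<exists>m<N. \<exists>m'<N. m < m' \<and>
    x (real m * (d / real N)) \<noteq> x (real (Suc m) * (d / real N)) \<and>
    x (real m' * (d / real N)) \<noteq> x (real (Suc m') * (d / real N))"
proof -
  obtain u v w where uvw: "0 \<le> u" "u < v" "v < w" "w \<le> d" "x u \<noteq> x v" "x v \<noteq> x w"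
    using assms(2) unfolding two_jumps_def by metis
  have v0: "0 \<le> v" and w0: "0 \<le> w" using uvw by linarith+
  obtain e1 where e1: "0 < e1" "\<And>z. u \<le> z \<Longrightarrow> z < u + e1 \<Longrightarrow> x z = x u"
    using right_continuous_pathE[OF assms(1) uvw(1)] by metis
  obtain e2 where e2: "0 < e2" "\<And>z. v \<le> z \<Longrightarrow> z < v + e2 \<Longrightarrow> x z = x v"
    using right_continuous_pathE[OF assms(1) v0] by metis
  obtain e3 where e3: "0 < e3" "\<And>z. w \<le> z \<Longrightarrow> z < w + e3 \<Longrightarrow> x z = x w"
    using right_continuous_pathE[OF assms(1) w0] by metis
  \<comment> \<open>\<open>e\<close> keeps the first grid point after each of the three times inside
    the corresponding interval of constancy and before the next of these times.\<close>
  define e where "e = min (min e1 e2) (min e3 (min (v - u) (w - v)))"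
  have e: "0 < e" "e \<le> e1" "e \<le> e2" "e \<le> e3" "e \<le> v - u" "e \<le> w - v"
    using e1(1) e2(1) e3(1) uvw by (auto simp: e_def)
  have change: "\<exists>m. i \<le> m \<and> m < j \<and> y m \<noteq> y (Suc m)" if "i \<le> j" "y i \<noteq> y j"
    for i j and y :: "nat \<Rightarrow> 'a"
    using that
  proof (induction j)
    case (Suc j)
    show ?case
    proof (cases "i = Suc j \<or> y j \<noteq> y (Suc j)")
      case True
      then show ?thesis using Suc.prems by (intro exI[of _ j]) (auto simp: le_Suc_eq)
    next
      case False
      then have "\<exists>m\<ge>i. m < j \<and> y m \<noteq> y (Suc m)" using Suc by auto
      then show ?thesis using less_SucI by blast
    qed
  qed simp
  have "\<forall>\<^sub>F N in sequentially. d / real N < e"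
    by (rule order_tendstoD(2)[OF lim_const_over_n e(1)])
  then show ?thesis using eventually_gt_at_top[of 0]
  proof eventually_elim
    case (elim N)
    define g where "g m = real m * (d / real N)" for m
    \<comment> \<open>The index of the first grid point at or after \<open>z\<close>.\<close>
    define i where "i z = nat \<lceil>z / (d / real N)\<rceil>" for z
    have dN: "0 < d / real N" using elim assms(3) by simp
    have gi: "z \<le> g (i z)" "g (i z) < z + e" if "0 \<le> z" for z
    proof -
      have "0 \<le> z / (d / real N)" using that dN by (intro divide_nonneg_pos)
      then have "z / (d / real N) \<le> real (i z)" "real (i z) < z / (d / real N) + 1"
        unfolding i_def by linarith+
      moreover have "z \<le> k * D \<and> k * D < z + D" if "0 < D" "z / D \<le> k" "k < z / D + 1" for D k :: real
        using that by (simp add: field_simps)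
      ultimately have "z \<le> g (i z)" "g (i z) < z + d / real N"
        unfolding g_def using dN by blast+
      then show "z \<le> g (i z)" "g (i z) < z + e" using elim by simp_all
    qed
    have mono: "m < m'" if "g m < g m'" for m m'
      using that dN by (simp only: g_def mult_less_cancel_right_pos of_nat_less_iff)
    have iw: "i w \<le> N"
    proof -
      have "w / (d / real N) \<le> real N" using uvw elim assms(3) by (simp add: field_simps)
      then show ?thesis by (simp add: i_def nat_le_iff ceiling_le_iff)
    qed
    have x: "x (g (i u)) = x u" "x (g (i v)) = x v" "x (g (i w)) = x w"
      using gi[OF uvw(1)] gi[OF v0] gi[OF w0] e
      by (intro e1(2) e2(2) e3(2); linarith)+
    have uv: "i u < i v" and vw: "i v < i w"
      using gi[OF uvw(1)] gi[OF v0] gi[OF w0] e by (intro mono; linarith)+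
    obtain m where m: "i u \<le> m" "m < i v" "x (g m) \<noteq> x (g (Suc m))"
      using change[of "i u" "i v" "\<lambda>m. x (g m)"] uv unfolding x using uvw(5) by auto
    obtain m' where m': "i v \<le> m'" "m' < i w" "x (g m') \<noteq> x (g (Suc m'))"
      using change[of "i v" "i w" "\<lambda>m. x (g m)"] vw unfolding x using uvw(6) by auto
    show ?case
      using m m' iw uv vw unfolding g_def by (intro exI[of _ m] exI[of _ m'] conjI) auto
  qed
qed

section \<open>The path space\<close>

text \<open>Only nonnegative times are coordinates. There are uncountably many of them, while a
  measurable set depends on countably many; hence the descriptions through rational times
  below.\<close>

definition path_space :: "(real \<Rightarrow> 's) measure" where
  "path_space = (\<Pi>\<^sub>M u\<in>{0..}. count_space UNIV)"

lemma measurable_path_eval: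
  "0 \<le> u \<Longrightarrow> (\<lambda>x. x u) \<in> path_space \<rightarrow>\<^sub>M count_space UNIV"
  unfolding path_space_def by (rule measurable_component_singleton) simp

lemma pred_path_eval:
  assumes "0 \<le> u"
  shows "Measurable.pred path_space (\<lambda>x. x u \<in> B)"
  using measurable_compose[OF measurable_path_eval[OF assms], of "\<lambda>i. i \<in> B" "count_space UNIV"]
  by simp

lemma measurable_rat_hit [measurable]:
  "rat_hit B \<in> borel_measurable path_space"
  unfolding rat_hit_def
proof (rule borel_measurable_INF)
  show "countable (\<rat> \<inter> {0<..} :: real set)" using countable_rat by blast
  fix q :: real assume "q \<in> \<rat> \<inter> {0<..}"
  then have [measurable]: "Measurable.pred path_space (\<lambda>x. x q \<in> B)" by (intro pred_path_eval) simp
  show "(\<lambda>x. if x q \<in> B then ereal q else \<infinity>) \<in> borel_measurable path_space" by measurable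
qed

text \<open>The endpoint \<open>d\<close> is added because the state at \<open>d\<close> cannot be
  recovered from rational times to its right without leaving the interval.\<close>

definition time_grid :: "real \<Rightarrow> real set" where
  "time_grid d = insert d (\<rat> \<inter> {0..d})"

lemma time_grid_dense:
  assumes "right_continuous_path x" "0 \<le> u" "u \<le> d"
  obtains q where "q \<in> time_grid d" "u \<le> q" "x q = x u"
proof (cases "u = d")
  case False
  then obtain q where "q \<in> \<rat>" "u < q" "q < d" "x q = x u"
    using right_continuous_path_rat[OF assms(1,2), of d] assms(3) by force
  then show ?thesis using assms(2) by (intro that[of q]) (auto simp: time_grid_def)
qed (auto intro!: that simp: time_grid_def)

definition stay_set :: "'s set \<Rightarrow> real \<Rightarrow> (real \<Rightarrow> 's) set" where
  "stay_set W d = {x\<in>space path_space. \<forall>q\<in>time_grid d. x q \<in> W}"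

(* A jump along W, T, W' happens exactly when T is hit at the moment W is left, which only involves
   countably many times. *)
definition jump_set :: "'s set \<Rightarrow> 's set \<Rightarrow> 's set \<Rightarrow> real \<Rightarrow> (real \<Rightarrow> 's) set" where
  "jump_set W T W' d = {x\<in>space path_space. x 0 \<in> W \<and> rat_hit T x = rat_hit (- W) x \<and>
     rat_hit T x \<le> ereal d \<and> (\<forall>q\<in>time_grid d. rat_hit T x \<le> ereal q \<longrightarrow> x q \<in> W')}"

lemma countable_time_grid: "countable (time_grid d)"
  unfolding time_grid_def using countable_rat by blast

lemma time_grid_bounds: "0 \<le> d \<Longrightarrow> q \<in> time_grid d \<Longrightarrow> 0 \<le> q \<and> q \<le> d"
  by (auto simp: time_grid_def)

lemma stay_set_measurable [measurable]:
  assumes "0 \<le> d" shows "stay_set W d \<in> sets path_space"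
proof -
  have "Measurable.pred path_space (\<lambda>x. \<forall>q\<in>time_grid d. x q \<in> W)"
    using time_grid_bounds[OF assms]
    by (intro measurable_pred_countable(1) countable_time_grid pred_path_eval) auto
  then show ?thesis unfolding stay_set_def pred_def by simp
qed

lemma jump_set_measurable [measurable]:
  assumes "0 \<le> d" shows "jump_set W T W' d \<in> sets path_space"
proof -
  have "Measurable.pred path_space (\<lambda>x. rat_hit T x \<le> ereal q \<longrightarrow> x q \<in> W')" if "q \<in> time_grid d" for q
  proof -
    have [measurable]: "Measurable.pred path_space (\<lambda>x. x q \<in> W')"
      using time_grid_bounds[OF assms that] by (intro pred_path_eval) auto
    show ?thesis by measurable
  qed
  then have [measurable]:
    "Measurable.pred path_space (\<lambda>x. \<forall>q\<in>time_grid d. rat_hit T x \<le> ereal q \<longrightarrow> x q \<in> W')"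
    by (intro measurable_pred_countable(1) countable_time_grid)
  have [measurable]: "Measurable.pred path_space (\<lambda>x. x 0 \<in> W)" by (intro pred_path_eval) simp
  have [measurable]: "Measurable.pred path_space (\<lambda>x. rat_hit T x = rat_hit (- W) x)"
    unfolding pred_def by (rule measurable_equality_set) measurable
  have [measurable]: "Measurable.pred path_space (\<lambda>x. rat_hit T x \<le> ereal d)" by measurable
  show ?thesis unfolding jump_set_def
    by (intro sets.sets_Collect_conj) (simp_all flip: pred_def)
qed

lemma stay_set_iff:
  assumes "right_continuous_path x" "x \<in> space path_space" "0 \<le> d"
  shows "x \<in> stay_set W d \<longleftrightarrow> stay W d x"
proof
  assume "x \<in> stay_set W d"
  then have q: "\<And>q. q \<in> time_grid d \<Longrightarrow> x q \<in> W" by (simp add: stay_set_def)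
  show "stay W d x" unfolding stay_def
  proof
    fix u assume "u \<in> {0..d}"
    then obtain p where "p \<in> time_grid d" "x p = x u"
      using time_grid_dense[OF assms(1), of u d] by auto
    then show "x u \<in> W" using q[of p] by simp
  qed
next
  assume st: "stay W d x"
  have "x q \<in> W" if "q \<in> time_grid d" for q
    using time_grid_bounds[OF assms(3) that] st by (auto simp: stay_def)
  with assms(2) show "x \<in> stay_set W d" by (simp add: stay_set_def)
qed

text \<open>With \<open>T\<close> disjoint from \<open>W\<close>, leaving \<open>W\<close> and
  hitting \<open>T\<close> at the same instant means that the path remains in \<open>W\<close> until
  it lands in \<open>T\<close>; attainment of both infima makes this exact.\<close>

lemma jump_set_iff:
  assumes "right_continuous_path x" "x \<in> space path_space" "0 \<le> d" "T \<inter> W = {}"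
  shows "x \<in> jump_set W T W' d \<longleftrightarrow> jump W T W' d x"
proof
  assume "x \<in> jump_set W T W' d"
  then have x: "x 0 \<in> W" "hit T x = hit (- W) x" "hit T x \<le> ereal d"
    "\<And>q. q \<in> time_grid d \<Longrightarrow> hit T x \<le> ereal q \<Longrightarrow> x q \<in> W'"
    by (auto simp: jump_set_def rat_hit_eq[OF assms(1)])
  have "0 \<le> hit T x" unfolding hit_def by (intro Inf_greatest) auto
  then obtain r where r: "hit T x = ereal r" "r \<le> d" using x(3) by (cases "hit T x") auto
  have r1: "0 < r" "x r \<in> T" "\<And>u. 0 \<le> u \<Longrightarrow> u < r \<Longrightarrow> x u \<in> W"
    using hit_eq_iff[OF assms(1), of T r] hit_eq_iff[OF assms(1), of "- W" r] r x(1,2) assms(4) by auto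
  have "x u \<in> W'" if "r \<le> u" "u \<le> d" for u
  proof -
    have "0 \<le> u" using r1(1) that by linarith
    then obtain q where "q \<in> time_grid d" "u \<le> q" "x q = x u"
      using time_grid_dense[OF assms(1), of u d] \<open>u \<le> d\<close> by metis
    then show ?thesis using x(4)[of q] r that by auto
  qed
  then show "jump W T W' d x" unfolding jump_def using r r1 by (intro exI[of _ r]) auto
next
  assume "jump W T W' d x"
  then obtain r where r: "0 < r" "r \<le> d" "\<And>u. 0 \<le> u \<Longrightarrow> u < r \<Longrightarrow> x u \<in> W" "x r \<in> T"
    "\<And>u. r \<le> u \<Longrightarrow> u \<le> d \<Longrightarrow> x u \<in> W'" by (auto simp: jump_def)
  have x0: "x 0 \<in> W" using r by auto
  have "hit T x = ereal r" using x0 r assms(4) by (subst hit_eq_iff[OF assms(1)]) auto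
  moreover have "hit (- W) x = ereal r" using x0 r assms(4) by (subst hit_eq_iff[OF assms(1)]) auto
  ultimately show "x \<in> jump_set W T W' d"
    using r x0 assms time_grid_bounds[OF assms(3)] by (auto simp: jump_set_def rat_hit_eq[OF assms(1)])
qed

section \<open>Hitting times and windows\<close>

lemma set_drop_conv: "set (drop n s) = {s ! l | l. n \<le> l \<and> l < length s}"
proof (intro set_eqI iffI)
  fix c assume "c \<in> set (drop n s)"
  then obtain i where "i < length s - n" "c = drop n s ! i" by (auto simp: in_set_conv_nth)
  then show "c \<in> {s ! l | l. n \<le> l \<and> l < length s}" by (auto intro!: exI[of _ "n + i"])
next
  fix c assume "c \<in> {s ! l | l. n \<le> l \<and> l < length s}"
  then obtain l where l: "c = s ! l" "n \<le> l" "l < length s" by auto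
  then have "c = drop n s ! (l - n)" "l - n < length (drop n s)" by auto
  then show "c \<in> set (drop n s)" by (metis nth_mem)
qed

lemma waiting_set_iff:
  "i \<in> waiting_set G s n \<longleftrightarrow> (\<forall>l. n \<le> l \<and> l < length s \<longrightarrow> (\<forall>k\<in>s ! l. i \<notin> G k))"
proof -
  show ?thesis unfolding waiting_set_def target_union_def set_drop_conv by blast
qed

text \<open>The preceding entry of a sequence, with 0 before the first. It is applied both to right
  window ends and to vectors of jump times, where it matches \<open>level_time\<close>.\<close>

definition window_start :: "(nat \<Rightarrow> real) \<Rightarrow> nat \<Rightarrow> real" where
  "window_start b n = (if n = 0 then 0 else b (n - 1))"

(* The n-th jump happens in the half-open window (a n, b n], so that a later hitting time exceeds
   b n iff its target is avoided on [0, b n]. *)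
primrec windows :: "(nat \<Rightarrow> 's set) \<Rightarrow> (nat \<Rightarrow> 's set) \<Rightarrow> (nat \<Rightarrow> real) \<Rightarrow> (nat \<Rightarrow> real) \<Rightarrow> nat \<Rightarrow>
    (real \<Rightarrow> 's) \<Rightarrow> bool" where
  "windows W T a b 0 x \<longleftrightarrow> x 0 \<in> W 0"
| "windows W T a b (Suc n) x \<longleftrightarrow> windows W T a b n x \<and>
     stay (W n) (a n - window_start b n) (shift_path (window_start b n) x) \<and>
     jump (W n) (T n) (W (Suc n)) (b n - a n) (shift_path (a n) x)"

text \<open>The \<open>n\<close>-th waiting set avoids the targets of component \<open>n\<close> and
  of all later ones, so the path misses them until the \<open>n\<close>-th jump, which lands in all
  targets of component \<open>n\<close> and in none of a later one. Conversely, the separation of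
  the windows orders the hitting times.\<close>

lemma windows_hit_iff:
  fixes G :: "'k \<Rightarrow> 's set" and s :: "'k set list"
  assumes x: "right_continuous_path x" "x 0 \<in> waiting_set G s 0"
    and a: "\<And>n. n < length s \<Longrightarrow> window_start b n \<le> a n"
    and ab: "\<And>n. n < length s \<Longrightarrow> a n < b n"
  shows "windows (waiting_set G s) (arrival_set G s) a b (length s) x \<longleftrightarrow>
    (\<exists>r. \<forall>n<length s. a n < r n \<and> r n \<le> b n \<and> (\<forall>k\<in>s ! n. hit (G k) x = ereal (r n)))"
proof -
  define W where "W = waiting_set G s"
  define T where "T = arrival_set G s"
  define m where "m = length s"
  define p where "p n = window_start b n" for n
  note x = x[folded W_def] and a = a[folded m_def p_def] and ab = ab[folded m_def]
  have p0: "p 0 = 0" and pS: "p (Suc n) = b n" for n by (simp_all add: p_def window_start_def)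
  have p_nonneg: "0 \<le> p n" if "n \<le> m" for n using that
  proof (induction n)
    case (Suc n)
    then show ?case using a[of n] ab[of n] by (simp add: pS)
  qed (simp add: p0)
  have x0: "x 0 \<notin> G k" if "k \<in> s ! n" "n < m" for k n
    using x(2) that by (auto simp: W_def m_def waiting_set_iff)
  show ?thesis unfolding W_def[symmetric] T_def[symmetric] m_def[symmetric]
  proof
    assume w: "windows W T a b m x"
    have step: "\<exists>r. a n < r \<and> r \<le> b n \<and> (\<forall>u. p n \<le> u \<and> u < r \<longrightarrow> x u \<in> W n) \<and> x r \<in> T n
        \<and> (\<forall>u. r \<le> u \<and> u \<le> b n \<longrightarrow> x u \<in> W (Suc n))" if "n < m" for n
    proof -
      have "windows W T a b n' x \<longrightarrow> n < n' \<longrightarrow>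
        stay (W n) (a n - p n) (shift_path (p n) x) \<and> jump (W n) (T n) (W (Suc n)) (b n - a n) (shift_path (a n) x)" for n'
        by (induction n') (auto simp: p_def less_Suc_eq)
      with w that have 1: "stay (W n) (a n - p n) (shift_path (p n) x)"
        and "jump (W n) (T n) (W (Suc n)) (b n - a n) (shift_path (a n) x)" by auto
      then obtain r where r: "0 < r" "r \<le> b n - a n" "\<And>u. 0 \<le> u \<Longrightarrow> u < r \<Longrightarrow> x (a n + u) \<in> W n"
        "x (a n + r) \<in> T n" "\<And>u. r \<le> u \<Longrightarrow> u \<le> b n - a n \<Longrightarrow> x (a n + u) \<in> W (Suc n)"
        by (auto simp: jump_def shift_path_def)
      have A: "x u \<in> W n" if "p n \<le> u" "u < a n + r" for u
      proof (cases "u \<le> a n")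
        case True
        then have "shift_path (p n) x (u - p n) \<in> W n" using 1 that by (auto simp: stay_def)
        then show ?thesis by (simp add: shift_path_def)
      qed (use r(3)[of "u - a n"] that in auto)
      have B: "x u \<in> W (Suc n)" if "a n + r \<le> u" "u \<le> b n" for u
        using r(5)[of "u - a n"] that by auto
      show ?thesis using A B r by (intro exI[of _ "a n + r"]) auto
    qed
    then have "\<forall>n. \<exists>r. n < m \<longrightarrow> a n < r \<and> r \<le> b n \<and> (\<forall>u. p n \<le> u \<and> u < r \<longrightarrow> x u \<in> W n) \<and> x r \<in> T n
        \<and> (\<forall>u. r \<le> u \<and> u \<le> b n \<longrightarrow> x u \<in> W (Suc n))" by blast
    then obtain r where r: "\<And>n. n < m \<Longrightarrow> a n < r n \<and> r n \<le> b n \<and>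
        (\<forall>u. p n \<le> u \<and> u < r n \<longrightarrow> x u \<in> W n) \<and> x (r n) \<in> T n
        \<and> (\<forall>u. r n \<le> u \<and> u \<le> b n \<longrightarrow> x u \<in> W (Suc n))" by metis
    \<comment> \<open>Up to the end of the previous window the path is in some waiting set of index
      at most \<open>n\<close>; these sets grow with the index, so the targets of component
      \<open>n\<close> are avoided there too.\<close>
    have cover: "\<exists>l\<le>n. x u \<in> W l" if "n \<le> m" "0 \<le> u" "u < p n" for n u
      using that
    proof (induction n)
      case (Suc n)
      consider "u < p n" | "p n \<le> u" "u < r n" | "r n \<le> u" "u < b n" using Suc.prems pS by fastforce
      then show ?case
      proof cases
        case 1
        then show ?thesis using Suc by (meson Suc_leD le_SucI)
      next
        case 2
        then have "x u \<in> W n" using r[of n] Suc.prems by auto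
        then show ?thesis using le_SucI by blast
      next
        case 3
        then have "x u \<in> W (Suc n)" using r[of n] Suc.prems by auto
        then show ?thesis by blast
      qed
    qed (simp add: p0)
    have "hit (G k) x = ereal (r n)" if n: "n < m" "k \<in> s ! n" for n k
    proof -
      have G: "y \<notin> G k" if "y \<in> W l" "l \<le> n" for y l
        using that n by (auto simp: W_def m_def waiting_set_iff)
      have "x u \<notin> G k" if "0 \<le> u" "u < r n" for u
      proof (cases "u < p n")
        case True
        then show ?thesis using cover[of n u] that n G by auto
      qed (use r[OF n(1)] that G[of _ n] in auto)
      moreover have "0 < r n" using r[OF n(1)] a[OF n(1)] p_nonneg[of n] n by simp
      moreover have "x (r n) \<in> G k" using r[OF n(1)] n by (auto simp: T_def arrival_set_def)
      ultimately show ?thesis using hit_eq_iff[OF x(1) x0[OF n(2,1)]] by blast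
    qed
    then show "\<exists>r. \<forall>n<m. a n < r n \<and> r n \<le> b n \<and> (\<forall>k\<in>s ! n. hit (G k) x = ereal (r n))"
      using r by (intro exI[of _ r]) auto
  next
    assume "\<exists>r. \<forall>n<m. a n < r n \<and> r n \<le> b n \<and> (\<forall>k\<in>s ! n. hit (G k) x = ereal (r n))"
    then obtain r where r: "\<And>n. n < m \<Longrightarrow> a n < r n" "\<And>n. n < m \<Longrightarrow> r n \<le> b n"
      "\<And>n k. n < m \<Longrightarrow> k \<in> s ! n \<Longrightarrow> hit (G k) x = ereal (r n)" by blast
    have h: "x (r n) \<in> G k" "\<And>u. 0 \<le> u \<Longrightarrow> u < r n \<Longrightarrow> x u \<notin> G k" if "n < m" "k \<in> s ! n" for n k
      using r(3)[OF that] hit_eq_iff[OF x(1) x0[OF that(2,1)], of "r n"] by auto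
    have chain: "n < l \<longrightarrow> l < m \<longrightarrow> b n \<le> a l" for n l
    proof (induction l)
      case (Suc l)
      show ?case
      proof (intro impI)
        assume *: "n < Suc l" "Suc l < m"
        then have "b l \<le> a (Suc l)" "a l < b l" using a[of "Suc l"] ab[of l] pS by auto
        then show "b n \<le> a (Suc l)" using Suc * by (cases "n = l") auto
      qed
    qed simp
    \<comment> \<open>A later component is hit no sooner than component \<open>n\<close>, as its
      window lies to the right.\<close>
    have W: "x u \<in> W n" if "0 \<le> u" "n < m" "u < r n" for u n
      unfolding W_def waiting_set_iff m_def[symmetric]
    proof (intro allI impI ballI)
      fix l k assume l: "n \<le> l \<and> l < m" "k \<in> s ! l"
      have "r n \<le> r l"
        using chain[of n l] r(1)[of l] r(2)[of n] l that by (cases "n = l") auto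
      then show "x u \<notin> G k" using h(2)[of l k u] l that by auto
    qed
    \<comment> \<open>Half-openness matters here: a later hitting time lies strictly beyond its left
      window end, hence strictly beyond \<open>b n\<close>.\<close>
    have W': "x u \<in> W (Suc n)" if "0 \<le> u" "n < m" "u \<le> b n" for u n
      unfolding W_def waiting_set_iff m_def[symmetric]
    proof (intro allI impI ballI)
      fix l k assume l: "Suc n \<le> l \<and> l < m" "k \<in> s ! l"
      have "b n < r l" using chain[of n l] r(1)[of l] l that by auto
      then show "x u \<notin> G k" using h(2)[of l k u] l that by auto
    qed
    have "n \<le> m \<longrightarrow> windows W T a b n x" for n
    proof (induction n)
      case (Suc n)
      show ?case
      proof
        assume n: "Suc n \<le> m"
        then have n': "n < m" by simp
        have p: "0 \<le> p n" "p n \<le> a n" using p_nonneg[of n] a[OF n'] n by auto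
        have ar: "0 \<le> r n" using p r(1)[OF n'] by simp
        have "stay (W n) (a n - p n) (shift_path (p n) x)"
          unfolding stay_def shift_path_def using p r(1)[OF n'] n' by (auto intro!: W)
        moreover have "x (r n) \<in> T n"
          unfolding T_def arrival_set_def using h(1)[OF n'] W'[OF ar n' r(2)[OF n']] by (auto simp: W_def)
        then have "jump (W n) (T n) (W (Suc n)) (b n - a n) (shift_path (a n) x)"
          unfolding jump_def shift_path_def using p r(1,2)[OF n'] n'
          by (intro exI[of _ "r n - a n"]) (auto intro!: W W')
        ultimately show "windows W T a b (Suc n) x" using Suc n by (simp add: p_def)
      qed
    qed (simp add: x(2))
    then show "windows W T a b m x" by simp
  qed
qed

section \<open>Events of the path space\<close>

text \<open>Agreement with a measurable set is demanded on right-continuous paths only, because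
  staying in a set throughout an interval is in general not measurable in the full product.
  Independence of negative times permits restriction to the coordinates of
  \<open>path_space\<close>.\<close>

definition path_event :: "((real \<Rightarrow> 's) \<Rightarrow> bool) \<Rightarrow> bool" where
  "path_event R \<longleftrightarrow> (\<forall>x y. (\<forall>u\<ge>0. x u = y u) \<longrightarrow> R x = R y) \<and>
     (\<exists>D\<in>sets path_space. \<forall>x\<in>space path_space. right_continuous_path x \<longrightarrow> (x \<in> D \<longleftrightarrow> R x))"

text \<open>A pointwise notion of not looking beyond \<open>d\<close>;
  \<open>determined_sets_F\<close> turns it into membership in the filtration.\<close>

definition determined :: "real \<Rightarrow> ((real \<Rightarrow> 's) \<Rightarrow> bool) \<Rightarrow> bool" where
  "determined d R \<longleftrightarrow> (\<forall>x y. (\<forall>u. 0 \<le> u \<and> u \<le> d \<longrightarrow> x u = y u) \<longrightarrow> R x = R y)"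

lemma path_event_cong: "path_event R \<Longrightarrow> (\<And>u. 0 \<le> u \<Longrightarrow> x u = y u) \<Longrightarrow> R x \<longleftrightarrow> R y"
  by (simp add: path_event_def)

lemma determined_cong:
  "determined d R \<Longrightarrow> (\<And>u. 0 \<le> u \<Longrightarrow> u \<le> d \<Longrightarrow> x u = y u) \<Longrightarrow> R x \<longleftrightarrow> R y"
  by (simp add: determined_def)

lemma determined_mono: "determined d R \<Longrightarrow> d \<le> d' \<Longrightarrow> determined d' R"
  unfolding determined_def by (meson order_trans)

lemma determined_conj:
  "determined d R \<Longrightarrow> determined d R' \<Longrightarrow> determined d (\<lambda>x. R x \<and> R' x)"
  unfolding determined_def by metis

lemma determined_shift:
  assumes "determined d R" "0 \<le> v"
  shows "determined (v + d) (\<lambda>x. R (shift_path v x))"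
  unfolding determined_def
proof (intro allI impI)
  fix x y :: "real \<Rightarrow> 'a" assume "\<forall>u. 0 \<le> u \<and> u \<le> v + d \<longrightarrow> x u = y u"
  then show "R (shift_path v x) = R (shift_path v y)"
    using assms(2) by (intro determined_cong[OF assms(1)]) (simp add: shift_path_def)
qed

lemma path_eventI:
  assumes "\<And>x y. (\<And>u. 0 \<le> u \<Longrightarrow> x u = y u) \<Longrightarrow> R x = R y"
    and "D \<in> sets path_space"
    and "\<And>x. x \<in> space path_space \<Longrightarrow> right_continuous_path x \<Longrightarrow> x \<in> D \<longleftrightarrow> R x"
  shows "path_event R"
  using assms unfolding path_event_def by metis

lemma path_event_eval: "0 \<le> u \<Longrightarrow> path_event (\<lambda>x. x u \<in> B)"
  using pred_path_eval[of u B]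
  by (intro path_eventI[where D = "{x\<in>space path_space. x u \<in> B}"]) (auto simp: pred_def)

lemma path_event_stay: "0 \<le> d \<Longrightarrow> path_event (stay W d)"
  by (intro path_eventI[where D = "stay_set W d"] stay_cong stay_set_measurable) (auto simp: stay_set_iff)

lemma path_event_jump: "0 \<le> d \<Longrightarrow> T \<inter> W = {} \<Longrightarrow> path_event (jump W T W' d)"
  by (intro path_eventI[where D = "jump_set W T W' d"] jump_cong jump_set_measurable)
    (auto simp: jump_set_iff)

lemma determined_stay: "determined d (stay W d)"
  unfolding determined_def by (intro allI impI stay_cong) auto

lemma determined_jump: "determined d (jump W T W' d)"
  unfolding determined_def by (intro allI impI jump_cong) auto

lemma path_event_conj:
  assumes "path_event R" "path_event R'"
  shows "path_event (\<lambda>x. R x \<and> R' x)"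
proof -
  obtain D D' where "D \<in> sets path_space"
      "\<forall>x\<in>space path_space. right_continuous_path x \<longrightarrow> (x \<in> D \<longleftrightarrow> R x)"
    and "D' \<in> sets path_space"
      "\<forall>x\<in>space path_space. right_continuous_path x \<longrightarrow> (x \<in> D' \<longleftrightarrow> R' x)"
    using assms unfolding path_event_def by blast
  then show ?thesis
    using path_event_cong[OF assms(1)] path_event_cong[OF assms(2)]
    by (intro path_eventI[where D = "D \<inter> D'"] arg_cong2[where f = "(\<and>)"]) blast+
qed

lemma path_event_shift:
  assumes "path_event R" "0 \<le> v"
  shows "path_event (\<lambda>x. R (shift_path v x))"
proof -
  obtain D where D: "D \<in> sets path_space"
      "\<And>x. x \<in> space path_space \<Longrightarrow> right_continuous_path x \<Longrightarrow> (x \<in> D \<longleftrightarrow> R x)"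
    using assms unfolding path_event_def by blast
  let ?S = "\<lambda>x. \<lambda>u\<in>{0..}. x (v + u) :: 'a"
  have S: "?S \<in> path_space \<rightarrow>\<^sub>M path_space"
    unfolding path_space_def by (intro measurable_restrict measurable_component_singleton) (use assms in auto)
  have R: "R (?S x) = R (shift_path v x)" for x
    by (rule path_event_cong[OF assms(1)]) (simp add: shift_path_def)
  show ?thesis
  proof (rule path_eventI[OF _ measurable_sets[OF S D(1)]])
    show "R (shift_path v x) = R (shift_path v y)" if "\<And>u. 0 \<le> u \<Longrightarrow> x u = y u" for x y
      using that assms(2) by (intro path_event_cong[OF assms(1)]) (simp add: shift_path_def)
  next
    fix x :: "real \<Rightarrow> 'a" assume x: "x \<in> space path_space" "right_continuous_path x"
    have "right_continuous_path (?S x)"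
      using right_continuous_path_shift[OF x(2) assms(2)]
      by (subst right_continuous_path_cong[of _ "shift_path v x"]) (auto simp: shift_path_def)
    moreover have "?S x \<in> space path_space" using measurable_space[OF S x(1)] .
    ultimately show "x \<in> ?S -` D \<inter> space path_space \<longleftrightarrow> R (shift_path v x)"
      using D(2)[of "?S x"] x(1) R by auto
  qed
qed

section \<open>The Markov property on the path space\<close>

context markov_process
begin

lemma space_P [simp]: "space (P i) = space M"
  using sets_eq_imp_space_eq[OF P_sets] .

lemma gen_sets_subset: "{X v -` B \<inter> space M | v B. 0 \<le> v \<and> v \<le> u} \<subseteq> sets M"
  using X_measurable by (auto intro!: measurable_sets)

lemma space_F [simp]: "space (generated_filtration M X u) = space M"
  by (simp add: generated_filtration_def space_measure_of_conv)

lemma sets_F: "sets (generated_filtration M X u) =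
    sigma_sets (space M) {X v -` B \<inter> space M | v B. 0 \<le> v \<and> v \<le> u}"
  unfolding generated_filtration_def
  by (rule sets_measure_of) (use gen_sets_subset sets.space_closed in blast)

lemma sets_F_subset: "sets (generated_filtration M X u) \<subseteq> sets M"
  unfolding sets_F by (rule sets.sigma_sets_subset[OF gen_sets_subset])

lemma sets_F_mono: "u \<le> v \<Longrightarrow> sets (generated_filtration M X u) \<subseteq> sets (generated_filtration M X v)"
  unfolding sets_F by (rule sigma_sets_mono') force

lemma X_measurable_F: "0 \<le> u \<Longrightarrow> u \<le> v \<Longrightarrow> X u \<in> generated_filtration M X v \<rightarrow>\<^sub>M count_space UNIV"
  by (rule measurableI) (auto simp: sets_F intro!: sigma_sets.Basic)

lemma X_eq_sets_F: "0 \<le> u \<Longrightarrow> u \<le> v \<Longrightarrow> {\<omega>\<in>space M. X u \<omega> \<in> B} \<in> sets (generated_filtration M X v)"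
  using measurable_sets[OF X_measurable_F, of u v B] by (simp add: vimage_def Int_def conj_commute)

lemma X_eq_sets [measurable]: "0 \<le> u \<Longrightarrow> {\<omega>\<in>space M. X u \<omega> \<in> B} \<in> sets M"
  using X_eq_sets_F[of u u B] sets_F_subset by blast

lemma X_eq_sets' [measurable]: "0 \<le> u \<Longrightarrow> {\<omega>\<in>space M. X u \<omega> = j} \<in> sets M"
  using X_eq_sets[of u "{j}"] by simp

lemma measure_split_state:
  assumes "0 \<le> v" "C \<in> sets M"
  shows "measure (P i) C = (\<Sum>l\<in>UNIV. measure (P i) {\<omega>\<in>C. X v \<omega> = l})"
proof -
  interpret prob_space "P i" by (rule P_prob)
  have "C = (\<Union>l\<in>UNIV. {\<omega>\<in>C. X v \<omega> = l})" by auto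
  moreover have "{\<omega>\<in>C. X v \<omega> = l} \<in> sets M" for l
  proof -
    have "{\<omega>\<in>C. X v \<omega> = l} = C \<inter> {\<omega>\<in>space M. X v \<omega> = l}" using sets.sets_into_space[OF assms(2)] by auto
    then show ?thesis using assms by auto
  qed
  ultimately show ?thesis
    using finite_measure_finite_Union[of UNIV "\<lambda>l. {\<omega>\<in>C. X v \<omega> = l}"]
    by (auto simp: disjoint_family_on_def P_sets)
qed

text \<open>On the event that the state at \<open>v\<close> is \<open>l\<close>, the conditional
  probability given by the Markov property is constant; integrating it over that part of
  \<open>C\<close> yields the product.\<close>

lemma markov_step:
  assumes "0 \<le> v" "0 \<le> u" "C \<in> sets (generated_filtration M X v)"
  shows "measure (P i) {\<omega>\<in>C. X v \<omega> = l \<and> X (v + u) \<omega> = j} =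
    measure (P i) {\<omega>\<in>C. X v \<omega> = l} * measure (P l) {\<omega>\<in>space M. X u \<omega> = j}"
proof -
  interpret prob_space "P i" by (rule P_prob)
  interpret finite_measure_subalgebra "P i" "generated_filtration M X v"
    by unfold_locales (use sets_F_subset in \<open>auto simp: subalgebra_def P_sets\<close>)
  have Csub: "C \<subseteq> space M" using sets.sets_into_space[OF assms(3)] by simp
  let ?A = "{\<omega>\<in>C. X v \<omega> = l}" and ?E = "{\<omega>\<in>space M. X (v + u) \<omega> = j}"
  have "?A = C \<inter> {\<omega>\<in>space M. X v \<omega> \<in> {l}}" using Csub by auto
  then have AF: "?A \<in> sets (generated_filtration M X v)"
    using assms X_eq_sets_F[of v v "{l}"] by (simp only: sets.Int)
  then have AM [measurable]: "?A \<in> sets (P i)" using sets_F_subset P_sets by blast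
  have EM [measurable]: "?E \<in> sets (P i)" using assms X_eq_sets' P_sets by simp
  have "measure (P i) {\<omega>\<in>C. X v \<omega> = l \<and> X (v + u) \<omega> = j} = (LINT \<omega>:?A|P i. indicator ?E \<omega>)"
  proof -
    have "(LINT \<omega>:?A|P i. indicator ?E \<omega>) = (LINT \<omega>|P i. indicator (?A \<inter> ?E) \<omega> :: real)"
      unfolding set_lebesgue_integral_def by (intro Bochner_Integration.integral_cong) (auto simp: indicator_def)
    also have "\<dots> = measure (P i) (?A \<inter> ?E)"
    proof -
      have "?A \<inter> ?E \<inter> space (P i) = ?A \<inter> ?E" by auto
      then show ?thesis using AM EM by (simp add: sets.Int)
    qed
    also have "?A \<inter> ?E = {\<omega>\<in>C. X v \<omega> = l \<and> X (v + u) \<omega> = j}" using Csub by auto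
    finally show ?thesis by simp
  qed
  also have "\<dots> = (LINT \<omega>:?A|P i. real_cond_exp (P i) (generated_filtration M X v) (indicator ?E) \<omega>)"
    by (rule real_cond_exp_intA[OF _ AF]) (use EM sets.Int[OF EM sets.top] in \<open>simp add: integrable_indicator_iff less_top[symmetric]\<close>)
  also have "\<dots> = (LINT \<omega>:?A|P i. measure (P l) {\<omega>\<in>space M. X u \<omega> = j})"
    unfolding set_lebesgue_integral_def
  proof (rule integral_cong_AE)
    show "AE \<omega> in P i. indicator ?A \<omega> *\<^sub>R real_cond_exp (P i) (generated_filtration M X v) (indicator ?E) \<omega>
        = indicator ?A \<omega> *\<^sub>R measure (P l) {\<omega>\<in>space M. X u \<omega> = j}"
      using markov[OF assms(1,2), of i j] by eventually_elim (auto simp: indicator_def)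
  qed (use AM in measurable)
  also have "\<dots> = measure (P i) ?A * measure (P l) {\<omega>\<in>space M. X u \<omega> = j}"
  proof -
    have "?A \<inter> space M = ?A" using Csub by auto
    then show ?thesis unfolding set_lebesgue_integral_def using AM by simp
  qed
  finally show ?thesis .
qed

text \<open>Induction removing the largest observation time \<open>m\<close>: conditioning at
  \<open>v + m\<close> separates the last piece, and the induction hypothesis treats the earlier
  times with \<open>m\<close> as end time. The separate end time \<open>w\<close> exists to make
  that hypothesis applicable.\<close>

lemma markov_cylinder:
  assumes v: "0 \<le> v" and C: "C \<in> sets (generated_filtration M X v)"
    and J: "finite J" "J \<subseteq> {0..}" "\<And>u. u \<in> J \<Longrightarrow> u \<le> w" "0 \<le> w"
  shows "measure (P i) {\<omega>\<in>C. X v \<omega> = l \<and> (\<forall>u\<in>J. X (v + u) \<omega> \<in> B u) \<and> X (v + w) \<omega> = j} =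
    measure (P i) {\<omega>\<in>C. X v \<omega> = l} * measure (P l) {\<omega>\<in>space M. (\<forall>u\<in>J. X u \<omega> \<in> B u) \<and> X w \<omega> = j}"
  using J
proof (induction J arbitrary: w j rule: finite_linorder_max_induct)
  case empty
  then show ?case using markov_step[OF v _ C] by simp
next
  case (insert m J)
  have cyl: "{\<omega>\<in>C'. (\<forall>u\<in>J. X (z + u) \<omega> \<in> B u)} \<in> sets (generated_filtration M X (z + m))"
    if "0 \<le> z" "C' \<in> sets (generated_filtration M X (z + m))" for z C'
  proof -
    have "C' \<subseteq> space M" using sets.sets_into_space[OF that(2)] by simp
    then have "{\<omega>\<in>C'. (\<forall>u\<in>J. X (z + u) \<omega> \<in> B u)} =
        C' \<inter> {\<omega>\<in>space (generated_filtration M X (z + m)). \<forall>u\<in>J. X (z + u) \<omega> \<in> B u}" by auto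
    also have "\<dots> \<in> sets (generated_filtration M X (z + m))"
    proof (intro sets.Int sets.sets_Collect_finite_All)
      fix u assume "u \<in> J"
      then show "{\<omega>\<in>space (generated_filtration M X (z + m)). X (z + u) \<omega> \<in> B u} \<in> sets (generated_filtration M X (z + m))"
        using that insert.hyps insert.prems unfolding space_F
        by (intro X_eq_sets_F) (auto simp: less_imp_le)
    qed (use that insert.hyps in auto)
    finally show ?thesis .
  qed
  have m: "0 \<le> m" "m \<le> w" using insert.prems by auto
  have Jm: "\<And>u. u \<in> J \<Longrightarrow> u \<le> m" using insert.hyps by (auto simp: less_imp_le)
  have sub: "{\<omega>\<in>D. X v' \<omega> = k} \<in> sets (generated_filtration M X v'')"
    if "D \<in> sets (generated_filtration M X v'')" "0 \<le> v'" "v' \<le> v''" for D v' v'' k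
  proof -
    have "{\<omega>\<in>D. X v' \<omega> = k} = D \<inter> {\<omega>\<in>space M. X v' \<omega> \<in> {k}}" using sets.sets_into_space[OF that(1)] by auto
    then show ?thesis using that X_eq_sets_F[of v' v'' "{k}"] by (simp only: sets.Int)
  qed
  define D where "D = {\<omega>\<in>{\<omega>\<in>C. X v \<omega> = l}. \<forall>u\<in>J. X (v + u) \<omega> \<in> B u}"
  have D: "D \<in> sets (generated_filtration M X (v + m))" unfolding D_def
    using sets_F_mono[of v "v + m"] C v m by (intro cyl sub) auto
  define D' where "D' = {\<omega>\<in>space M. \<forall>u\<in>J. X u \<omega> \<in> B u}"
  have D': "D' \<in> sets (generated_filtration M X m)"
    using cyl[of 0 "space M"] sets.top[of "generated_filtration M X m"] by (simp add: D'_def)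
  \<comment> \<open>Used under \<open>P i\<close> at time \<open>v + m\<close> and under
    \<open>P l\<close> at time \<open>m\<close>; the two sums are then matched term by term.\<close>
  have split: "measure (P i') {\<omega>\<in>E. X v' \<omega> \<in> B m \<and> X (v' + (w - m)) \<omega> = j}
      = (\<Sum>k\<in>B m. measure (P i') {\<omega>\<in>E. X v' \<omega> = k} * measure (P k) {\<omega>\<in>space M. X (w - m) \<omega> = j})"
    if E: "E \<in> sets (generated_filtration M X v')" "0 \<le> v'" for E v' i'
  proof -
    interpret prob_space "P i'" by (rule P_prob)
    have Esub: "E \<subseteq> space M" using sets.sets_into_space[OF E(1)] by simp
    have "{\<omega>\<in>E. X v' \<omega> \<in> B m \<and> X (v' + (w - m)) \<omega> = j} =
        (\<Union>k\<in>B m. {\<omega>\<in>E. X v' \<omega> = k \<and> X (v' + (w - m)) \<omega> = j})" by auto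
    moreover have "{\<omega>\<in>E. X v' \<omega> = k \<and> X (v' + (w - m)) \<omega> = j} \<in> sets (P i')" for k
    proof -
      have "{\<omega>\<in>E. X v' \<omega> = k \<and> X (v' + (w - m)) \<omega> = j} =
          {\<omega>\<in>E. X v' \<omega> = k} \<inter> {\<omega>\<in>space M. X (v' + (w - m)) \<omega> = j}" using Esub by auto
      moreover have "{\<omega>\<in>E. X v' \<omega> = k} \<in> sets M" using sub[OF E(1), of v' k] E sets_F_subset by blast
      ultimately show ?thesis using E m by (simp add: P_sets sets.Int)
    qed
    ultimately have "measure (P i') {\<omega>\<in>E. X v' \<omega> \<in> B m \<and> X (v' + (w - m)) \<omega> = j}
        = (\<Sum>k\<in>B m. measure (P i') {\<omega>\<in>E. X v' \<omega> = k \<and> X (v' + (w - m)) \<omega> = j})"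
      by (simp only:) (intro finite_measure_finite_Union, auto simp: disjoint_family_on_def)
    also have "\<dots> = (\<Sum>k\<in>B m. measure (P i') {\<omega>\<in>E. X v' \<omega> = k} * measure (P k) {\<omega>\<in>space M. X (w - m) \<omega> = j})"
      using E m by (intro sum.cong refl markov_step) auto
    finally show ?thesis .
  qed
  have "{\<omega>\<in>C. X v \<omega> = l \<and> (\<forall>u\<in>insert m J. X (v + u) \<omega> \<in> B u) \<and> X (v + w) \<omega> = j}
      = {\<omega>\<in>D. X (v + m) \<omega> \<in> B m \<and> X (v + m + (w - m)) \<omega> = j}"
    by (auto simp: D_def)
  then have "measure (P i) {\<omega>\<in>C. X v \<omega> = l \<and> (\<forall>u\<in>insert m J. X (v + u) \<omega> \<in> B u) \<and> X (v + w) \<omega> = j}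
      = (\<Sum>k\<in>B m. measure (P i) {\<omega>\<in>D. X (v + m) \<omega> = k} * measure (P k) {\<omega>\<in>space M. X (w - m) \<omega> = j})"
    using split[OF D, of i] v m by simp
  also have "\<dots> = (\<Sum>k\<in>B m. measure (P i) {\<omega>\<in>C. X v \<omega> = l} *
      measure (P l) {\<omega>\<in>D'. X m \<omega> = k} * measure (P k) {\<omega>\<in>space M. X (w - m) \<omega> = j})"
  proof (intro sum.cong refl arg_cong2[where f = "(*)"])
    fix k
    have "{\<omega>\<in>D. X (v + m) \<omega> = k} = {\<omega>\<in>C. X v \<omega> = l \<and> (\<forall>u\<in>J. X (v + u) \<omega> \<in> B u) \<and> X (v + m) \<omega> = k}"
      "{\<omega>\<in>D'. X m \<omega> = k} = {\<omega>\<in>space M. (\<forall>u\<in>J. X u \<omega> \<in> B u) \<and> X m \<omega> = k}"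
      by (auto simp: D_def D'_def)
    then show "measure (P i) {\<omega>\<in>D. X (v + m) \<omega> = k} =
        measure (P i) {\<omega>\<in>C. X v \<omega> = l} * measure (P l) {\<omega>\<in>D'. X m \<omega> = k}"
      using insert.IH[of m k] insert.prems Jm m by simp
  qed
  also have "\<dots> = measure (P i) {\<omega>\<in>C. X v \<omega> = l} *
      measure (P l) {\<omega>\<in>D'. X m \<omega> \<in> B m \<and> X (m + (w - m)) \<omega> = j}"
    using split[OF D' m(1), of l] by (simp add: sum_distrib_left mult.assoc)
  also have "{\<omega>\<in>D'. X m \<omega> \<in> B m \<and> X (m + (w - m)) \<omega> = j}
      = {\<omega>\<in>space M. (\<forall>u\<in>insert m J. X u \<omega> \<in> B u) \<and> X w \<omega> = j}"
    by (auto simp: D'_def)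
  finally show ?case .
qed

definition future :: "real \<Rightarrow> 'w \<Rightarrow> real \<Rightarrow> 's" where
  "future v \<omega> = (\<lambda>u\<in>{0..}. X (v + u) \<omega>)"

lemma future_measurable:
  assumes "0 \<le> v" shows "future v \<in> M \<rightarrow>\<^sub>M path_space"
  unfolding future_def path_space_def using assms by (intro measurable_restrict X_measurable) auto

text \<open>For fixed \<open>C\<close> and \<open>l\<close> both sides are finite measures in
  \<open>D\<close>. They agree on cylinders by \<open>markov_cylinder\<close>, and cylinders
  determine a finite measure on the product.\<close>

lemma markov_path_set:
  assumes v: "0 \<le> v" and C: "C \<in> sets (generated_filtration M X v)"
    and D: "D \<in> sets path_space"
  shows "measure (P i) {\<omega>\<in>C. X v \<omega> = l \<and> future v \<omega> \<in> D} =
    measure (P i) {\<omega>\<in>C. X v \<omega> = l} * measure (P l) {\<omega>\<in>space M. future 0 \<omega> \<in> D}"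
proof -
  interpret Pi: prob_space "P i" by (rule P_prob)
  interpret Pl: prob_space "P l" by (rule P_prob)
  have Csub: "C \<subseteq> space M" using sets.sets_into_space[OF C] by simp
  have CM: "C \<in> sets M" using C sets_F_subset by blast
  define A where "A = {\<omega>\<in>C. X v \<omega> = l}"
  have "A = C \<inter> {\<omega>\<in>space M. X v \<omega> = l}" using Csub by (auto simp: A_def)
  then have A: "A \<in> sets M" using CM v by simp
  have fm: "future v' \<in> P i' \<rightarrow>\<^sub>M path_space" if "0 \<le> v'" for v' i'
    using future_measurable[OF that] measurable_cong_sets[OF P_sets refl] by blast
  define N1 where "N1 = distr (density (P i) (indicator A)) path_space (future v)"
  define N2 where "N2 = scale_measure (emeasure (P i) A) (distr (P l) path_space (future 0))"
  have e1: "emeasure N1 S = ennreal (measure (P i) {\<omega>\<in>A. future v \<omega> \<in> S})" if "S \<in> sets path_space" for S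
  proof -
    have S: "future v -` S \<inter> space M \<in> sets M" by (rule measurable_sets[OF future_measurable[OF v] that])
    have "emeasure N1 S = emeasure (density (P i) (indicator A)) (future v -` S \<inter> space M)"
      unfolding N1_def using that fm[OF v] by (subst emeasure_distr) auto
    also have "\<dots> = emeasure (P i) (A \<inter> (future v -` S \<inter> space M))"
    proof -
      have [measurable]: "A \<in> sets (P i)" "future v -` S \<inter> space M \<in> sets (P i)" using S A by (simp_all add: P_sets)
      then have "A \<inter> (future v -` S \<inter> space M) \<in> sets (P i)" by (rule sets.Int)
      then show ?thesis by (subst emeasure_density) (simp_all flip: indicator_inter_arith)
    qed
    also have "A \<inter> (future v -` S \<inter> space M) = {\<omega>\<in>A. future v \<omega> \<in> S}" using Csub by (auto simp: A_def)
    finally show ?thesis by (simp add: Pi.emeasure_eq_measure)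
  qed
  have e2: "emeasure N2 S = ennreal (measure (P i) A * measure (P l) {\<omega>\<in>space M. future 0 \<omega> \<in> S})"
    if "S \<in> sets path_space" for S
  proof -
    have "emeasure N2 S = emeasure (P i) A * emeasure (P l) (future 0 -` S \<inter> space M)"
      unfolding N2_def using that fm[of 0 l] by (simp add: emeasure_distr)
    also have "future 0 -` S \<inter> space M = {\<omega>\<in>space M. future 0 \<omega> \<in> S}" by auto
    finally show ?thesis by (simp add: Pi.emeasure_eq_measure Pl.emeasure_eq_measure ennreal_mult)
  qed
  have "N1 = N2"
    unfolding path_space_def
  proof (rule measure_eqI_PiM_infinite)
    show "sets N1 = sets (\<Pi>\<^sub>M u\<in>{0..}. count_space UNIV)"
      "sets N2 = sets (\<Pi>\<^sub>M u\<in>{0..}. count_space UNIV)"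
      by (simp_all add: N1_def N2_def path_space_def)
    show "finite_measure N1"
    proof
      have "space N1 = space path_space" by (simp add: N1_def)
      then show "emeasure N1 (space N1) \<noteq> \<infinity>" using e1[of "space path_space"] by simp
    qed
    fix B :: "real \<Rightarrow> 's set" and J :: "real set" assume J: "finite J" "J \<subseteq> {0..}"
    define S where "S = prod_emb {0..} (\<lambda>_. count_space UNIV) J (Pi\<^sub>E J B)"
    have S: "S \<in> sets path_space" unfolding S_def path_space_def
      using J by (intro sets_PiM_I) auto
    have fS: "future v' \<omega> \<in> S \<longleftrightarrow> (\<forall>u\<in>J. X (v' + u) \<omega> \<in> B u)" for v' \<omega>
      using J by (auto simp: S_def prod_emb_def future_def space_PiM PiE_iff subset_eq)
    \<comment> \<open>Inserting 0 covers the cylinder without conditions; summing over the state at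
      \<open>w\<close> removes the end condition of \<open>markov_cylinder\<close>.\<close>
    define w where "w = Max (insert 0 J)"
    have w: "\<And>u. u \<in> J \<Longrightarrow> u \<le> w" "0 \<le> w" using J by (auto simp: w_def)
    have cylM: "{\<omega>\<in>E. X v \<omega> = l \<and> (\<forall>u\<in>J. X (v + u) \<omega> \<in> B u)} \<in> sets M" if "E \<in> sets M" for E
    proof -
      have "{\<omega>\<in>E. X v \<omega> = l \<and> (\<forall>u\<in>J. X (v + u) \<omega> \<in> B u)}
        = E \<inter> {\<omega>\<in>space M. X v \<omega> = l} \<inter> {\<omega>\<in>space M. \<forall>u\<in>J. X (v + u) \<omega> \<in> B u}"
        using sets.sets_into_space[OF that] by auto
      also have "\<dots> \<in> sets M"
        using v J that by (intro sets.Int sets.sets_Collect_finite_All) auto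
      finally show ?thesis .
    qed
    have cylM': "{\<omega>\<in>space M. \<forall>u\<in>J. X u \<omega> \<in> B u} \<in> sets M"
      using J by (intro sets.sets_Collect_finite_All) auto
    have "measure (P i) {\<omega>\<in>A. \<forall>u\<in>J. X (v + u) \<omega> \<in> B u}
        = (\<Sum>j\<in>UNIV. measure (P i) {\<omega>\<in>C. X v \<omega> = l \<and> (\<forall>u\<in>J. X (v + u) \<omega> \<in> B u) \<and> X (v + w) \<omega> = j})"
    proof -
      have "{\<omega>\<in>A. \<forall>u\<in>J. X (v + u) \<omega> \<in> B u} = {\<omega>\<in>C. X v \<omega> = l \<and> (\<forall>u\<in>J. X (v + u) \<omega> \<in> B u)}"
        by (auto simp: A_def)
      moreover have "{\<omega> \<in> {\<omega>\<in>C. X v \<omega> = l \<and> (\<forall>u\<in>J. X (v + u) \<omega> \<in> B u)}. X (v + w) \<omega> = j}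
        = {\<omega>\<in>C. X v \<omega> = l \<and> (\<forall>u\<in>J. X (v + u) \<omega> \<in> B u) \<and> X (v + w) \<omega> = j}" for j by auto
      ultimately show ?thesis
        using measure_split_state[of "v + w" "{\<omega>\<in>C. X v \<omega> = l \<and> (\<forall>u\<in>J. X (v + u) \<omega> \<in> B u)}" i]
          cylM[OF CM] v w by simp
    qed
    also have "\<dots> = measure (P i) A * (\<Sum>j\<in>UNIV. measure (P l) {\<omega>\<in>space M. (\<forall>u\<in>J. X u \<omega> \<in> B u) \<and> X w \<omega> = j})"
      using markov_cylinder[OF v C J w] by (simp add: sum_distrib_left A_def)
    also have "(\<Sum>j\<in>UNIV. measure (P l) {\<omega>\<in>space M. (\<forall>u\<in>J. X u \<omega> \<in> B u) \<and> X w \<omega> = j})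
        = measure (P l) {\<omega>\<in>space M. \<forall>u\<in>J. X u \<omega> \<in> B u}"
      using measure_split_state[OF w(2) cylM', of l] by (simp add: conj_assoc)
    finally have "emeasure N1 S = emeasure N2 S"
      unfolding e1[OF S] e2[OF S] fS by simp
    then show "emeasure N1 (prod_emb {0..} (\<lambda>u. count_space UNIV) J (Pi\<^sub>E J B)) =
        emeasure N2 (prod_emb {0..} (\<lambda>u. count_space UNIV) J (Pi\<^sub>E J B))" by (simp add: S_def)
  qed
  then have "emeasure N1 D = emeasure N2 D" by simp
  then have "measure (P i) {\<omega>\<in>A. future v \<omega> \<in> D} = measure (P i) A * measure (P l) {\<omega>\<in>space M. future 0 \<omega> \<in> D}"
    unfolding e1[OF D] e2[OF D] by (simp add: measure_nonneg)
  moreover have "{\<omega>\<in>A. future v \<omega> \<in> D} = {\<omega>\<in>C. X v \<omega> = l \<and> future v \<omega> \<in> D}" by (auto simp: A_def)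
  ultimately show ?thesis by (simp add: A_def)
qed

abbreviation traj :: "'w \<Rightarrow> real \<Rightarrow> 's" where
  "traj \<omega> u \<equiv> X u \<omega>"

lemma path_shift_0: "shift_path 0 (traj \<omega>) = traj \<omega>"
  by (simp add: shift_path_def fun_eq_iff)

lemma right_continuous_path: "\<omega> \<in> space M \<Longrightarrow> right_continuous_path (traj \<omega>)"
  using X_right_continuous by simp

text \<open>One set serves shifted and stopped trajectories alike, since both are right-continuous;
  restricting them to nonnegative times makes them points of the product.\<close>

lemma path_event_iff:
  assumes "path_event R"
  obtains D where "D \<in> sets path_space"
    "\<And>\<omega> v. \<omega> \<in> space M \<Longrightarrow> 0 \<le> v \<Longrightarrow> future v \<omega> \<in> D \<longleftrightarrow> R (shift_path v (traj \<omega>))"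
    "\<And>\<omega> v d. \<omega> \<in> space M \<Longrightarrow> 0 \<le> v \<Longrightarrow> 0 \<le> d \<Longrightarrow>
      (\<lambda>u\<in>{0..}. X (v + min u d) \<omega>) \<in> D \<longleftrightarrow> R (\<lambda>u. X (v + min u d) \<omega>)"
proof -
  obtain D where D: "D \<in> sets path_space"
      "\<And>x. x \<in> space path_space \<Longrightarrow> right_continuous_path x \<Longrightarrow> (x \<in> D \<longleftrightarrow> R x)"
    using assms unfolding path_event_def by blast
  have restr: "restrict x {0..} \<in> D \<longleftrightarrow> R x" if "right_continuous_path x" for x
  proof -
    have "restrict x {0..} \<in> space path_space" by (simp add: path_space_def space_PiM)
    moreover have "right_continuous_path (restrict x {0..})"
      using that by (subst right_continuous_path_cong[of _ x]) auto
    ultimately have "restrict x {0..} \<in> D \<longleftrightarrow> R (restrict x {0..})" by (rule D(2))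
    also have "\<dots> \<longleftrightarrow> R x" by (rule path_event_cong[OF assms]) simp
    finally show ?thesis .
  qed
  show thesis
  proof (rule that[OF D(1)])
    fix \<omega> and v d :: real assume w: "\<omega> \<in> space M" "0 \<le> v"
    have r: "right_continuous_path (shift_path v (traj \<omega>))"
      by (rule right_continuous_path_shift[OF right_continuous_path[OF w(1)] w(2)])
    have "future v \<omega> = restrict (shift_path v (traj \<omega>)) {0..}"
      by (simp add: future_def shift_path_def restrict_def fun_eq_iff)
    with restr[OF r] show "future v \<omega> \<in> D \<longleftrightarrow> R (shift_path v (traj \<omega>))" by simp
    assume d: "0 \<le> d"
    have "right_continuous_path (\<lambda>u. X (v + min u d) \<omega>)"
      using right_continuous_path_stopped[OF r d] by (simp add: shift_path_def)
    from restr[OF this]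
    show "(\<lambda>u\<in>{0..}. X (v + min u d) \<omega>) \<in> D \<longleftrightarrow> R (\<lambda>u. X (v + min u d) \<omega>)" .
  qed
qed

lemma path_event_sets:
  assumes "path_event R" "0 \<le> v"
  shows "{\<omega>\<in>space M. R (shift_path v (traj \<omega>))} \<in> sets M"
proof -
  obtain D where D: "D \<in> sets path_space"
    "\<And>\<omega> v. \<omega> \<in> space M \<Longrightarrow> 0 \<le> v \<Longrightarrow> future v \<omega> \<in> D \<longleftrightarrow> R (shift_path v (traj \<omega>))"
    by (rule path_event_iff[OF assms(1)]) blast
  have "{\<omega>\<in>space M. R (shift_path v (traj \<omega>))} = future v -` D \<inter> space M"
    using D(2) assms(2) by auto
  then show ?thesis using measurable_sets[OF future_measurable[OF assms(2)] D(1)] by simp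
qed

lemma path_event_sets_0: "path_event R \<Longrightarrow> {\<omega>\<in>space M. R (traj \<omega>)} \<in> sets M"
  using path_event_sets[of R 0] by (simp add: path_shift_0)

text \<open>Stopping the shifted trajectory after \<open>d\<close> does not affect \<open>R\<close>,
  and the stopped trajectory is a measurable function of the observations up to
  \<open>v + d\<close>.\<close>

lemma determined_sets_F:
  assumes "path_event R" "determined d R" "0 \<le> v" "0 \<le> d"
  shows "{\<omega>\<in>space M. R (shift_path v (traj \<omega>))} \<in> sets (generated_filtration M X (v + d))"
proof -
  obtain D where D: "D \<in> sets path_space"
    "\<And>\<omega> v d. \<omega> \<in> space M \<Longrightarrow> 0 \<le> v \<Longrightarrow> 0 \<le> d \<Longrightarrow>
      (\<lambda>u\<in>{0..}. X (v + min u d) \<omega>) \<in> D \<longleftrightarrow> R (\<lambda>u. X (v + min u d) \<omega>)"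
    by (rule path_event_iff[OF assms(1)]) blast
  define Z where "Z \<omega> = (\<lambda>u\<in>{0..}. X (v + min u d) \<omega>)" for \<omega>
  have Z: "Z \<in> generated_filtration M X (v + d) \<rightarrow>\<^sub>M path_space"
    unfolding Z_def path_space_def using assms by (intro measurable_restrict X_measurable_F) auto
  have "R (\<lambda>u. X (v + min u d) \<omega>) \<longleftrightarrow> R (shift_path v (traj \<omega>))" for \<omega>
    by (rule determined_cong[OF assms(2)]) (simp add: shift_path_def)
  then have "{\<omega>\<in>space M. R (shift_path v (traj \<omega>))} = Z -` D \<inter> space (generated_filtration M X (v + d))"
    using D(2) assms by (auto simp: Z_def)
  then show ?thesis using measurable_sets[OF Z D(1)] by simp
qed

lemma markov_path:
  assumes R: "path_event R" and v: "0 \<le> v" and C: "C \<in> sets (generated_filtration M X v)"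
  shows "measure (P i) {\<omega>\<in>C. X v \<omega> = l \<and> R (shift_path v (traj \<omega>))} =
    measure (P i) {\<omega>\<in>C. X v \<omega> = l} * measure (P l) {\<omega>\<in>space M. R (traj \<omega>)}"
proof -
  obtain D where D: "D \<in> sets path_space"
    "\<And>\<omega> v. \<omega> \<in> space M \<Longrightarrow> 0 \<le> v \<Longrightarrow> future v \<omega> \<in> D \<longleftrightarrow> R (shift_path v (traj \<omega>))"
    by (rule path_event_iff[OF R]) blast
  have "C \<subseteq> space M" using sets.sets_into_space[OF C] by simp
  then have "{\<omega>\<in>C. X v \<omega> = l \<and> R (shift_path v (traj \<omega>))} = {\<omega>\<in>C. X v \<omega> = l \<and> future v \<omega> \<in> D}"
    using D(2) v by auto
  moreover have "{\<omega>\<in>space M. R (traj \<omega>)} = {\<omega>\<in>space M. future 0 \<omega> \<in> D}"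
    using D(2)[of _ 0] by (auto simp: path_shift_0)
  ultimately show ?thesis using markov_path_set[OF v C D(1)] by simp
qed

section \<open>Transition kernels of path events\<close>

text \<open>The final state is recorded so that succession of events becomes matrix multiplication;
  rows may sum to less than 1.\<close>

definition kern :: "((real \<Rightarrow> 's) \<Rightarrow> bool) \<Rightarrow> real \<Rightarrow> real^'s^'s" where
  "kern R d = (\<chi> i j. measure (P i) {\<omega>\<in>space M. R (traj \<omega>) \<and> X d \<omega> = j})"

lemma kern_nonneg: "0 \<le> kern R d $ i $ j"
  by (simp add: kern_def)

lemma AE_start: "AE \<omega> in P i. X 0 \<omega> = i"
proof -
  interpret prob_space "P i" by (rule P_prob)
  have "{\<omega>\<in>space M. X 0 \<omega> = i} = {\<omega>\<in>space (P i). X 0 \<omega> = i}" by simp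
  then show ?thesis using P_start[of i] prob_Collect_eq_1[of "\<lambda>\<omega>. X 0 \<omega> = i"] by (simp add: P_sets)
qed

lemma measure_cong_start:
  assumes "A \<in> sets M" "B \<in> sets M"
    and "\<And>\<omega>. \<omega> \<in> space M \<Longrightarrow> X 0 \<omega> = i \<Longrightarrow> \<omega> \<in> A \<longleftrightarrow> \<omega> \<in> B"
  shows "measure (P i) A = measure (P i) B"
proof (rule measure_eq_AE)
  show "AE \<omega> in P i. \<omega> \<in> A \<longleftrightarrow> \<omega> \<in> B" using AE_start[of i] AE_space by eventually_elim (use assms(3) in auto)
qed (use assms in \<open>auto simp: P_sets\<close>)

lemma kern_compose_event:
  assumes C: "C \<in> sets (generated_filtration M X v)" and v: "0 \<le> v" and R: "path_event R" and d: "0 \<le> d"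
  shows "measure (P i) {\<omega>\<in>C. R (shift_path v (traj \<omega>)) \<and> X (v + d) \<omega> = j} =
    (\<Sum>l\<in>UNIV. measure (P i) {\<omega>\<in>C. X v \<omega> = l} * kern R d $ l $ j)"
proof -
  let ?R = "\<lambda>x. R x \<and> x d \<in> {j}"
  have R': "path_event ?R" by (intro path_event_conj R path_event_eval d)
  have Csub: "C \<subseteq> space M" using sets.sets_into_space[OF C] by simp
  have "{\<omega>\<in>C. R (shift_path v (traj \<omega>)) \<and> X (v + d) \<omega> = j} = C \<inter> {\<omega>\<in>space M. ?R (shift_path v (traj \<omega>))}"
    using Csub by (auto simp: shift_path_def)
  moreover have "C \<in> sets M" using C sets_F_subset by blast
  ultimately have "{\<omega>\<in>C. R (shift_path v (traj \<omega>)) \<and> X (v + d) \<omega> = j} \<in> sets M"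
    using path_event_sets[OF R' v] by (simp add: sets.Int)
  from measure_split_state[OF v this, of i]
  have "measure (P i) {\<omega>\<in>C. R (shift_path v (traj \<omega>)) \<and> X (v + d) \<omega> = j}
      = (\<Sum>l\<in>UNIV. measure (P i) {\<omega>\<in>{\<omega>\<in>C. R (shift_path v (traj \<omega>)) \<and> X (v + d) \<omega> = j}. X v \<omega> = l})"
    using Csub by auto
  also have "\<dots> = (\<Sum>l\<in>UNIV. measure (P i) {\<omega>\<in>C. X v \<omega> = l \<and> ?R (shift_path v (traj \<omega>))})"
    by (intro sum.cong refl arg_cong[where f = "measure (P i)"]) (auto simp: shift_path_def)
  also have "\<dots> = (\<Sum>l\<in>UNIV. measure (P i) {\<omega>\<in>C. X v \<omega> = l} * kern R d $ l $ j)"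
    using markov_path[OF R' v C] by (simp add: kern_def)
  finally show ?thesis .
qed

text \<open>The Markov property at time \<open>d\<close>: the first event, determined up to
  \<open>d\<close>, belongs to the conditioning sigma-algebra, and summing over the state at
  \<open>d\<close> is a matrix product.\<close>

lemma kern_compose:
  assumes "path_event R" "determined d R" "0 \<le> d" "path_event R'" "0 \<le> d'"
  shows "kern (\<lambda>x. R x \<and> R' (shift_path d x)) (d + d') = kern R d ** kern R' d'"
proof -
  let ?C = "{\<omega>\<in>space M. R (traj \<omega>)}"
  have C: "?C \<in> sets (generated_filtration M X d)"
    using determined_sets_F[OF assms(1,2), of 0] assms(3) by (simp add: path_shift_0)
  have "kern (\<lambda>x. R x \<and> R' (shift_path d x)) (d + d') $ i $ j = (kern R d ** kern R' d') $ i $ j" for i j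
  proof -
    have "{\<omega>\<in>space M. (R (traj \<omega>) \<and> R' (shift_path d (traj \<omega>))) \<and> X (d + d') \<omega> = j}
        = {\<omega>\<in>?C. R' (shift_path d (traj \<omega>)) \<and> X (d + d') \<omega> = j}" by auto
    then show ?thesis
      using kern_compose_event[OF C assms(3,4,5), of i j]
      by (simp add: kern_def matrix_matrix_mult_def)
  qed
  then show ?thesis by (simp add: vec_eq_iff)
qed

lemma measure_P_space [simp]: "measure (P i) (space M) = 1"
proof -
  interpret prob_space "P i" by (rule P_prob)
  show ?thesis using prob_space by simp
qed

lemma kern_0:
  "kern (\<lambda>x. x 0 \<in> W) 0 = (\<chi> i j. if i = j \<and> i \<in> W then 1 else 0)"
proof -
  have "measure (P i) {\<omega>\<in>space M. X 0 \<omega> \<in> W \<and> X 0 \<omega> = j} = (if i = j \<and> i \<in> W then 1 else 0)" for i j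
  proof -
    interpret prob_space "P i" by (rule P_prob)
    have "{\<omega>\<in>space M. X 0 \<omega> \<in> W \<and> X 0 \<omega> = j} = {\<omega>\<in>space M. X 0 \<omega> \<in> W \<inter> {j}}" by auto
    then have "measure (P i) {\<omega>\<in>space M. X 0 \<omega> \<in> W \<and> X 0 \<omega> = j}
        = measure (P i) (if i = j \<and> i \<in> W then space M else {})"
      by (intro measure_cong_start) (auto simp: X_eq_sets)
    then show ?thesis by auto
  qed
  then show ?thesis by (simp add: kern_def vec_eq_iff)
qed

section \<open>Short-time estimates for the number of jumps\<close>

definition trans_prob :: "real \<Rightarrow> 's \<Rightarrow> 's \<Rightarrow> real" where
  "trans_prob u i j = measure (P i) {\<omega>\<in>space M. X u \<omega> = j}"

lemma trans_prob_sum: "0 \<le> u \<Longrightarrow> (\<Sum>j\<in>UNIV. trans_prob u i j) = 1"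
proof -
  interpret prob_space "P i" by (rule P_prob)
  show "0 \<le> u \<Longrightarrow> (\<Sum>j\<in>UNIV. trans_prob u i j) = 1"
    using measure_split_state[of u "space M" i] prob_space by (simp add: trans_prob_def)
qed

text \<open>The diagonal intensities bound the probability of being away from the start; finiteness
  of the state space makes the constant and the range of times uniform in \<open>i\<close>.\<close>

lemma jump_rate_bound:
  obtains c h0 where "0 \<le> c" "0 < h0"
    "\<And>i h. 0 < h \<Longrightarrow> h < h0 \<Longrightarrow> measure (P i) {\<omega>\<in>space M. X h \<omega> \<noteq> i} \<le> c * h"
proof -
  have compl: "measure (P i) {\<omega>\<in>space M. X h \<omega> \<noteq> i} = 1 - trans_prob h i i" if "0 \<le> h" for i h
  proof -
    interpret prob_space "P i" by (rule P_prob)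
    have "{\<omega>\<in>space M. X h \<omega> \<noteq> i} = space (P i) - {\<omega>\<in>space M. X h \<omega> = i}" by auto
    then show ?thesis using prob_compl[of "{\<omega>\<in>space M. X h \<omega> = i}"] that by (simp add: trans_prob_def P_sets)
  qed
  have "\<forall>\<^sub>F h in at_right 0. lam $ i $ i - 1 < (trans_prob h i i - 1) / h" for i
    using order_tendstoD(1)[OF intensity[of i i], of "lam $ i $ i - 1"] by (simp add: trans_prob_def)
  then have "\<forall>\<^sub>F h in at_right 0. \<forall>i. lam $ i $ i - 1 < (trans_prob h i i - 1) / h"
    by (simp add: eventually_all_finite)
  then obtain h0 where h0: "0 < h0"
    "\<And>h i. 0 < h \<Longrightarrow> h < h0 \<Longrightarrow> lam $ i $ i - 1 < (trans_prob h i i - 1) / h"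
    unfolding eventually_at_right_field by blast
  define c where "c = (\<Sum>i\<in>UNIV. 1 + \<bar>lam $ i $ i\<bar>)"
  have "measure (P i) {\<omega>\<in>space M. X h \<omega> \<noteq> i} \<le> c * h" if "0 < h" "h < h0" for h i
  proof -
    have "1 - trans_prob h i i \<le> (1 - lam $ i $ i) * h"
      using pos_less_divide_eq[THEN iffD1, OF that(1) h0(2)[OF that, of i]] by (simp add: algebra_simps)
    also have "1 - lam $ i $ i \<le> 1 + \<bar>lam $ i $ i\<bar>" by simp
    also have "1 + \<bar>lam $ i $ i\<bar> \<le> c" unfolding c_def by (rule member_le_sum) auto
    finally show ?thesis using that compl[of h i] by simp
  qed
  then show thesis using h0(1) by (intro that[of c h0]) (auto simp: c_def intro: sum_nonneg)
qed

lemma change_sets: "0 \<le> u \<Longrightarrow> u \<le> v \<Longrightarrow> v \<le> w \<Longrightarrow>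
    {\<omega>\<in>space M. X u \<omega> \<noteq> X v \<omega>} \<in> sets (generated_filtration M X w)"
proof -
  assume a: "0 \<le> u" "u \<le> v" "v \<le> w"
  have "{\<omega>\<in>space M. X u \<omega> \<noteq> X v \<omega>} =
      (\<Union>i\<in>UNIV. {\<omega>\<in>space M. X u \<omega> \<in> {i}} \<inter> {\<omega>\<in>space M. X v \<omega> \<in> - {i}})" by auto
  also have "\<dots> \<in> sets (generated_filtration M X w)"
    using a by (intro sets.finite_UN sets.Int X_eq_sets_F) auto
  finally show ?thesis .
qed

text \<open>Given the state at \<open>v\<close>, a change after time \<open>h\<close> is a departure
  of the restarted process from its starting state.\<close>

lemma change_bound:
  assumes c: "\<And>i. measure (P i) {\<omega>\<in>space M. X h \<omega> \<noteq> i} \<le> c"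
    and C: "C \<in> sets (generated_filtration M X v)" and v: "0 \<le> v" and h: "0 \<le> h"
  shows "measure (P i) {\<omega>\<in>C. X v \<omega> \<noteq> X (v + h) \<omega>} \<le> c * measure (P i) C"
proof -
  have Csub: "C \<subseteq> space M" using sets.sets_into_space[OF C] by simp
  have CM: "C \<in> sets M" using C sets_F_subset by blast
  have "{\<omega>\<in>space M. X v \<omega> \<noteq> X (v + h) \<omega>} \<in> sets M"
    using change_sets[of v "v + h" "v + h"] v h sets_F_subset by auto
  moreover have "{\<omega>\<in>C. X v \<omega> \<noteq> X (v + h) \<omega>} = C \<inter> {\<omega>\<in>space M. X v \<omega> \<noteq> X (v + h) \<omega>}" using Csub by auto
  ultimately have "{\<omega>\<in>C. X v \<omega> \<noteq> X (v + h) \<omega>} \<in> sets M" using CM by simp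
  from measure_split_state[OF v this]
  have "measure (P i) {\<omega>\<in>C. X v \<omega> \<noteq> X (v + h) \<omega>}
      = (\<Sum>l\<in>UNIV. measure (P i) {\<omega>\<in>{\<omega>\<in>C. X v \<omega> \<noteq> X (v + h) \<omega>}. X v \<omega> = l})" using Csub by auto
  also have "\<dots> = (\<Sum>l\<in>UNIV. measure (P i) {\<omega>\<in>C. X v \<omega> = l \<and> shift_path v (traj \<omega>) h \<in> - {l}})"
    by (intro sum.cong refl arg_cong[where f = "measure (P i)"]) (auto simp: shift_path_def)
  also have "\<dots> = (\<Sum>l\<in>UNIV. measure (P i) {\<omega>\<in>C. X v \<omega> = l} * measure (P l) {\<omega>\<in>space M. X h \<omega> \<in> - {l}})"
    by (intro sum.cong refl markov_path path_event_eval h v C)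
  also have "\<dots> \<le> (\<Sum>l\<in>UNIV. measure (P i) {\<omega>\<in>C. X v \<omega> = l} * c)"
    using c by (intro sum_mono mult_left_mono) auto
  also have "\<dots> = c * measure (P i) C"
    using measure_split_state[OF v CM, of i] by (simp add: sum_distrib_left mult.commute)
  finally show ?thesis .
qed

(* The set of paths with two jumps need not be measurable, hence the covering set Z. *)
lemma two_jumps_bound:
  obtains c where "0 \<le> c" "\<And>h. 0 < h \<Longrightarrow> \<exists>Z\<in>sets M. (\<forall>i. measure (P i) Z \<le> c * h\<^sup>2) \<and>
      (\<forall>\<omega>\<in>space M. two_jumps h (traj \<omega>) \<longrightarrow> \<omega> \<in> Z)"
proof -
  obtain c h0 where c: "0 \<le> c" "0 < h0"
    "\<And>i h. 0 < h \<Longrightarrow> h < h0 \<Longrightarrow> measure (P i) {\<omega>\<in>space M. X h \<omega> \<noteq> i} \<le> c * h"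
    by (rule jump_rate_bound) blast
  have "\<exists>Z\<in>sets M. (\<forall>i. measure (P i) Z \<le> c\<^sup>2 * h\<^sup>2) \<and>
      (\<forall>\<omega>\<in>space M. two_jumps h (traj \<omega>) \<longrightarrow> \<omega> \<in> Z)" if h: "0 < h" for h
  proof -
    define ch where "ch N m = {\<omega>\<in>space M. X (real m * (h / real N)) \<omega> \<noteq> X (real (Suc m) * (h / real N)) \<omega>}"
      for N m :: nat
    define J where "J N = (\<Union>m\<in>{..<N}. \<Union>m'\<in>{m<..<N}. ch N m \<inter> ch N m')" for N :: nat
    have ch_F: "ch N m \<in> sets (generated_filtration M X (real m' * (h / real N)))" if "m < m'" for N m m'
      unfolding ch_def using h that by (intro change_sets mult_right_mono mult_nonneg_nonneg) auto
    have ch_M: "ch N m \<in> sets M" for N m using ch_F[of m "Suc m" N] sets_F_subset by auto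
    have J_M: "J N \<in> sets M" for N unfolding J_def by (intro sets.finite_UN sets.Int ch_M) auto
    \<comment> \<open>There are at most \<open>N\<close> squared pairs of grid cells, and two uses
      of the Markov property bound each pair by the square of \<open>c * (h / N)\<close>; the number
      \<open>N\<close> cancels.\<close>
    have J_bound: "measure (P i) (J N) \<le> c\<^sup>2 * h\<^sup>2" if N: "h / real N < h0" "0 < N" for N i
    proof -
      interpret prob_space "P i" by (rule P_prob)
      let ?d = "h / real N"
      have d: "0 < ?d" using h N by simp
      have cd: "measure (P i) {\<omega>\<in>space M. X ?d \<omega> \<noteq> i} \<le> c * ?d" for i
        by (rule c(3)[OF d N(1)])
      have one: "measure (P i) {\<omega>\<in>C. X (real m * ?d) \<omega> \<noteq> X (real (Suc m) * ?d) \<omega>} \<le> c * ?d * measure (P i) C"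
        if "C \<in> sets (generated_filtration M X (real m * ?d))" for C m
      proof -
        have eq: "real (Suc m) * ?d = real m * ?d + ?d"
          by (simp only: of_nat_Suc distrib_right mult_1_left add.commute)
        have "0 \<le> real m * ?d" using d by (intro mult_nonneg_nonneg) simp_all
        then show ?thesis unfolding eq by (rule change_bound[OF cd that]) (use d in simp)
      qed
      have two: "measure (P i) (ch N m \<inter> ch N m') \<le> (c * ?d)\<^sup>2" if "m < m'" for m m'
      proof -
        have "ch N m \<inter> ch N m' = {\<omega>\<in>ch N m. X (real m' * ?d) \<omega> \<noteq> X (real (Suc m') * ?d) \<omega>}"
          by (auto simp: ch_def)
        then have "measure (P i) (ch N m \<inter> ch N m') \<le> c * ?d * measure (P i) (ch N m)"
          using one[OF ch_F[OF that]] by simp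
        also have "\<dots> \<le> c * ?d * (c * ?d)"
        proof (rule mult_left_mono)
          have "measure (P i) (ch N m) \<le> c * ?d * measure (P i) (space M)"
            unfolding ch_def using sets.top[of "generated_filtration M X (real m * ?d)"] by (intro one) simp
          then show "measure (P i) (ch N m) \<le> c * ?d" by simp
        qed (intro mult_nonneg_nonneg c(1) less_imp_le[OF d])
        finally show ?thesis by (simp only: power2_eq_square)
      qed
      have "measure (P i) (J N) \<le> (\<Sum>m<N. measure (P i) (\<Union>m'\<in>{m<..<N}. ch N m \<inter> ch N m'))"
        unfolding J_def by (rule finite_measure_subadditive_finite) (auto simp: P_sets ch_M intro!: sets.finite_UN)
      also have "\<dots> \<le> (\<Sum>m<N. \<Sum>m'\<in>{m<..<N}. measure (P i) (ch N m \<inter> ch N m'))"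
        by (intro sum_mono finite_measure_subadditive_finite) (auto simp: P_sets ch_M)
      also have "\<dots> \<le> (\<Sum>m<N. \<Sum>m'\<in>{m<..<N}. (c * ?d)\<^sup>2)" by (intro sum_mono two) auto
      also have "\<dots> \<le> (\<Sum>m<N. real N * (c * ?d)\<^sup>2)"
        by (intro sum_mono) (auto intro!: mult_right_mono)
      also have "\<dots> = (real N * ?d * c)\<^sup>2" by (simp add: power2_eq_square)
      also have "\<dots> = c\<^sup>2 * h\<^sup>2" using N by (simp add: power_mult_distrib mult.commute)
      finally show ?thesis .
    qed
    \<comment> \<open>The lower limit of the events \<open>J N\<close>: a path with two jumps lies
      in \<open>J N\<close> for all large \<open>N\<close>, and the uniform bound passes to the
      increasing union.\<close>
    define Z where "Z = (\<Union>n. \<Inter>N\<in>{n..}. J N)"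
    have I_M: "(\<Inter>N\<in>{n..}. J N) \<in> sets M" for n
      by (intro sets.countable_INT) (auto simp: J_M)
    have "measure (P i) Z \<le> c\<^sup>2 * h\<^sup>2" for i
    proof -
      interpret prob_space "P i" by (rule P_prob)
      have "incseq (\<lambda>n. \<Inter>N\<in>{n..}. J N)" by (intro incseq_SucI) force
      then have "(\<lambda>n. measure (P i) (\<Inter>N\<in>{n..}. J N)) \<longlonglongrightarrow> measure (P i) Z"
        unfolding Z_def by (intro finite_Lim_measure_incseq) (auto simp: P_sets I_M)
      then show ?thesis
      proof (rule LIMSEQ_le_const2, intro exI allI impI)
        fix n :: nat
        have "\<forall>\<^sub>F N in sequentially. h / real N < h0"
          by (rule order_tendstoD(2)[OF lim_const_over_n c(2)])
        then obtain N0 where N0: "\<And>N. N0 \<le> N \<Longrightarrow> h / real N < h0"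
          unfolding eventually_sequentially by blast
        define N where "N = Suc (max n N0)"
        have "measure (P i) (\<Inter>N\<in>{n..}. J N) \<le> measure (P i) (J N)"
          by (intro finite_measure_mono) (auto simp: P_sets J_M N_def)
        also have "\<dots> \<le> c\<^sup>2 * h\<^sup>2" by (intro J_bound N0) (simp_all add: N_def)
        finally show "measure (P i) (\<Inter>N\<in>{n..}. J N) \<le> c\<^sup>2 * h\<^sup>2" .
      qed
    qed
    moreover have "\<omega> \<in> Z" if w: "\<omega> \<in> space M" "two_jumps h (traj \<omega>)" for \<omega>
    proof -
      obtain n where n: "\<And>N. n \<le> N \<Longrightarrow> \<exists>m<N. \<exists>m'<N. m < m' \<and>
          X (real m * (h / real N)) \<omega> \<noteq> X (real (Suc m) * (h / real N)) \<omega> \<and>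
          X (real m' * (h / real N)) \<omega> \<noteq> X (real (Suc m') * (h / real N)) \<omega>"
        using two_jumps_grid[OF right_continuous_path[OF w(1)] w(2) h] unfolding eventually_sequentially by blast
      have "\<omega> \<in> J N" if nN: "n \<le> N" for N
      proof -
        obtain m m' where "m < N" "m' < N" "m < m'" "\<omega> \<in> ch N m" "\<omega> \<in> ch N m'"
          using n[OF nN] w(1) by (auto simp: ch_def)
        then show ?thesis unfolding J_def by (intro UN_I[of m] UN_I[of m']) simp_all
      qed
      then show ?thesis by (auto simp: Z_def)
    qed
    moreover have "Z \<in> sets M" unfolding Z_def by (intro sets.countable_UN) (auto simp: I_M)
    ultimately show ?thesis by blast
  qed
  then show thesis by (intro that[of "c\<^sup>2"]) auto
qed

end

text \<open>Concerns paths only. That the first \<open>m\<close> windows are decided by time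
  \<open>window_start b m\<close> is what permits the Markov property to be applied there.\<close>

lemma windows_event:
  assumes "\<And>n. n < m \<Longrightarrow> T n \<inter> W n = {}"
    and "\<And>n. n < m \<Longrightarrow> window_start b n \<le> a n" "\<And>n. n < m \<Longrightarrow> a n < b n"
  shows "path_event (windows W T a b m) \<and> determined (window_start b m) (windows W T a b m)
    \<and> 0 \<le> window_start b m"
  using assms
proof (induction m)
  case 0
  have "determined 0 (\<lambda>x. x 0 \<in> W 0)" by (simp add: determined_def)
  then show ?case using path_event_eval[of 0 "W 0"] by (simp add: window_start_def)
next
  case (Suc m)
  define p where "p = window_start b m"
  have IH: "path_event (windows W T a b m)" "determined p (windows W T a b m)" "0 \<le> p"
    using Suc.IH Suc.prems by (auto simp: p_def)
  have ab: "p \<le> a m" "a m < b m" "T m \<inter> W m = {}"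
    using Suc.prems by (auto simp: p_def)
  have st: "path_event (\<lambda>x. stay (W m) (a m - p) (shift_path p x))"
    using IH ab by (intro path_event_shift path_event_stay) auto
  have ju: "path_event (\<lambda>x. jump (W m) (T m) (W (Suc m)) (b m - a m) (shift_path (a m) x))"
    using IH ab by (intro path_event_shift path_event_jump) auto
  have st': "determined (p + (a m - p)) (\<lambda>x. stay (W m) (a m - p) (shift_path p x))"
    using IH ab by (intro determined_shift determined_stay) auto
  have ju': "determined (a m + (b m - a m)) (\<lambda>x. jump (W m) (T m) (W (Suc m)) (b m - a m) (shift_path (a m) x))"
    using IH ab by (intro determined_shift determined_jump) auto
  have "windows W T a b (Suc m) = (\<lambda>x. windows W T a b m x \<and> stay (W m) (a m - p) (shift_path p x) \<and>
      jump (W m) (T m) (W (Suc m)) (b m - a m) (shift_path (a m) x))"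
    by (simp add: fun_eq_iff p_def)
  moreover have "determined (b m) \<dots>"
    using ab by (intro determined_conj determined_mono[OF IH(2)] determined_mono[OF st'] determined_mono[OF ju']) auto
  ultimately show ?case
    using path_event_conj[OF IH(1) path_event_conj[OF st ju]] IH ab by (simp add: window_start_def)
qed

context markov_process
begin

text \<open>Without two jumps in \<open>{0..h}\<close> the two end states decide \<open>R\<close>;
  the kernel entry therefore differs from a transition probability, or from 0, by at most the
  probability of the covering set \<open>Z\<close>.\<close>

lemma kern_approx:
  obtains c where "0 \<le> c"
    "\<And>h R Q i j. 0 < h \<Longrightarrow> path_event R \<Longrightarrow>
      (\<And>x. right_continuous_path x \<Longrightarrow> \<not> two_jumps h x \<Longrightarrow> x 0 = i \<Longrightarrow> x h = j \<Longrightarrow> R x \<longleftrightarrow> Q) \<Longrightarrow>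
      \<bar>kern R h $ i $ j - (if Q then trans_prob h i j else 0)\<bar> \<le> c * h\<^sup>2"
proof -
  obtain c where c: "0 \<le> c" "\<And>h. 0 < h \<Longrightarrow> \<exists>Z\<in>sets M. (\<forall>i. measure (P i) Z \<le> c * h\<^sup>2) \<and>
      (\<forall>\<omega>\<in>space M. two_jumps h (traj \<omega>) \<longrightarrow> \<omega> \<in> Z)"
    by (rule two_jumps_bound) blast
  show thesis
  proof (rule that[OF c(1)])
    fix h :: real and R :: "(real \<Rightarrow> 's) \<Rightarrow> bool" and Q :: bool and i j
    assume h: "0 < h" and R: "path_event R"
      and eq: "\<And>x. right_continuous_path x \<Longrightarrow> \<not> two_jumps h x \<Longrightarrow> x 0 = i \<Longrightarrow> x h = j \<Longrightarrow> R x \<longleftrightarrow> Q"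
    interpret prob_space "P i" by (rule P_prob)
    obtain Z where Z: "Z \<in> sets M" "measure (P i) Z \<le> c * h\<^sup>2"
      "\<And>\<omega>. \<omega> \<in> space M \<Longrightarrow> two_jumps h (traj \<omega>) \<Longrightarrow> \<omega> \<in> Z" using c(2)[OF h] by blast
    define A where "A = {\<omega>\<in>space M. R (traj \<omega>) \<and> X h \<omega> = j}"
    define B where "B = {\<omega>\<in>space M. Q \<and> X h \<omega> = j}"
    have "path_event (\<lambda>x. R x \<and> x h \<in> {j})" using h by (intro path_event_conj R path_event_eval) simp
    from path_event_sets_0[OF this] have A: "A \<in> sets M" by (simp add: A_def)
    have B: "B \<in> sets M" unfolding B_def using h by (cases Q) auto
    have AZ: "measure (P i) A \<le> measure (P i) B + measure (P i) Z"
      and BZ: "measure (P i) B \<le> measure (P i) A + measure (P i) Z"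
    proof -
      have *: "\<omega> \<in> Z" if "\<omega> \<in> space M" "X 0 \<omega> = i" "X h \<omega> = j" "\<not> (R (traj \<omega>) \<longleftrightarrow> Q)" for \<omega>
        using eq[of "traj \<omega>"] right_continuous_path[OF that(1)] Z(3)[OF that(1)] that by blast
      have le: "measure (P i) S \<le> measure (P i) S' + measure (P i) Z"
        if "S \<in> sets M" "S' \<in> sets M" "\<And>\<omega>. X 0 \<omega> = i \<Longrightarrow> \<omega> \<in> S \<Longrightarrow> \<omega> \<in> S' \<union> Z" for S S'
      proof -
        have "measure (P i) S \<le> measure (P i) (S' \<union> Z)"
          using AE_start[of i] that Z(1)
          by (intro finite_measure_mono_AE) (auto simp: P_sets elim!: eventually_mono)
        also have "\<dots> \<le> measure (P i) S' + measure (P i) Z"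
          using that Z(1) by (intro measure_Un_le) (auto simp: P_sets)
        finally show ?thesis .
      qed
      show "measure (P i) A \<le> measure (P i) B + measure (P i) Z"
        by (rule le[OF A B]) (use * in \<open>auto simp: A_def B_def\<close>)
      show "measure (P i) B \<le> measure (P i) A + measure (P i) Z"
        by (rule le[OF B A]) (use * in \<open>auto simp: A_def B_def\<close>)
    qed
    have "kern R h $ i $ j = measure (P i) A" by (simp add: kern_def A_def)
    moreover have "(if Q then trans_prob h i j else 0) = measure (P i) B"
      by (simp add: B_def trans_prob_def)
    ultimately show "\<bar>kern R h $ i $ j - (if Q then trans_prob h i j else 0)\<bar> \<le> c * h\<^sup>2"
      using AZ BZ Z(2) by simp
  qed
qed

text \<open>An error of order \<open>h\<close> squared vanishes after division by \<open>h\<close>,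
  so the derivative at 0 is the intensity wherever the end states permit the event.\<close>

lemma kern_deriv:
  assumes R: "\<And>h. 0 < h \<Longrightarrow> path_event (R h)"
    and Q: "\<And>h x. 0 < h \<Longrightarrow> right_continuous_path x \<Longrightarrow> \<not> two_jumps h x \<Longrightarrow> x 0 = i \<Longrightarrow> x h = j \<Longrightarrow>
      R h x \<longleftrightarrow> Q"
  shows "((\<lambda>h. (kern (R h) h $ i $ j - (if Q \<and> i = j then 1 else 0)) / h) \<longlongrightarrow>
    (if Q then lam $ i $ j else 0)) (at_right 0)"
proof -
  obtain c where c: "0 \<le> c"
    "\<And>h R Q i j. 0 < h \<Longrightarrow> path_event R \<Longrightarrow>
      (\<And>x. right_continuous_path x \<Longrightarrow> \<not> two_jumps h x \<Longrightarrow> x 0 = i \<Longrightarrow> x h = j \<Longrightarrow> R x \<longleftrightarrow> Q) \<Longrightarrow>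
      \<bar>kern R h $ i $ j - (if Q then trans_prob h i j else 0)\<bar> \<le> c * h\<^sup>2"
    by (rule kern_approx) blast
  have 1: "((\<lambda>h. ((if Q then trans_prob h i j else 0) - (if Q \<and> i = j then 1 else 0)) / h)
      \<longlongrightarrow> (if Q then lam $ i $ j else 0)) (at_right 0)"
    using intensity[of i j] by (cases Q) (simp_all add: trans_prob_def)
  have 2: "((\<lambda>h. (kern (R h) h $ i $ j - (if Q then trans_prob h i j else 0)) / h) \<longlongrightarrow> 0) (at_right 0)"
  proof (rule Lim_null_comparison)
    show "\<forall>\<^sub>F h in at_right 0. norm ((kern (R h) h $ i $ j - (if Q then trans_prob h i j else 0)) / h) \<le> c * h"
      unfolding eventually_at_right_field
    proof (intro exI[of _ 1] conjI allI impI)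
      fix h :: real assume h: "0 < h" "h < 1"
      have "\<bar>kern (R h) h $ i $ j - (if Q then trans_prob h i j else 0)\<bar> \<le> c * h\<^sup>2"
        by (rule c(2)[OF h(1) R[OF h(1)]]) (rule Q[OF h(1)])
      then show "norm ((kern (R h) h $ i $ j - (if Q then trans_prob h i j else 0)) / h) \<le> c * h"
        using h by (simp add: abs_divide pos_divide_le_eq power2_eq_square mult.assoc)
    qed simp
    have "((\<lambda>h. c * h) \<longlongrightarrow> c * 0) (at_right 0)" by (intro tendsto_intros)
    then show "((\<lambda>h. c * h) \<longlongrightarrow> 0) (at_right 0)" by simp
  qed
  from tendsto_add[OF 1 2] show ?thesis
    by (simp add: add_divide_distrib[symmetric])
qed

section \<open>Kernels of staying and of a single jump\<close>

definition stay_exp :: "'s set \<Rightarrow> real \<Rightarrow> real^'s^'s" where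
  "stay_exp W t = matrix_exp (t *\<^sub>R sub_matrix lam W W)"

(* The exponential of a matrix supported on W acts as the identity outside W. *)
definition id_off :: "'s set \<Rightarrow> real^'s^'s" where
  "id_off W = (\<chi> i j. if i = j \<and> i \<notin> W then 1 else 0)"

lemma kern_ends_0:
  assumes "\<And>\<omega>. \<omega> \<in> space M \<Longrightarrow> X 0 \<omega> = i \<Longrightarrow> X d \<omega> = j \<Longrightarrow> \<not> R (traj \<omega>)" "path_event R" "0 \<le> d"
  shows "kern R d $ i $ j = 0"
proof -
  have "path_event (\<lambda>x. R x \<and> x d \<in> {j})" using assms by (intro path_event_conj path_event_eval)
  from path_event_sets_0[OF this] have "{\<omega>\<in>space M. R (traj \<omega>) \<and> X d \<omega> = j} \<in> sets M" by simp
  then have "measure (P i) {\<omega>\<in>space M. R (traj \<omega>) \<and> X d \<omega> = j} = measure (P i) {}"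
    using assms(1) by (intro measure_cong_start) auto
  then show ?thesis by (simp add: kern_def)
qed

lemma kern_stay_outside: "0 \<le> t \<Longrightarrow> i \<notin> W \<or> j \<notin> W \<Longrightarrow> kern (stay W t) t $ i $ j = 0"
  by (rule kern_ends_0) (auto dest: stay_ends intro: path_event_stay)

lemma kern_jump_outside:
  "0 \<le> t \<Longrightarrow> T \<inter> W = {} \<Longrightarrow> i \<notin> W \<or> j \<notin> W' \<Longrightarrow> kern (jump W T W' t) t $ i $ j = 0"
  by (rule kern_ends_0) (auto dest: jump_ends intro: path_event_jump)

lemma matrix_mult_id_off: "(\<And>i j. j \<notin> W \<Longrightarrow> A $ i $ j = 0) \<Longrightarrow> A ** id_off W = 0"
  by (simp add: vec_eq_iff matrix_matrix_mult_def id_off_def) (intro allI sum.neutral, auto)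

lemma id_off_mult: "(\<And>i j. i \<notin> W \<Longrightarrow> A $ i $ j = 0) \<Longrightarrow> id_off W ** A = 0"
  by (simp add: vec_eq_iff matrix_matrix_mult_def id_off_def) (intro allI sum.neutral, auto)

lemma id_off_idem: "id_off W ** id_off W = id_off W"
proof -
  have "(\<Sum>k\<in>UNIV. id_off W $ i $ k * id_off W $ k $ j) = (\<Sum>k\<in>UNIV. if k = i then id_off W $ i $ j else 0)" for i j
    by (intro sum.cong refl) (auto simp: id_off_def)
  then show ?thesis by (simp add: vec_eq_iff matrix_matrix_mult_def)
qed

text \<open>The staying kernel is a semigroup, but at time 0 it is the projection onto
  \<open>W\<close> and not the identity. Adding \<open>id_off\<close> repairs this, and the mixed
  products vanish because the kernel is supported on \<open>W\<close>.\<close>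

lemma stay_exp_eq:
  assumes "0 \<le> t"
  shows "stay_exp W t = kern (stay W t) t + id_off W"
proof -
  define Q where "Q t = kern (stay W t) t + id_off W" for t
  have "Q t = matrix_exp (t *\<^sub>R sub_matrix lam W W)"
  proof (rule matrix_semigroup_eq_exp[OF _ _ _ assms])
    fix t h :: real assume th: "0 \<le> t" "0 \<le> h"
    have "kern (stay W (t + h)) (t + h) = kern (\<lambda>x. stay W t x \<and> stay W h (shift_path t x)) (t + h)"
      using stay_add[OF th] by metis
    also have "\<dots> = kern (stay W t) t ** kern (stay W h) h"
      using th by (intro kern_compose path_event_stay determined_stay)
    finally have "kern (stay W (t + h)) (t + h) = kern (stay W t) t ** kern (stay W h) h" .
    moreover have "kern (stay W t) t ** id_off W = 0" "id_off W ** kern (stay W h) h = 0"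
      using th by (auto intro!: matrix_mult_id_off id_off_mult kern_stay_outside)
    ultimately show "Q (t + h) = Q t ** Q h"
      unfolding Q_def by (simp add: matrix_add_ldistrib matrix_add_rdistrib id_off_idem)
  next
    have "stay W 0 = (\<lambda>x. x 0 \<in> W)" by (simp add: stay_def fun_eq_iff)
    then show "Q 0 = mat 1" by (simp add: Q_def kern_0 id_off_def vec_eq_iff mat_def)
  next
    show "((\<lambda>h. (Q h - mat 1) /\<^sub>R h) \<longlongrightarrow> sub_matrix lam W W) (at_right 0)"
    proof (intro vec_tendstoI)
      fix i j
      have "((\<lambda>h. (kern (stay W h) h $ i $ j - (if (i \<in> W \<and> j \<in> W) \<and> i = j then 1 else 0)) / h) \<longlongrightarrow>
        (if i \<in> W \<and> j \<in> W then lam $ i $ j else 0)) (at_right 0)"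
      proof (rule kern_deriv)
        fix h :: real and x :: "real \<Rightarrow> 's"
        assume "0 < h" "right_continuous_path x" "\<not> two_jumps h x" "x 0 = i" "x h = j"
        then show "stay W h x \<longleftrightarrow> i \<in> W \<and> j \<in> W"
          using stay_ends[of W h x] stay_if_not_two_jumps[of h x W] by auto
      qed (simp add: path_event_stay)
      also have "(\<lambda>h. (kern (stay W h) h $ i $ j - (if (i \<in> W \<and> j \<in> W) \<and> i = j then 1 else 0)) / h)
          = (\<lambda>h. ((Q h - mat 1) /\<^sub>R h) $ i $ j)"
        by (auto simp: Q_def id_off_def mat_def divide_inverse fun_eq_iff)
      finally show "((\<lambda>h. ((Q h - mat 1) /\<^sub>R h) $ i $ j) \<longlongrightarrow> sub_matrix lam W W $ i $ j) (at_right 0)"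
        by (simp add: sub_matrix_def)
    qed
  qed
  then show ?thesis by (simp add: stay_exp_def Q_def)
qed

lemma stay_exp_nonneg: "0 \<le> t \<Longrightarrow> 0 \<le> stay_exp W t $ i $ j"
  using kern_nonneg[of "stay W t" t i j] by (simp add: stay_exp_eq id_off_def)

text \<open>Without any restriction on the state, the exponential is the transition matrix of the
  process.\<close>

lemma stay_exp_row_sum:
  assumes "0 \<le> t"
  shows "(\<Sum>j\<in>UNIV. stay_exp UNIV t $ i $ j) = 1"
proof -
  have "stay_exp UNIV t $ i $ j = trans_prob t i j" for j
    by (simp add: stay_exp_eq[OF assms] id_off_def kern_def trans_prob_def stay_def)
  then show ?thesis using trans_prob_sum[OF assms] by simp
qed

text \<open>By \<open>jump_add\<close> and \<open>jump_not_stay\<close> the jump kernel obeys the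
  Duhamel equation. Its rows are supported in \<open>W\<close> and its columns in \<open>W'\<close>,
  so the staying kernels next to it may be replaced by full exponentials; its derivative at 0 is the
  intensity from \<open>W\<close> into \<open>T\<close>.\<close>

lemma kern_jump_integral:
  assumes TW: "T \<inter> W = {}" "T \<subseteq> W'" and t: "0 \<le> t"
  shows "((\<lambda>r. stay_exp W r ** sub_matrix lam W T ** stay_exp W' (t - r)) has_integral
    kern (jump W T W' t) t) {0..t}"
  unfolding stay_exp_def
proof (rule matrix_Duhamel_unique[OF _ _ t])
  fix t h :: real assume th: "0 \<le> t" "0 \<le> h"
  let ?A = "\<lambda>x. jump W T W' t x \<and> stay W' h (shift_path t x)"
  let ?B = "\<lambda>x. stay W t x \<and> jump W T W' h (shift_path t x)"
  have "kern (jump W T W' (t + h)) (t + h) = kern ?A (t + h) + kern ?B (t + h)"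
  proof -
    have "measure (P i) {\<omega>\<in>space M. jump W T W' (t + h) (traj \<omega>) \<and> X (t + h) \<omega> = j}
        = measure (P i) {\<omega>\<in>space M. ?A (traj \<omega>) \<and> X (t + h) \<omega> = j}
        + measure (P i) {\<omega>\<in>space M. ?B (traj \<omega>) \<and> X (t + h) \<omega> = j}" for i j
    proof -
      interpret prob_space "P i" by (rule P_prob)
      have "path_event (\<lambda>x. ?A x \<and> x (t + h) \<in> {j})" "path_event (\<lambda>x. ?B x \<and> x (t + h) \<in> {j})"
        by (intro path_event_conj path_event_eval path_event_stay path_event_jump path_event_shift;
            use th TW in simp)+
      from this[THEN path_event_sets_0]
      have *: "{\<omega>\<in>space M. ?A (traj \<omega>) \<and> X (t + h) \<omega> = j} \<in> sets M"
        "{\<omega>\<in>space M. ?B (traj \<omega>) \<and> X (t + h) \<omega> = j} \<in> sets M" by auto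
      have "{\<omega>\<in>space M. jump W T W' (t + h) (traj \<omega>) \<and> X (t + h) \<omega> = j}
        = {\<omega>\<in>space M. ?A (traj \<omega>) \<and> X (t + h) \<omega> = j} \<union> {\<omega>\<in>space M. ?B (traj \<omega>) \<and> X (t + h) \<omega> = j}"
        using jump_add[OF th, of W T W'] by auto
      moreover have "{\<omega>\<in>space M. ?A (traj \<omega>) \<and> X (t + h) \<omega> = j} \<inter> {\<omega>\<in>space M. ?B (traj \<omega>) \<and> X (t + h) \<omega> = j} = {}"
        using jump_not_stay[OF TW(1)] by blast
      ultimately show ?thesis using * by (simp add: finite_measure_Union P_sets)
    qed
    then show ?thesis by (simp add: kern_def vec_eq_iff)
  qed
  also have "kern ?A (t + h) = kern (jump W T W' t) t ** kern (stay W' h) h"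
    using th TW by (intro kern_compose path_event_stay determined_jump path_event_jump)
  also have "kern ?B (t + h) = kern (stay W t) t ** kern (jump W T W' h) h"
    using th TW by (intro kern_compose path_event_stay determined_stay path_event_jump)
  also have "kern (jump W T W' t) t ** kern (stay W' h) h = kern (jump W T W' t) t ** stay_exp W' h"
  proof -
    have "kern (jump W T W' t) t ** id_off W' = 0"
      using th TW by (auto intro!: matrix_mult_id_off kern_jump_outside)
    then show ?thesis using th by (simp add: stay_exp_eq matrix_add_ldistrib)
  qed
  also have "kern (stay W t) t ** kern (jump W T W' h) h = stay_exp W t ** kern (jump W T W' h) h"
  proof -
    have "id_off W ** kern (jump W T W' h) h = 0"
      using th TW by (auto intro!: id_off_mult kern_jump_outside)
    then show ?thesis using th by (simp add: stay_exp_eq matrix_add_rdistrib)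
  qed
  finally show "kern (jump W T W' (t + h)) (t + h) = kern (jump W T W' t) t ** matrix_exp (h *\<^sub>R sub_matrix lam W' W')
      + matrix_exp (t *\<^sub>R sub_matrix lam W W) ** kern (jump W T W' h) h"
    by (simp add: stay_exp_def)
next
  show "((\<lambda>h. kern (jump W T W' h) h /\<^sub>R h) \<longlongrightarrow> sub_matrix lam W T) (at_right 0)"
  proof (intro vec_tendstoI)
    fix i j
    have "((\<lambda>h. (kern (jump W T W' h) h $ i $ j - (if (i \<in> W \<and> j \<in> T) \<and> i = j then 1 else 0)) / h) \<longlongrightarrow>
      (if i \<in> W \<and> j \<in> T then lam $ i $ j else 0)) (at_right 0)"
    proof (rule kern_deriv)
      fix h :: real and x :: "real \<Rightarrow> 's"
      assume x: "0 < h" "right_continuous_path x" "\<not> two_jumps h x" "x 0 = i" "x h = j"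
      show "jump W T W' h x \<longleftrightarrow> i \<in> W \<and> j \<in> T"
      proof (cases "i \<in> W")
        case True
        then show ?thesis using jump_iff_not_two_jumps[of h x W T W'] x TW by auto
      next
        case False
        then show ?thesis using jump_ends[of W T W' h x] x by auto
      qed
    qed (simp add: path_event_jump TW)
    also have "(\<lambda>h. (kern (jump W T W' h) h $ i $ j - (if (i \<in> W \<and> j \<in> T) \<and> i = j then 1 else 0)) / h)
        = (\<lambda>h. (kern (jump W T W' h) h /\<^sub>R h) $ i $ j)"
      using TW by (auto simp: divide_inverse fun_eq_iff)
    finally show "((\<lambda>h. (kern (jump W T W' h) h /\<^sub>R h) $ i $ j) \<longlongrightarrow> sub_matrix lam W T $ i $ j) (at_right 0)"
      by (simp add: sub_matrix_def)
  qed
qed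

lemma kern_windows_outside:
  assumes "\<And>n. n < m \<Longrightarrow> T n \<inter> W n = {}"
    and "\<And>n. n < m \<Longrightarrow> window_start b n \<le> a n" "\<And>n. n < m \<Longrightarrow> a n < b n"
    and "j \<notin> W m"
  shows "kern (windows W T a b m) (window_start b m) $ i $ j = 0"
proof (rule kern_ends_0)
  have "x (window_start b m) \<in> W m" if "windows W T a b m x" for x :: "real \<Rightarrow> 's"
  proof (cases m)
    case (Suc n)
    then have "jump (W n) (T n) (W (Suc n)) (b n - a n) (shift_path (a n) x)" using that by simp
    from jump_ends[OF this] show ?thesis using Suc by (simp add: shift_path_def window_start_def)
  qed (use that in \<open>simp add: window_start_def\<close>)
  then show "\<not> windows W T a b m (traj \<omega>)"
    if "X (window_start b m) \<omega> = j" for \<omega> using assms(4) that by auto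
qed (use windows_event[of m T W b a] assms in auto)

text \<open>The kernel of the earlier windows is supported on columns in \<open>W m\<close>, so the
  identity part of the exponential off \<open>W m\<close> contributes nothing.\<close>

lemma kern_windows_Suc:
  assumes TW: "\<And>n. n \<le> m \<Longrightarrow> T n \<inter> W n = {}"
    and p: "\<And>n. n \<le> m \<Longrightarrow> window_start b n \<le> a n" and ab: "\<And>n. n \<le> m \<Longrightarrow> a n < b n"
  shows "kern (windows W T a b (Suc m)) (b m) =
    kern (windows W T a b m) (window_start b m) ** stay_exp (W m) (a m - window_start b m)
      ** kern (jump (W m) (T m) (W (Suc m)) (b m - a m)) (b m - a m)"
proof -
  define p where "p = window_start b m"
  have pm: "p \<le> a m" "a m < b m" using p ab by (auto simp: p_def)
  have ev: "path_event (windows W T a b m)" "determined p (windows W T a b m)" "0 \<le> p"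
    using windows_event[of m T W b a] assms by (auto simp: p_def)
  let ?st = "stay (W m) (a m - p)" and ?ju = "jump (W m) (T m) (W (Suc m)) (b m - a m)"
  have pst: "path_event (\<lambda>x. ?st (shift_path p x))"
    using ev pm by (intro path_event_shift path_event_stay) auto
  have dst: "determined (a m) (\<lambda>x. windows W T a b m x \<and> ?st (shift_path p x))"
    using determined_shift[OF determined_stay[of "a m - p" "W m"], of p] ev pm
    by (intro determined_conj determined_mono[OF ev(2)]) auto
  have "kern (windows W T a b (Suc m)) (b m)
      = kern (\<lambda>x. (windows W T a b m x \<and> ?st (shift_path p x)) \<and> ?ju (shift_path (a m) x)) (a m + (b m - a m))"
  proof -
    have "windows W T a b (Suc m) = (\<lambda>x. (windows W T a b m x \<and> ?st (shift_path p x)) \<and> ?ju (shift_path (a m) x))"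
      by (simp add: fun_eq_iff p_def)
    then show ?thesis by simp
  qed
  also have "\<dots> = kern (\<lambda>x. windows W T a b m x \<and> ?st (shift_path p x)) (a m) ** kern ?ju (b m - a m)"
    using ev pm TW by (intro kern_compose path_event_conj pst dst path_event_jump) auto
  also have "kern (\<lambda>x. windows W T a b m x \<and> ?st (shift_path p x)) (a m)
      = kern (\<lambda>x. windows W T a b m x \<and> ?st (shift_path p x)) (p + (a m - p))" by simp
  also have "\<dots> = kern (windows W T a b m) p ** kern ?st (a m - p)"
    using ev pm by (intro kern_compose path_event_stay) auto
  also have "\<dots> = kern (windows W T a b m) p ** stay_exp (W m) (a m - p)"
  proof -
    have "kern (windows W T a b m) p ** id_off (W m) = 0"
      unfolding p_def using assms by (intro matrix_mult_id_off kern_windows_outside) auto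
    then show ?thesis using pm by (simp add: stay_exp_eq matrix_add_ldistrib)
  qed
  finally show ?thesis unfolding p_def .
qed

end

section \<open>Integrating the density over boxes\<close>

lemma ordered_matrix_prod_0 [simp]: "ordered_matrix_prod B 0 = mat 1"
  by (simp add: ordered_matrix_prod_def)

lemma ordered_matrix_prod_Suc:
  "ordered_matrix_prod B (Suc m) = ordered_matrix_prod B m ** B m"
proof -
  have "foldr (**) xs y = foldr (**) xs (mat 1) ** y" for xs and y :: "real^'a^'a"
  proof (induction xs)
    case (Cons x xs)
    show ?case by (simp only: foldr.simps o_apply Cons matrix_mul_assoc)
  qed simp
  from this[of "map B [0..<m]" "B m"] show ?thesis by (simp add: ordered_matrix_prod_def)
qed

lemma ordered_matrix_prod_cong:
  "(\<And>n. n < m \<Longrightarrow> B n = B' n) \<Longrightarrow> ordered_matrix_prod B m = ordered_matrix_prod B' m"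
  by (induction m) (simp_all add: ordered_matrix_prod_Suc)

definition window_box :: "(nat \<Rightarrow> real) \<Rightarrow> (nat \<Rightarrow> real) \<Rightarrow> nat \<Rightarrow> (nat \<Rightarrow> real) set" where
  "window_box a b m = {r. \<forall>n<m. a n < r n \<and> r n \<le> b n}"

context markov_process
begin

definition jump_density :: "(nat \<Rightarrow> 's set) \<Rightarrow> (nat \<Rightarrow> 's set) \<Rightarrow> nat \<Rightarrow> (nat \<Rightarrow> real) \<Rightarrow> real^'s^'s" where
  "jump_density W T m r = ordered_matrix_prod
     (\<lambda>n. stay_exp (W n) (window_start r (Suc n) - window_start r n) ** sub_matrix lam (W n) (T n)) m"

lemma jump_density_0 [simp]: "jump_density W T 0 r = mat 1"
  by (simp add: jump_density_def)

lemma jump_density_Suc: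
  "jump_density W T (Suc m) r = jump_density W T m r **
     (stay_exp (W m) (r m - window_start r m) ** sub_matrix lam (W m) (T m))"
  by (simp add: jump_density_def ordered_matrix_prod_Suc window_start_def)

lemma jump_density_cong:
  assumes "\<And>n. n < m \<Longrightarrow> r n = r' n"
  shows "jump_density W T m r = jump_density W T m r'"
  unfolding jump_density_def
  by (intro ordered_matrix_prod_cong) (simp add: window_start_def assms)

lemma stay_exp_add: "stay_exp W (s + t) = stay_exp W s ** stay_exp W t"
  by (simp add: stay_exp_def matrix_exp_add)

lemma stay_exp_0 [simp]: "stay_exp W 0 = mat 1"
  by (simp add: stay_exp_def)

lemma stay_exp_measurable [measurable]:
  assumes [measurable]: "f \<in> borel_measurable N"
  shows "(\<lambda>x. stay_exp W (f x) $ i $ j) \<in> borel_measurable N"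
proof -
  have "continuous_on UNIV (\<lambda>t. stay_exp W t $ i $ j)"
    unfolding stay_exp_def by (intro continuous_intros)
  from borel_measurable_continuous_onI[OF this]
  show ?thesis by measurable
qed

lemma matrix_mult_measurable:
  fixes A B :: "'x \<Rightarrow> real^'s^'s"
  assumes "\<And>i j. (\<lambda>x. A x $ i $ j) \<in> borel_measurable N" "\<And>i j. (\<lambda>x. B x $ i $ j) \<in> borel_measurable N"
  shows "(\<lambda>x. (A x ** B x) $ i $ j) \<in> borel_measurable N"
  unfolding matrix_matrix_mult_def
  by (simp, intro borel_measurable_sum borel_measurable_times assms)

lemma jump_density_measurable:
  assumes "\<And>n. n < m \<Longrightarrow> (\<lambda>x. r x n) \<in> borel_measurable N"
  shows "(\<lambda>x. jump_density W T m (r x) $ i $ j) \<in> borel_measurable N"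
  using assms
proof (induction m arbitrary: i j)
  case (Suc m)
  have [measurable]: "(\<lambda>x. r x m) \<in> borel_measurable N" using Suc.prems by simp
  have [measurable]: "(\<lambda>x. window_start (r x) m) \<in> borel_measurable N"
    using Suc.prems by (cases m) (simp_all add: window_start_def)
  show ?case unfolding jump_density_Suc
    by (intro matrix_mult_measurable Suc.IH Suc.prems stay_exp_measurable) simp_all
qed simp

lemma matrix_mult_nonneg:
  fixes A B :: "real^'s^'s"
  assumes "\<And>i j. 0 \<le> A $ i $ j" "\<And>i j. 0 \<le> B $ i $ j"
  shows "0 \<le> (A ** B) $ i $ j"
  unfolding matrix_matrix_mult_def by (simp add: assms sum_nonneg)

lemma sub_matrix_nonneg: "W \<inter> T = {} \<Longrightarrow> 0 \<le> sub_matrix lam W T $ i $ j"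
  using intensity_matrix unfolding sub_matrix_def is_intensity_matrix_def
  by (cases "i = j") auto

lemma jump_density_nonneg:
  assumes "\<And>n. n < m \<Longrightarrow> T n \<inter> W n = {}" "\<And>n. n < m \<Longrightarrow> window_start r n \<le> r n"
  shows "0 \<le> jump_density W T m r $ i $ j"
  using assms
proof (induction m arbitrary: i j)
  case (Suc m)
  have "W m \<inter> T m = {}" using Suc.prems(1)[of m] by auto
  then show ?case unfolding jump_density_Suc using Suc.prems(2)[of m]
    by (intro matrix_mult_nonneg Suc.IH Suc.prems stay_exp_nonneg sub_matrix_nonneg) simp_all
qed (simp add: mat_def)

text \<open>\<open>kern_jump_integral\<close> moved to absolute time and read entrywise; the left
  end, absent from the half-open window, is a null set.\<close>

lemma kern_jump_nn_integral:
  assumes TW: "T \<inter> W = {}" "T \<subseteq> W'" and ab: "a \<le> b"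
  shows "(\<integral>\<^sup>+y. indicator {a<..b} y *
      ennreal ((stay_exp W (y - a) ** sub_matrix lam W T ** stay_exp W' (b - y)) $ i $ j) \<partial>lborel)
    = ennreal (kern (jump W T W' (b - a)) (b - a) $ i $ j)"
proof -
  define g where "g y = (stay_exp W (y - a) ** sub_matrix lam W T ** stay_exp W' (b - y)) $ i $ j" for y
  have "W \<inter> T = {}" using TW by auto
  then have g_nonneg: "0 \<le> g y" if "y \<in> {a..b}" for y
    unfolding g_def using that by (intro matrix_mult_nonneg stay_exp_nonneg sub_matrix_nonneg) auto
  have "bounded_linear (\<lambda>A::real^'s^'s. A $ i $ j)"
    using bounded_linear_compose[OF bounded_linear_vec_nth bounded_linear_vec_nth] by blast
  from has_integral_linear[OF kern_jump_integral[OF TW, of "b - a"] this]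
  have "((\<lambda>r. (stay_exp W r ** sub_matrix lam W T ** stay_exp W' (b - a - r)) $ i $ j) has_integral
      kern (jump W T W' (b - a)) (b - a) $ i $ j) {0..b - a}"
    using ab by (simp add: o_def)
  also have "(\<lambda>r. (stay_exp W r ** sub_matrix lam W T ** stay_exp W' (b - a - r)) $ i $ j) = g \<circ> (+) a"
    by (simp add: g_def fun_eq_iff diff_diff_eq)
  finally have "(g has_integral kern (jump W T W' (b - a)) (b - a) $ i $ j) {0 + a..b - a + a}"
    by (rule has_integral_shift_Icc_real[THEN iffD1])
  then have "(g has_integral kern (jump W T W' (b - a)) (b - a) $ i $ j) {a..b}" by simp
  from nn_integral_has_integral_lebesgue'[OF g_nonneg this]
  have "(\<integral>\<^sup>+y. ennreal (g y) * indicator {a..b} y \<partial>lborel) = ennreal (kern (jump W T W' (b - a)) (b - a) $ i $ j)"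
    by simp
  also have "(\<integral>\<^sup>+y. ennreal (g y) * indicator {a..b} y \<partial>lborel) = (\<integral>\<^sup>+y. indicator {a<..b} y * ennreal (g y) \<partial>lborel)"
  proof (rule nn_integral_cong_AE)
    show "AE y in lborel. ennreal (g y) * indicator {a..b} y = indicator {a<..b} y * ennreal (g y)"
      using AE_lborel_singleton[of a] by eventually_elim (auto simp: indicator_def)
  qed
  finally show ?thesis by (simp add: g_def)
qed

text \<open>Induction on the number of windows. The trailing exponential carries the density from
  the last jump to the end of the last window, so that both sides refer to the same deterministic
  time.\<close>

lemma nn_integral_jump_density:
  assumes TW: "\<And>n. n < m \<Longrightarrow> T n \<inter> W n = {}" "\<And>n. n < m \<Longrightarrow> T n \<subseteq> W (Suc n)"
    and pa: "\<And>n. n < m \<Longrightarrow> window_start b n \<le> a n" and ab: "\<And>n. n < m \<Longrightarrow> a n < b n"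
    and i: "i \<in> W 0"
  shows "(\<integral>\<^sup>+r. indicator (window_box a b m) r *
      ennreal ((jump_density W T m r ** stay_exp (W m) (window_start b m - window_start r m)) $ i $ j)
        \<partial>(\<Pi>\<^sub>M n\<in>{..<m}. lborel))
    = ennreal (kern (windows W T a b m) (window_start b m) $ i $ j)"
  using TW pa ab
proof (induction m arbitrary: j)
  case 0
  have "windows W T a b 0 = (\<lambda>x. x 0 \<in> W 0)" by (simp add: fun_eq_iff)
  then show ?case using i by (simp add: window_start_def PiM_empty nn_integral_count_space_finite window_box_def kern_0)
      (simp add: mat_def)
next
  case (Suc m)
  interpret product_sigma_finite "\<lambda>_::nat. lborel :: real measure" by standard
  define p where "p = window_start b m"
  define Y where "Y y = stay_exp (W m) (y - a m) ** sub_matrix lam (W m) (T m) ** stay_exp (W (Suc m)) (b m - y)" for y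
  define E where "E = stay_exp (W m) (a m - p)"
  define L where "L r = jump_density W T m r ** stay_exp (W m) (p - window_start r m)" for r
  define J where "J = kern (jump (W m) (T m) (W (Suc m)) (b m - a m)) (b m - a m)"
  have pab: "p \<le> a m" "a m < b m" using Suc.prems by (auto simp: p_def)
  have ws: "window_start (x(m := y)) m = window_start x m" "jump_density W T m (x(m := y)) = jump_density W T m x" for x y
    by (auto simp: window_start_def intro!: jump_density_cong)
  \<comment> \<open>The waiting time before the last jump is cut at the deterministic times
    \<open>p\<close> and \<open>a m\<close>. The semigroup law then factors the integrand into a
    function of \<open>x\<close>, a constant matrix and a function of \<open>y\<close>.\<close>
  have split: "jump_density W T (Suc m) (x(m := y)) ** stay_exp (W (Suc m)) (window_start b (Suc m) - window_start (x(m := y)) (Suc m))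
      = L x ** E ** Y y" for x y
  proof -
    have "y - window_start x m = (p - window_start x m) + ((a m - p) + (y - a m))" by simp
    then have "stay_exp (W m) (y - window_start x m) = stay_exp (W m) (p - window_start x m) **
        (E ** stay_exp (W m) (y - a m))" unfolding E_def by (simp only: stay_exp_add)
    then show ?thesis
      by (simp add: jump_density_Suc ws window_start_def[of b] window_start_def[of _ "Suc m"] L_def Y_def matrix_mul_assoc)
  qed
  have bx: "indicator (window_box a b (Suc m)) (x(m := y)) = (indicator (window_box a b m) x * indicator {a m<..b m} y :: ennreal)" for x y
    by (auto simp: window_box_def indicator_def less_Suc_eq)
  have wsr: "window_start r n \<le> r n" if "r \<in> window_box a b m" "n < m" for r n
  proof (cases n)
    case 0
    then show ?thesis using that Suc.prems(3)[of 0] by (force simp: window_box_def window_start_def)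
  next
    case (Suc k)
    then have "r k \<le> b k" "a n < r n" "b k \<le> a n"
      using that Suc.prems(3)[of n] by (auto simp: window_box_def window_start_def)
    then show ?thesis using Suc by (simp add: window_start_def)
  qed
  have wsm: "window_start r m \<le> p" if "r \<in> window_box a b m" for r
    using that by (cases m) (auto simp: window_box_def window_start_def p_def)
  have L_nonneg: "0 \<le> L r $ i $ j" if "r \<in> window_box a b m" for r i j
    unfolding L_def using wsm[OF that] wsr[OF that] Suc.prems(1)
    by (intro matrix_mult_nonneg stay_exp_nonneg jump_density_nonneg) auto
  have E_nonneg: "0 \<le> E $ i $ j" for i j unfolding E_def using pab by (intro stay_exp_nonneg) simp
  have Y_nonneg: "0 \<le> Y y $ i $ j" if "y \<in> {a m<..b m}" for y i j
    unfolding Y_def using that Suc.prems(1)[of m] by (intro matrix_mult_nonneg stay_exp_nonneg sub_matrix_nonneg) auto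
  have L_meas [measurable]: "(\<lambda>r. L r $ i $ j) \<in> borel_measurable (\<Pi>\<^sub>M n\<in>{..<m}. lborel)" for i j
  proof -
    have "(\<lambda>r. window_start r m) \<in> borel_measurable (\<Pi>\<^sub>M n\<in>{..<m}. lborel)"
      by (cases m) (auto simp: window_start_def)
    then show ?thesis unfolding L_def
      by (intro matrix_mult_measurable jump_density_measurable stay_exp_measurable) auto
  qed
  have Y_meas [measurable]: "(\<lambda>y. Y y $ i $ j) \<in> borel_measurable lborel" for i j
    unfolding Y_def by (intro matrix_mult_measurable stay_exp_measurable) auto
  have box_meas: "window_box a b n \<inter> space (\<Pi>\<^sub>M n\<in>{..<n}. lborel) \<in> sets (\<Pi>\<^sub>M n\<in>{..<n}. lborel :: real measure)" for n
  proof -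
    have "window_box a b n \<inter> space (\<Pi>\<^sub>M n\<in>{..<n}. lborel :: real measure) =
        {r\<in>space (\<Pi>\<^sub>M n\<in>{..<n}. lborel). \<forall>k<n. a k < r k \<and> r k \<le> b k}" by (auto simp: window_box_def)
    also have "\<dots> \<in> sets (\<Pi>\<^sub>M n\<in>{..<n}. lborel)" by measurable
    finally show ?thesis .
  qed
  have box_ind [measurable]: "(indicator (window_box a b n) :: _ \<Rightarrow> ennreal) \<in> borel_measurable (\<Pi>\<^sub>M n\<in>{..<n}. lborel)" for n
    using box_meas[of n] by (simp add: borel_measurable_indicator_iff)
  have full_meas: "(\<lambda>r. indicator (window_box a b (Suc m)) r * ennreal ((jump_density W T (Suc m) r **
        stay_exp (W (Suc m)) (window_start b (Suc m) - window_start r (Suc m))) $ i $ j))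
      \<in> borel_measurable (\<Pi>\<^sub>M n\<in>{..<Suc m}. lborel)"
  proof -
    have "(\<lambda>r. window_start r (Suc m)) \<in> borel_measurable (\<Pi>\<^sub>M n\<in>{..<Suc m}. lborel)"
      by (simp add: window_start_def)
    then have "(\<lambda>r. (jump_density W T (Suc m) r **
        stay_exp (W (Suc m)) (window_start b (Suc m) - window_start r (Suc m))) $ i $ j)
      \<in> borel_measurable (\<Pi>\<^sub>M n\<in>{..<Suc m}. lborel)"
      by (intro matrix_mult_measurable jump_density_measurable stay_exp_measurable) auto
    then show ?thesis using box_ind[of "Suc m"] by (intro borel_measurable_times_ennreal) auto
  qed
  have "(\<integral>\<^sup>+r. indicator (window_box a b (Suc m)) r * ennreal ((jump_density W T (Suc m) r **
        stay_exp (W (Suc m)) (window_start b (Suc m) - window_start r (Suc m))) $ i $ j)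
        \<partial>(\<Pi>\<^sub>M n\<in>{..<Suc m}. lborel))
    = (\<integral>\<^sup>+x. \<integral>\<^sup>+y. indicator (window_box a b m) x * indicator {a m<..b m} y * ennreal ((L x ** E ** Y y) $ i $ j)
        \<partial>lborel \<partial>(\<Pi>\<^sub>M n\<in>{..<m}. lborel))"
    using product_nn_integral_insert[of "{..<m}" m, folded lessThan_Suc, OF _ _ full_meas]
    by (simp only: split bx) simp
  \<comment> \<open>Expanded into scalars so that the integrals separate; nonnegativity of the
    entries inside the box lets \<open>ennreal\<close> pass through sums and products.\<close>
  also have "\<dots> = (\<integral>\<^sup>+x. \<integral>\<^sup>+y. (\<Sum>l\<in>UNIV. \<Sum>k\<in>UNIV. (indicator (window_box a b m) x * ennreal (L x $ i $ k)) *
        (ennreal (E $ k $ l) * (indicator {a m<..b m} y * ennreal (Y y $ l $ j))))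
        \<partial>lborel \<partial>(\<Pi>\<^sub>M n\<in>{..<m}. lborel))"
  proof (intro nn_integral_cong)
    fix x y
    show "indicator (window_box a b m) x * indicator {a m<..b m} y * ennreal ((L x ** E ** Y y) $ i $ j)
      = (\<Sum>l\<in>UNIV. \<Sum>k\<in>UNIV. (indicator (window_box a b m) x * ennreal (L x $ i $ k)) *
        (ennreal (E $ k $ l) * (indicator {a m<..b m} y * ennreal (Y y $ l $ j))))"
    proof (cases "x \<in> window_box a b m \<and> y \<in> {a m<..b m}")
      case True
      have "(L x ** E ** Y y) $ i $ j = (\<Sum>l\<in>UNIV. \<Sum>k\<in>UNIV. L x $ i $ k * (E $ k $ l * Y y $ l $ j))"
        by (simp add: matrix_matrix_mult_def sum_distrib_right mult.assoc)
      then show ?thesis using True L_nonneg E_nonneg Y_nonneg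
        by (simp add: sum_ennreal[symmetric] ennreal_mult sum_nonneg)
    next
      case False
      then show ?thesis by auto
    qed
  qed
  also have "\<dots> = (\<Sum>l\<in>UNIV. \<Sum>k\<in>UNIV. (\<integral>\<^sup>+x. indicator (window_box a b m) x * ennreal (L x $ i $ k) \<partial>(\<Pi>\<^sub>M n\<in>{..<m}. lborel)) *
        (ennreal (E $ k $ l) * (\<integral>\<^sup>+y. indicator {a m<..b m} y * ennreal (Y y $ l $ j) \<partial>lborel)))"
    by (simp add: nn_integral_sum nn_integral_cmult nn_integral_multc)
  also have "\<dots> = (\<Sum>l\<in>UNIV. \<Sum>k\<in>UNIV. ennreal (kern (windows W T a b m) p $ i $ k) * (ennreal (E $ k $ l) * ennreal (J $ l $ j)))"
  proof (intro sum.cong refl arg_cong2[where f = "(*)"])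
    fix k l
    show "(\<integral>\<^sup>+x. indicator (window_box a b m) x * ennreal (L x $ i $ k) \<partial>(\<Pi>\<^sub>M n\<in>{..<m}. lborel))
        = ennreal (kern (windows W T a b m) p $ i $ k)"
      unfolding L_def p_def using Suc.prems by (intro Suc.IH) auto
    show "(\<integral>\<^sup>+y. indicator {a m<..b m} y * ennreal (Y y $ l $ j) \<partial>lborel) = ennreal (J $ l $ j)"
      unfolding Y_def J_def using Suc.prems less_imp_le[OF pab(2)] by (intro kern_jump_nn_integral) auto
  qed
  also have "\<dots> = ennreal ((kern (windows W T a b m) p ** E ** J) $ i $ j)"
  proof -
    have "(kern (windows W T a b m) p ** E ** J) $ i $ j =
        (\<Sum>l\<in>UNIV. \<Sum>k\<in>UNIV. kern (windows W T a b m) p $ i $ k * (E $ k $ l * J $ l $ j))"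
      by (simp add: matrix_matrix_mult_def sum_distrib_right mult.assoc)
    then show ?thesis
      by (simp add: sum_ennreal[symmetric] ennreal_mult sum_nonneg kern_nonneg E_nonneg J_def)
  qed
  also have "kern (windows W T a b m) p ** E ** J = kern (windows W T a b (Suc m)) (window_start b (Suc m))"
    using kern_windows_Suc[of m T W b a] Suc.prems
    by (simp add: E_def J_def p_def window_start_def[of _ "Suc m"] less_Suc_eq_le)
  finally show ?case .
qed

end

section \<open>Boxes generate the ordered cone\<close>

text \<open>Unlike \<open>ordered_cone\<close>, this excludes a first coordinate equal to 0, which
  no half-open window with nonnegative left end contains.\<close>

definition open_cone :: "nat \<Rightarrow> (nat \<Rightarrow> real) set" where
  "open_cone m = {r \<in> {..<m} \<rightarrow>\<^sub>E UNIV. \<forall>n<m. window_start r n < r n}"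

definition cone_boxes :: "nat \<Rightarrow> (nat \<Rightarrow> real) set set" where
  "cone_boxes m = {window_box a b m \<inter> ({..<m} \<rightarrow>\<^sub>E UNIV) | a b. \<forall>n<m. window_start b n \<le> a n}"

text \<open>Consecutive windows touch and all right ends are rational, which gives a countable cover
  of the cone by boxes.\<close>

definition rat_boxes :: "nat \<Rightarrow> (nat \<Rightarrow> real) set set" where
  "rat_boxes m = (\<lambda>b. window_box (window_start b) b m \<inter> ({..<m} \<rightarrow>\<^sub>E UNIV)) ` ({..<m} \<rightarrow>\<^sub>E \<rat>)"

lemma countable_rat_boxes: "countable (rat_boxes m)"
  unfolding rat_boxes_def by (intro countable_image countable_PiE) (auto simp: countable_rat)

lemma rat_boxes_subset: "rat_boxes m \<subseteq> cone_boxes m"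
  unfolding rat_boxes_def cone_boxes_def by blast

lemma box_subset_open_cone:
  assumes "\<And>n. n < m \<Longrightarrow> window_start b n \<le> a n"
  shows "window_box a b m \<inter> ({..<m} \<rightarrow>\<^sub>E UNIV) \<subseteq> open_cone m"
proof
  fix r assume r: "r \<in> window_box a b m \<inter> ({..<m} \<rightarrow>\<^sub>E UNIV)"
  have "window_start r n < r n" if n: "n < m" for n
  proof (cases n)
    case 0
    then show ?thesis using r assms[OF n] n by (auto simp: window_box_def window_start_def intro: le_less_trans)
  next
    case (Suc k)
    have "r k \<le> b k" "a n < r n" using r n Suc by (auto simp: window_box_def)
    then show ?thesis using assms[OF n] Suc by (simp add: window_start_def)
  qed
  then show "r \<in> open_cone m" using r by (simp add: open_cone_def)
qed

lemma cone_boxes_subset: "B \<in> cone_boxes m \<Longrightarrow> B \<subseteq> open_cone m"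
  unfolding cone_boxes_def using box_subset_open_cone by blast

text \<open>Intersecting takes the larger left ends and the smaller right ends, which can only widen
  the gaps between windows.\<close>

lemma Int_stable_cone_boxes: "Int_stable (cone_boxes m)"
proof (rule Int_stableI)
  fix B B' assume "B \<in> cone_boxes m" "B' \<in> cone_boxes m"
  then obtain a b a' b' where *: "B = window_box a b m \<inter> ({..<m} \<rightarrow>\<^sub>E UNIV)" "B' = window_box a' b' m \<inter> ({..<m} \<rightarrow>\<^sub>E UNIV)"
    "\<And>n. n < m \<Longrightarrow> window_start b n \<le> a n" "\<And>n. n < m \<Longrightarrow> window_start b' n \<le> a' n"
    unfolding cone_boxes_def by blast
  have "B \<inter> B' = window_box (\<lambda>n. max (a n) (a' n)) (\<lambda>n. min (b n) (b' n)) m \<inter> ({..<m} \<rightarrow>\<^sub>E UNIV)"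
    unfolding * window_box_def by auto
  moreover have "window_start (\<lambda>n. min (b n) (b' n)) n \<le> max (a n) (a' n)" if "n < m" for n
    using *(3,4)[OF that] by (auto simp: window_start_def min_def max_def split: if_splits)
  ultimately show "B \<inter> B' \<in> cone_boxes m" unfolding cone_boxes_def by blast
qed

text \<open>A rational separator is placed between each coordinate and the next. As the right end of
  one window and the left end of the following one it puts \<open>r\<close> inside the box, while
  \<open>c\<close> keeps the box below prescribed bounds.\<close>

lemma rat_box_between:
  assumes r: "r \<in> open_cone m" and c: "\<And>n. n < m \<Longrightarrow> r n < c n"
  shows "\<exists>b. b \<in> {..<m} \<rightarrow>\<^sub>E \<rat> \<and> r \<in> window_box (window_start b) b m \<and> (\<forall>n<m. b n < c n)"
proof -
  have ws: "window_start r n < r n" if "n < m" for n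
    using r that by (simp add: open_cone_def)
  have "\<exists>q\<in>\<rat>. r n < q \<and> q < (if Suc n < m then min (c n) (r (Suc n)) else c n)" if "n < m" for n
  proof (rule Rats_dense_in_real)
    show "r n < (if Suc n < m then min (c n) (r (Suc n)) else c n)"
      using ws[of "Suc n"] c[OF that] by (simp add: window_start_def)
  qed
  then have "\<forall>n. \<exists>q. n < m \<longrightarrow> q \<in> \<rat> \<and> r n < q \<and> q < (if Suc n < m then min (c n) (r (Suc n)) else c n)"
    by blast
  then obtain q where q: "\<And>n. n < m \<Longrightarrow> q n \<in> \<rat>" "\<And>n. n < m \<Longrightarrow> r n < q n"
    "\<And>n. n < m \<Longrightarrow> q n < (if Suc n < m then min (c n) (r (Suc n)) else c n)" by metis
  define b where "b = restrict q {..<m}"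
  have "window_start b n < r n" if n: "n < m" for n
  proof (cases n)
    case 0
    then show ?thesis using ws[OF n] by (simp add: window_start_def)
  next
    case (Suc k)
    then show ?thesis using q(3)[of k] n by (simp add: window_start_def b_def)
  qed
  then have "r \<in> window_box (window_start b) b m" using q(2) by (auto simp: window_box_def b_def less_imp_le)
  moreover have "b n < c n" if "n < m" for n using q(3)[OF that] that by (auto simp: b_def split: if_splits)
  moreover have "b \<in> {..<m} \<rightarrow>\<^sub>E \<rat>" using q(1) by (auto simp: b_def)
  ultimately show ?thesis by blast
qed

lemma Union_rat_boxes: "\<Union>(rat_boxes m) = open_cone m"
proof
  show "\<Union>(rat_boxes m) \<subseteq> open_cone m"
    using rat_boxes_subset cone_boxes_subset by blast
  show "open_cone m \<subseteq> \<Union>(rat_boxes m)"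
  proof
    fix r assume r: "r \<in> open_cone m"
    obtain b where "b \<in> {..<m} \<rightarrow>\<^sub>E \<rat>" "r \<in> window_box (window_start b) b m"
      using rat_box_between[OF r, of "\<lambda>n. r n + 1"] by auto
    moreover have "r \<in> {..<m} \<rightarrow>\<^sub>E UNIV" using r by (simp add: open_cone_def)
    ultimately show "r \<in> \<Union>(rat_boxes m)" unfolding rat_boxes_def by blast
  qed
qed

lemma space_PiM_borel: "space (\<Pi>\<^sub>M n\<in>I. borel) = I \<rightarrow>\<^sub>E UNIV"
  by (simp add: space_PiM)

lemma box_sets: "window_box a b m \<inter> ({..<m} \<rightarrow>\<^sub>E UNIV) \<in> sets (\<Pi>\<^sub>M n\<in>{..<m}. borel :: real measure)"
proof -
  have "window_box a b m \<inter> ({..<m} \<rightarrow>\<^sub>E UNIV) =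
      {r\<in>space (\<Pi>\<^sub>M n\<in>{..<m}. borel). \<forall>k<m. a k < r k \<and> r k \<le> b k}"
    by (auto simp: window_box_def space_PiM_borel)
  also have "\<dots> \<in> sets (\<Pi>\<^sub>M n\<in>{..<m}. borel)" by measurable
  finally show ?thesis .
qed

lemma sets_open_cone: "open_cone m \<in> sets (\<Pi>\<^sub>M n\<in>{..<m}. borel :: real measure)"
  unfolding Union_rat_boxes[symmetric]
proof (rule sets.countable_Union[OF countable_rat_boxes])
  show "rat_boxes m \<subseteq> sets (\<Pi>\<^sub>M n\<in>{..<m}. borel)" unfolding rat_boxes_def using box_sets by auto
qed

text \<open>The nontrivial inclusion needs coordinates measurable for the sigma-algebra of boxes:
  the part of the cone where coordinate \<open>n\<close> is below \<open>c\<close> is the union of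
  the rational boxes contained in it.\<close>

lemma sets_restrict_open_cone:
  assumes N: "sets N = sets (\<Pi>\<^sub>M n\<in>{..<m}. borel :: real measure)"
  shows "sets (restrict_space N (open_cone m)) = sigma_sets (open_cone m) (cone_boxes m)"
proof
  have sub: "cone_boxes m \<subseteq> Pow (open_cone m)" using cone_boxes_subset by blast
  have C: "open_cone m \<subseteq> space N"
    using sets_eq_imp_space_eq[OF N] by (auto simp: open_cone_def space_PiM_borel)
  show "sigma_sets (open_cone m) (cone_boxes m) \<subseteq> sets (restrict_space N (open_cone m))"
  proof (rule sets.sigma_sets_subset')
    show "cone_boxes m \<subseteq> sets (restrict_space N (open_cone m))"
    proof
      fix B assume B: "B \<in> cone_boxes m"
      then have "B \<in> sets N" unfolding N cone_boxes_def using box_sets by auto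
      moreover have "B = open_cone m \<inter> B" using cone_boxes_subset[OF B] by auto
      ultimately show "B \<in> sets (restrict_space N (open_cone m))"
        unfolding sets_restrict_space by blast
    qed
    show "open_cone m \<in> sets (restrict_space N (open_cone m))"
      using C sets.top[of "restrict_space N (open_cone m)"] by (simp add: space_restrict_space Int_absorb2)
  qed
  define S where "S = sigma (open_cone m) (cone_boxes m)"
  have S: "sets S = sigma_sets (open_cone m) (cone_boxes m)" "space S = open_cone m"
    using sub by (simp_all add: S_def)
  have "(\<lambda>r. r) \<in> S \<rightarrow>\<^sub>M (\<Pi>\<^sub>M n\<in>{..<m}. borel)"
  proof (rule measurable_PiM_single')
    fix n assume n: "n \<in> {..<m}"
    show "(\<lambda>r. r n) \<in> borel_measurable S"
    proof (rule borel_measurableI_less)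
      fix c :: real
      have "{r\<in>space S. r n < c} = \<Union>{B\<in>rat_boxes m. \<forall>r\<in>B. r n < c}"
      proof (intro equalityI subsetI)
        fix r assume "r \<in> {r\<in>space S. r n < c}"
        then have r: "r \<in> open_cone m" "r n < c" by (auto simp: S)
        have "\<exists>b. b \<in> {..<m} \<rightarrow>\<^sub>E \<rat> \<and> r \<in> window_box (window_start b) b m \<and>
            (\<forall>k<m. b k < (if k = n then c else r k + 1))"
          by (rule rat_box_between[OF r(1)]) (use r(2) in simp)
        then obtain b where b: "b \<in> {..<m} \<rightarrow>\<^sub>E \<rat>" "r \<in> window_box (window_start b) b m"
          "\<And>k. k < m \<Longrightarrow> b k < (if k = n then c else r k + 1)" by blast
        have "r \<in> {..<m} \<rightarrow>\<^sub>E UNIV" using r(1) by (simp add: open_cone_def)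
        moreover have "\<forall>r\<in>window_box (window_start b) b m. r n < c"
          using b(3)[of n] n by (auto simp: window_box_def)
        ultimately show "r \<in> \<Union>{B\<in>rat_boxes m. \<forall>r\<in>B. r n < c}"
          using b(1,2) unfolding rat_boxes_def by blast
      next
        fix r assume "r \<in> \<Union>{B\<in>rat_boxes m. \<forall>r\<in>B. r n < c}"
        then show "r \<in> {r\<in>space S. r n < c}"
          using Union_rat_boxes[of m] by (auto simp: S)
      qed
      also have "\<dots> \<in> sets S"
        unfolding S(1) using rat_boxes_subset
        by (intro sigma_sets_UNION) (auto intro!: sigma_sets.Basic countable_subset[OF _ countable_rat_boxes])
      finally show "{r\<in>space S. r n < c} \<in> sets S" .
    qed
  qed (auto simp: S open_cone_def)
  from measurable_sets[OF this] have *: "A \<inter> open_cone m \<in> sigma_sets (open_cone m) (cone_boxes m)"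
    if "A \<in> sets N" for A using that by (simp add: N S vimage_def)
  show "sets (restrict_space N (open_cone m)) \<subseteq> sigma_sets (open_cone m) (cone_boxes m)"
    unfolding sets_restrict_space using * by (auto simp: Int_commute)
qed

text \<open>Uniqueness of measures on an intersection-stable generator, applied to the restrictions
  to the cone; finiteness on the countable cover comes from \<open>N1\<close>.\<close>

lemma measure_eq_on_open_cone:
  assumes N1: "sets N1 = sets (\<Pi>\<^sub>M n\<in>{..<m}. borel :: real measure)"
    and N2: "sets N2 = sets (\<Pi>\<^sub>M n\<in>{..<m}. borel :: real measure)"
    and fin: "finite_measure N1"
    and eq: "\<And>a b. (\<And>n. n < m \<Longrightarrow> window_start b n \<le> a n) \<Longrightarrow>
      emeasure N1 (window_box a b m \<inter> ({..<m} \<rightarrow>\<^sub>E UNIV)) = emeasure N2 (window_box a b m \<inter> ({..<m} \<rightarrow>\<^sub>E UNIV))"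
    and V: "V \<in> sets (\<Pi>\<^sub>M n\<in>{..<m}. borel)" "V \<subseteq> open_cone m"
  shows "emeasure N1 V = emeasure N2 V"
proof -
  interpret finite_measure N1 by (rule fin)
  have C: "open_cone m \<inter> space N \<in> sets N" if "sets N = sets (\<Pi>\<^sub>M n\<in>{..<m}. borel :: real measure)"
    for N :: "(nat \<Rightarrow> real) measure"
    using sets_open_cone[of m] that by (simp add: sets.Int)
  have em: "emeasure (restrict_space N (open_cone m)) B = emeasure N B"
    if "sets N = sets (\<Pi>\<^sub>M n\<in>{..<m}. borel :: real measure)" "B \<subseteq> open_cone m" for N B
    using emeasure_restrict_space[OF C[OF that(1)] that(2)] .
  have "restrict_space N1 (open_cone m) = restrict_space N2 (open_cone m)"
  proof (rule measure_eqI_generator_eq_countable[OF Int_stable_cone_boxes _ _ sets_restrict_open_cone[OF N1]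
        sets_restrict_open_cone[OF N2] rat_boxes_subset Union_rat_boxes countable_rat_boxes])
    show "cone_boxes m \<subseteq> Pow (open_cone m)" using cone_boxes_subset by blast
    fix B assume B: "B \<in> cone_boxes m"
    then show "emeasure (restrict_space N1 (open_cone m)) B = emeasure (restrict_space N2 (open_cone m)) B"
      using eq cone_boxes_subset[OF B] unfolding em[OF N1 cone_boxes_subset[OF B]] em[OF N2 cone_boxes_subset[OF B]]
      by (auto simp: cone_boxes_def)
  next
    fix B assume "B \<in> rat_boxes m"
    then have "B \<subseteq> open_cone m" using rat_boxes_subset cone_boxes_subset by blast
    then show "emeasure (restrict_space N1 (open_cone m)) B \<noteq> \<infinity>" by (simp add: em[OF N1])
  qed
  then show ?thesis using em[OF N1 V(2)] em[OF N2 V(2)] by simp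
qed

section \<open>The law of the hitting times\<close>

lemma ordered_partition_nth:
  assumes "ordered_partition A s" "n < length s"
  shows "s ! n \<noteq> {}" "s ! n \<subseteq> A" "first_elem (s ! n) \<in> s ! n"
proof -
  have "s ! n \<in> set s" using assms(2) by simp
  moreover have "\<forall>c\<in>set s. c \<noteq> {}" "\<Union>(set s) = A"
    using assms(1) by (simp_all add: ordered_partition_def)
  ultimately show "s ! n \<noteq> {}" "s ! n \<subseteq> A" by auto
  then show "first_elem (s ! n) \<in> s ! n" unfolding first_elem_def by (simp add: some_in_eq)
qed

lemma component_index_eq:
  assumes "ordered_partition A s" "n < length s" "k \<in> s ! n"
  shows "component_index s k = n"
  unfolding component_index_def
proof (rule the_equality)
  fix l assume "l < length s \<and> k \<in> s ! l"
  then show "l = n" using assms unfolding ordered_partition_def by blast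
qed (use assms in simp)

lemma component_index_lt:
  assumes "ordered_partition A s" "k \<in> A"
  shows "component_index s k < length s" "k \<in> s ! component_index s k"
proof -
  obtain n where "n < length s" "k \<in> s ! n"
    using assms unfolding ordered_partition_def by (metis UnionE in_set_conv_nth)
  with component_index_eq[OF assms(1) this]
  show "component_index s k < length s" "k \<in> s ! component_index s k" by auto
qed

lemma arrival_waiting:
  assumes "ordered_partition A s" "n < length s"
  shows "arrival_set G s n \<inter> waiting_set G s n = {}" "arrival_set G s n \<subseteq> waiting_set G s (Suc n)"
proof -
  have "i \<notin> waiting_set G s n" if "i \<in> arrival_set G s n" for i
    using that ordered_partition_nth[OF assms] assms(2) unfolding waiting_set_iff arrival_set_def by blast
  then show "arrival_set G s n \<inter> waiting_set G s n = {}" by blast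
qed (simp add: arrival_set_def)

lemma waiting_set_length: "waiting_set G s (length s) = UNIV"
  by (auto simp: waiting_set_iff)

context markov_process
begin

lemma hit_measurable [measurable]: "(\<lambda>\<omega>. hit B (traj \<omega>)) \<in> borel_measurable M"
proof -
  have "(\<lambda>\<omega>. rat_hit B (future 0 \<omega>)) \<in> borel_measurable M"
    by (rule measurable_compose[OF future_measurable measurable_rat_hit]) simp
  moreover have "rat_hit B (future 0 \<omega>) = hit B (traj \<omega>)" if "\<omega> \<in> space M" for \<omega>
  proof -
    have "right_continuous_path (future 0 \<omega>)"
      using right_continuous_path[OF that]
      by (subst right_continuous_path_cong[of _ "traj \<omega>"]) (auto simp: future_def)
    then have "rat_hit B (future 0 \<omega>) = hit B (future 0 \<omega>)" by (rule rat_hit_eq)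
    also have "\<dots> = hit B (traj \<omega>)" by (rule hit_cong) (simp add: future_def)
    finally show ?thesis .
  qed
  ultimately show ?thesis by (simp cong: measurable_cong)
qed

text \<open>\<open>real_of_ereal\<close> sends an infinite hitting time to 0; such outcomes are
  discarded by \<open>tied\<close>.\<close>

definition hit_vec :: "('k \<Rightarrow> 's set) \<Rightarrow> 'k set list \<Rightarrow> 'w \<Rightarrow> nat \<Rightarrow> real" where
  "hit_vec G s \<omega> = (\<lambda>n\<in>{..<length s}. real_of_ereal (hit (G (first_elem (s ! n))) (traj \<omega>)))"

definition tied :: "('k \<Rightarrow> 's set) \<Rightarrow> 'k set list \<Rightarrow> 'w set" where
  "tied G s = {\<omega>\<in>space M. \<forall>n<length s. \<forall>k\<in>s ! n. hit (G k) (traj \<omega>) = ereal (hit_vec G s \<omega> n)}"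

lemma hit_vec_measurable [measurable]: "hit_vec G s \<in> M \<rightarrow>\<^sub>M (\<Pi>\<^sub>M n\<in>{..<length s}. borel)"
  unfolding hit_vec_def by measurable

lemma hit_vec_eqI:
  assumes "ordered_partition A s" "\<omega> \<in> space M"
    and "\<And>n k. n < length s \<Longrightarrow> k \<in> s ! n \<Longrightarrow> hit (G k) (traj \<omega>) = ereal (r n)"
  shows "\<omega> \<in> tied G s" "\<And>n. n < length s \<Longrightarrow> hit_vec G s \<omega> n = r n"
proof -
  show *: "hit_vec G s \<omega> n = r n" if "n < length s" for n
    using assms(3)[OF that ordered_partition_nth(3)[OF assms(1) that]] that by (simp add: hit_vec_def)
  show "\<omega> \<in> tied G s" using assms(2,3) * by (simp add: tied_def)
qed

lemma tied_sets:
  assumes "finite A" "ordered_partition A s"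
  shows "tied G s \<in> sets M"
proof -
  have fin: "finite (s ! n)" if "n < length s" for n
    using ordered_partition_nth(2)[OF assms(2) that] assms(1) finite_subset by blast
  have *: "(\<lambda>\<omega>. hit_vec G s \<omega> n) \<in> borel_measurable M" if "n < length s" for n
    using that unfolding hit_vec_def by simp
  have "tied G s = {\<omega>\<in>space M. \<forall>n\<in>{..<length s}. \<forall>k\<in>s ! n. hit (G k) (traj \<omega>) = ereal (hit_vec G s \<omega> n)}"
    by (auto simp: tied_def)
  also have "\<dots> \<in> sets M"
    using * fin
    by (intro sets.sets_Collect_finite_All measurable_equality_set hit_measurable borel_measurable_ereal) auto
  finally show ?thesis .
qed

definition density_fun :: "('k \<Rightarrow> 's set) \<Rightarrow> 'k set list \<Rightarrow> 's \<Rightarrow> (nat \<Rightarrow> real) \<Rightarrow> real" where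
  "density_fun G s i r = (\<Sum>j\<in>UNIV. jump_density (waiting_set G s) (arrival_set G s) (length s) r $ i $ j)"

lemma density_fun_nonneg:
  assumes "ordered_partition A s" "\<And>n. n < length s \<Longrightarrow> window_start r n \<le> r n"
  shows "0 \<le> density_fun G s i r"
  unfolding density_fun_def
  using assms arrival_waiting(1)[OF assms(1)] by (intro sum_nonneg jump_density_nonneg)

lemma density_fun_measurable:
  assumes "\<And>n. n < length s \<Longrightarrow> (\<lambda>x. r x n) \<in> borel_measurable N"
  shows "(\<lambda>x. density_fun G s i (r x)) \<in> borel_measurable N"
  unfolding density_fun_def by (intro borel_measurable_sum jump_density_measurable assms)

text \<open>\<open>windows_hit_iff\<close> turns the hitting event into a window event for
  trajectories starting at \<open>i\<close>; summing the kernel over its columns forgets the final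
  state.\<close>

lemma measure_hit_vec_box:
  assumes s: "finite A" "ordered_partition A s" and i: "i \<in> waiting_set G s 0"
    and a: "\<And>n. n < length s \<Longrightarrow> window_start b n \<le> a n" and ab: "\<And>n. n < length s \<Longrightarrow> a n < b n"
  shows "measure (P i) {\<omega>\<in>tied G s. hit_vec G s \<omega> \<in> window_box a b (length s)} =
    (\<Sum>j\<in>UNIV. kern (windows (waiting_set G s) (arrival_set G s) a b (length s)) (window_start b (length s)) $ i $ j)"
proof -
  define m where "m = length s"
  define W where "W = waiting_set G s"
  define T where "T = arrival_set G s"
  have TW: "\<And>n. n < m \<Longrightarrow> T n \<inter> W n = {}"
    unfolding T_def W_def m_def by (rule arrival_waiting(1)[OF s(2)])
  have ev: "path_event (windows W T a b m)" "0 \<le> window_start b m"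
    using windows_event[of m T W b a] TW a ab by (auto simp: m_def)
  have wM: "{\<omega>\<in>space M. windows W T a b m (traj \<omega>)} \<in> sets M" by (rule path_event_sets_0[OF ev(1)])
  have "measure (P i) {\<omega>\<in>tied G s. hit_vec G s \<omega> \<in> window_box a b m} = measure (P i) {\<omega>\<in>space M. windows W T a b m (traj \<omega>)}"
  proof (rule measure_cong_start[OF _ wM])
    have "{\<omega>\<in>tied G s. hit_vec G s \<omega> \<in> window_box a b m} =
        tied G s \<inter> (hit_vec G s -` (window_box a b m \<inter> ({..<m} \<rightarrow>\<^sub>E UNIV)) \<inter> space M)"
      by (auto simp: tied_def hit_vec_def m_def)
    also have "\<dots> \<in> sets M"
      unfolding m_def by (intro sets.Int tied_sets[OF s] measurable_sets[OF hit_vec_measurable box_sets])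
    finally show "{\<omega>\<in>tied G s. hit_vec G s \<omega> \<in> window_box a b m} \<in> sets M" .
  next
    fix \<omega> assume w: "\<omega> \<in> space M" "X 0 \<omega> = i"
    have "windows W T a b m (traj \<omega>) \<longleftrightarrow>
        (\<exists>r. \<forall>n<m. a n < r n \<and> r n \<le> b n \<and> (\<forall>k\<in>s ! n. hit (G k) (traj \<omega>) = ereal (r n)))"
      unfolding W_def T_def m_def using w i a ab
      by (intro windows_hit_iff right_continuous_path) auto
    also have "\<dots> \<longleftrightarrow> \<omega> \<in> {\<omega>\<in>tied G s. hit_vec G s \<omega> \<in> window_box a b m}"
    proof
      assume "\<exists>r. \<forall>n<m. a n < r n \<and> r n \<le> b n \<and> (\<forall>k\<in>s ! n. hit (G k) (traj \<omega>) = ereal (r n))"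
      then obtain r where r: "\<And>n. n < m \<Longrightarrow> a n < r n \<and> r n \<le> b n"
        "\<And>n k. n < length s \<Longrightarrow> k \<in> s ! n \<Longrightarrow> hit (G k) (traj \<omega>) = ereal (r n)" unfolding m_def by blast
      from hit_vec_eqI[of A s \<omega> G r, OF s(2) w(1) r(2)] r(1)
      show "\<omega> \<in> {\<omega>\<in>tied G s. hit_vec G s \<omega> \<in> window_box a b m}" by (auto simp: window_box_def m_def)
    next
      assume "\<omega> \<in> {\<omega>\<in>tied G s. hit_vec G s \<omega> \<in> window_box a b m}"
      then show "\<exists>r. \<forall>n<m. a n < r n \<and> r n \<le> b n \<and> (\<forall>k\<in>s ! n. hit (G k) (traj \<omega>) = ereal (r n))"
        by (intro exI[of _ "hit_vec G s \<omega>"]) (auto simp: window_box_def tied_def m_def)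
    qed
    finally show "\<omega> \<in> {\<omega>\<in>tied G s. hit_vec G s \<omega> \<in> window_box a b m} \<longleftrightarrow> \<omega> \<in> {\<omega>\<in>space M. windows W T a b m (traj \<omega>)}"
      using w(1) by simp
  qed
  also have "\<dots> = (\<Sum>j\<in>UNIV. kern (windows W T a b m) (window_start b m) $ i $ j)"
    using measure_split_state[OF ev(2) wM, of i] by (simp add: kern_def conj_assoc)
  finally show ?thesis by (simp add: W_def T_def m_def)
qed

text \<open>The last waiting set is the whole space, so the trailing exponential is a transition
  matrix and disappears when the end states are summed.\<close>

lemma nn_integral_density_box:
  assumes s: "ordered_partition A s" and i: "i \<in> waiting_set G s 0"
    and a: "\<And>n. n < length s \<Longrightarrow> window_start b n \<le> a n" and ab: "\<And>n. n < length s \<Longrightarrow> a n < b n"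
  shows "(\<integral>\<^sup>+r. indicator (window_box a b (length s)) r * ennreal (density_fun G s i r) \<partial>(\<Pi>\<^sub>M n\<in>{..<length s}. lborel)) =
    ennreal (\<Sum>j\<in>UNIV. kern (windows (waiting_set G s) (arrival_set G s) a b (length s)) (window_start b (length s)) $ i $ j)"
proof -
  define m where "m = length s"
  define W where "W = waiting_set G s"
  define T where "T = arrival_set G s"
  define N where "N = (\<Pi>\<^sub>M n\<in>{..<m}. lborel :: real measure)"
  define F where "F r = jump_density W T m r ** stay_exp (W m) (window_start b m - window_start r m)" for r
  have TW: "\<And>n. n < m \<Longrightarrow> T n \<inter> W n = {}" "\<And>n. n < m \<Longrightarrow> T n \<subseteq> W (Suc n)"
    unfolding T_def W_def m_def by (rule arrival_waiting[OF s]; simp)+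
  have Wm: "W m = UNIV" by (simp add: W_def m_def waiting_set_length)
  have nonneg: "0 \<le> F r $ i $ j" and eq: "density_fun G s i r = (\<Sum>j\<in>UNIV. F r $ i $ j)"
    if "r \<in> window_box a b m" "r \<in> {..<m} \<rightarrow>\<^sub>E UNIV" for r j
  proof -
    have "r \<in> open_cone m" using box_subset_open_cone[of m b a] a that by (auto simp: m_def)
    then have ws: "\<And>n. n < m \<Longrightarrow> window_start r n \<le> r n" by (auto simp: open_cone_def less_imp_le)
    have le: "0 \<le> window_start b m - window_start r m"
      using that(1) by (cases m) (auto simp: window_box_def window_start_def)
    show "0 \<le> F r $ i $ j" unfolding F_def
      by (intro matrix_mult_nonneg jump_density_nonneg stay_exp_nonneg TW ws le)
    have "(\<Sum>j\<in>UNIV. F r $ i $ j) =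
        (\<Sum>k\<in>UNIV. jump_density W T m r $ i $ k * (\<Sum>j\<in>UNIV. stay_exp UNIV (window_start b m - window_start r m) $ k $ j))"
      unfolding F_def Wm by (simp add: matrix_matrix_mult_def sum_distrib_left) (rule sum.swap)
    then show "density_fun G s i r = (\<Sum>j\<in>UNIV. F r $ i $ j)"
      using stay_exp_row_sum[OF le] by (simp add: density_fun_def W_def T_def m_def)
  qed
  have "(\<integral>\<^sup>+r. indicator (window_box a b m) r * ennreal (density_fun G s i r) \<partial>N)
      = (\<integral>\<^sup>+r. (\<Sum>j\<in>UNIV. indicator (window_box a b m) r * ennreal (F r $ i $ j)) \<partial>N)"
  proof (rule nn_integral_cong)
    fix r assume "r \<in> space N"
    then have "r \<in> {..<m} \<rightarrow>\<^sub>E UNIV" by (simp add: N_def space_PiM)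
    then show "indicator (window_box a b m) r * ennreal (density_fun G s i r)
        = (\<Sum>j\<in>UNIV. indicator (window_box a b m) r * ennreal (F r $ i $ j))"
      using nonneg eq by (cases "r \<in> window_box a b m") (simp_all add: sum_ennreal)
  qed
  also have "\<dots> = (\<Sum>j\<in>UNIV. \<integral>\<^sup>+r. indicator (window_box a b m) r * ennreal (F r $ i $ j) \<partial>N)"
  proof (rule nn_integral_sum)
    fix j
    have comp: "(\<lambda>r. r n) \<in> borel_measurable N" if "n < m" for n using that by (simp add: N_def)
    then have "(\<lambda>r. window_start r m) \<in> borel_measurable N" by (cases m) (simp_all add: window_start_def)
    then have F [measurable]: "(\<lambda>r. F r $ i $ j) \<in> borel_measurable N" unfolding F_def
      by (intro matrix_mult_measurable jump_density_measurable stay_exp_measurable) (auto simp: comp)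
    have spN: "space N = {..<m} \<rightarrow>\<^sub>E UNIV" by (simp add: N_def space_PiM)
    have "sets N = sets (\<Pi>\<^sub>M n\<in>{..<m}. borel :: real measure)"
      unfolding N_def by (intro sets_PiM_cong) auto
    then have "window_box a b m \<inter> space N \<in> sets N" using box_sets[of a b m] by (simp add: spN)
    then have "(indicator (window_box a b m) :: _ \<Rightarrow> ennreal) \<in> borel_measurable N"
      by (simp add: borel_measurable_indicator_iff)
    then show "(\<lambda>r. indicator (window_box a b m) r * ennreal (F r $ i $ j)) \<in> borel_measurable N" by measurable
  qed
  also have "\<dots> = (\<Sum>j\<in>UNIV. ennreal (kern (windows W T a b m) (window_start b m) $ i $ j))"
    unfolding F_def N_def using TW a ab i
    by (intro sum.cong refl nn_integral_jump_density) (auto simp: m_def W_def)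
  also have "\<dots> = ennreal (\<Sum>j\<in>UNIV. kern (windows W T a b m) (window_start b m) $ i $ j)"
    by (simp add: sum_ennreal kern_nonneg)
  finally show ?thesis by (simp add: W_def T_def m_def N_def)
qed

text \<open>Both sides are measures in \<open>V\<close>, known to agree on boxes of separated
  windows; \<open>measure_eq_on_open_cone\<close> extends this to Borel subsets of the cone.\<close>

lemma measure_hit_vec:
  assumes s: "finite A" "ordered_partition A s" and i: "i \<in> waiting_set G s 0"
    and V: "V \<in> sets (\<Pi>\<^sub>M n\<in>{..<length s}. borel)" "V \<subseteq> open_cone (length s)"
  shows "ennreal (measure (P i) {\<omega>\<in>tied G s. hit_vec G s \<omega> \<in> V}) =
    (\<integral>\<^sup>+r. indicator V r * ennreal (density_fun G s i r) \<partial>(\<Pi>\<^sub>M n\<in>{..<length s}. lborel))"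
proof -
  interpret prob_space "P i" by (rule P_prob)
  define m where "m = length s"
  have tM: "tied G s \<in> sets (P i)" using tied_sets[OF s] by (simp add: P_sets)
  have hv: "hit_vec G s \<in> P i \<rightarrow>\<^sub>M (\<Pi>\<^sub>M n\<in>{..<m}. borel)"
    unfolding m_def using hit_vec_measurable measurable_cong_sets[OF P_sets refl] by blast
  define N where "N = (\<Pi>\<^sub>M n\<in>{..<m}. lborel :: real measure)"
  have N: "sets N = sets (\<Pi>\<^sub>M n\<in>{..<m}. borel :: real measure)"
    unfolding N_def by (intro sets_PiM_cong) auto
  define N1 where "N1 = distr (density (P i) (indicator (tied G s))) (\<Pi>\<^sub>M n\<in>{..<m}. borel) (hit_vec G s)"
  define N2 where "N2 = density N (\<lambda>r. ennreal (density_fun G s i r))"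
  have e1: "emeasure N1 S = ennreal (measure (P i) {\<omega>\<in>tied G s. hit_vec G s \<omega> \<in> S})"
    if S: "S \<in> sets (\<Pi>\<^sub>M n\<in>{..<m}. borel)" for S
  proof -
    have S': "hit_vec G s -` S \<inter> space M \<in> sets (P i)" using measurable_sets[OF hv S] by simp
    have "emeasure N1 S = emeasure (density (P i) (indicator (tied G s))) (hit_vec G s -` S \<inter> space M)"
      unfolding N1_def using S hv by (subst emeasure_distr) auto
    also have "\<dots> = emeasure (P i) (tied G s \<inter> (hit_vec G s -` S \<inter> space M))"
    proof -
      have "tied G s \<inter> (hit_vec G s -` S \<inter> space M) \<in> sets (P i)" using tM S' by (rule sets.Int)
      then show ?thesis using S' tM by (subst emeasure_density) (simp_all flip: indicator_inter_arith)
    qed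
    also have "tied G s \<inter> (hit_vec G s -` S \<inter> space M) = {\<omega>\<in>tied G s. hit_vec G s \<omega> \<in> S}"
      by (auto simp: tied_def)
    finally show ?thesis by (simp add: emeasure_eq_measure)
  qed
  have f_meas: "(\<lambda>r. ennreal (density_fun G s i r)) \<in> borel_measurable N"
    by (intro measurable_compose[OF _ measurable_ennreal] density_fun_measurable) (simp add: N_def m_def)
  have e2: "emeasure N2 S = (\<integral>\<^sup>+r. indicator S r * ennreal (density_fun G s i r) \<partial>N)"
    if "S \<in> sets (\<Pi>\<^sub>M n\<in>{..<m}. borel)" for S
    unfolding N2_def using that f_meas by (subst emeasure_density) (simp_all add: N mult.commute)
  have "emeasure N1 V = emeasure N2 V"
  proof (rule measure_eq_on_open_cone)
    show "sets N1 = sets (\<Pi>\<^sub>M n\<in>{..<m}. borel :: real measure)" by (simp add: N1_def)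
    show "sets N2 = sets (\<Pi>\<^sub>M n\<in>{..<m}. borel :: real measure)" by (simp add: N2_def N)
    have "space N1 = space (\<Pi>\<^sub>M n\<in>{..<m}. borel :: real measure)" by (simp add: N1_def)
    then show "finite_measure N1" using e1[of "space N1"] by (intro finite_measureI) simp
    show "V \<in> sets (\<Pi>\<^sub>M n\<in>{..<m}. borel)" "V \<subseteq> open_cone m" using V by (simp_all add: m_def)
    fix a b :: "nat \<Rightarrow> real" assume a: "\<And>n. n < m \<Longrightarrow> window_start b n \<le> a n"
    let ?B = "window_box a b m \<inter> ({..<m} \<rightarrow>\<^sub>E UNIV)"
    show "emeasure N1 ?B = emeasure N2 ?B"
    proof (cases "\<forall>n<m. a n < b n")
      case True
      have "{\<omega>\<in>tied G s. hit_vec G s \<omega> \<in> ?B} = {\<omega>\<in>tied G s. hit_vec G s \<omega> \<in> window_box a b m}"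
        by (auto simp: hit_vec_def m_def)
      then have "emeasure N1 ?B = ennreal (measure (P i) {\<omega>\<in>tied G s. hit_vec G s \<omega> \<in> window_box a b m})"
        using e1[OF box_sets] by simp
      also have "\<dots> = (\<integral>\<^sup>+r. indicator (window_box a b m) r * ennreal (density_fun G s i r) \<partial>N)"
        unfolding N_def m_def using a True i s
        by (subst measure_hit_vec_box[of A], simp_all add: m_def nn_integral_density_box)
      also have "\<dots> = (\<integral>\<^sup>+r. indicator ?B r * ennreal (density_fun G s i r) \<partial>N)"
        by (rule nn_integral_cong) (simp add: N_def space_PiM indicator_def)
      finally show ?thesis using e2[OF box_sets] by simp
    next
      \<comment> \<open>A degenerate window makes the box empty; the box formulas above concern
        nondegenerate windows.\<close>
      case False
      then have "?B = {}" by (auto simp: window_box_def)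
      then show ?thesis by simp
    qed
  qed
  then show ?thesis using e1[of V] e2[of V] V by (simp add: m_def N_def)
qed

end

text \<open>Only rational times strictly before \<open>u\<close> occur, so the event can be placed
  in the filtration at time \<open>u\<close>.\<close>

lemma le_hit_iff:
  assumes "right_continuous_path x"
  shows "ereal u \<le> hit B x \<longleftrightarrow> (\<forall>q\<in>\<rat> \<inter> {0<..<u}. x q \<notin> B)"
  unfolding rat_hit_eq[OF assms, symmetric] rat_hit_def le_INF_iff by force

text \<open>No visit to \<open>B\<close> occurs up to and including \<open>u\<close>, so both sides
  describe the same first visit through \<open>hit_eq_iff\<close>.\<close>

lemma hit_shift_iff:
  assumes x: "right_continuous_path x" and u: "0 \<le> u" "x u \<notin> B" "ereal u \<le> hit B x"
  shows "hit B x = ereal (u + t) \<longleftrightarrow> hit B (shift_path u x) = ereal t"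
proof -
  have before: "x v \<notin> B" if "0 < v" "v \<le> u" for v
    using hit_le[of v x B] u that by (cases "v = u") (auto dest: order_trans)
  \<comment> \<open>For positive \<open>u\<close>, the state at 0 persists to some positive time not
    after \<open>u\<close>, where \<open>B\<close> is already known to be avoided.\<close>
  have x0: "x 0 \<notin> B"
  proof (cases "u = 0")
    case False
    obtain e where e: "0 < e" "\<And>v. 0 \<le> v \<Longrightarrow> v < 0 + e \<Longrightarrow> x v = x 0"
      using right_continuous_pathE[OF x order_refl] by metis
    define v where "v = min u (e / 2)"
    have "0 < v" "v \<le> u" "v < 0 + e" using e(1) u False by (auto simp: v_def)
    then show ?thesis using e(2)[of v] before[of v] by simp
  qed (use u in simp)
  have "hit B x = ereal (u + t) \<longleftrightarrow> 0 < u + t \<and> x (u + t) \<in> B \<and> (\<forall>v. 0 \<le> v \<and> v < u + t \<longrightarrow> x v \<notin> B)"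
    by (rule hit_eq_iff[OF x x0])
  also have "\<dots> \<longleftrightarrow> 0 < t \<and> x (u + t) \<in> B \<and> (\<forall>v. 0 \<le> v \<and> v < t \<longrightarrow> x (u + v) \<notin> B)"
  proof
    assume h: "0 < u + t \<and> x (u + t) \<in> B \<and> (\<forall>v. 0 \<le> v \<and> v < u + t \<longrightarrow> x v \<notin> B)"
    then have "0 < t" using before[of "u + t"] by (cases "0 < t") auto
    moreover have "x (u + v) \<notin> B" if "0 \<le> v" "v < t" for v using h that u by auto
    ultimately show "0 < t \<and> x (u + t) \<in> B \<and> (\<forall>v. 0 \<le> v \<and> v < t \<longrightarrow> x (u + v) \<notin> B)" using h by blast
  next
    assume h: "0 < t \<and> x (u + t) \<in> B \<and> (\<forall>v. 0 \<le> v \<and> v < t \<longrightarrow> x (u + v) \<notin> B)"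
    have "x v \<notin> B" if "0 \<le> v" "v < u + t" for v
    proof (cases "v \<le> u")
      case True
      then show ?thesis using before[of v] x0 that by (cases "v = 0") auto
    next
      case False
      then have "0 \<le> v - u" "v - u < t" using that by auto
      then have "x (u + (v - u)) \<notin> B" using h by blast
      then show ?thesis by simp
    qed
    then show "0 < u + t \<and> x (u + t) \<in> B \<and> (\<forall>v. 0 \<le> v \<and> v < u + t \<longrightarrow> x v \<notin> B)"
      using h u by auto
  qed
  also have "\<dots> \<longleftrightarrow> hit B (shift_path u x) = ereal t"
    using hit_eq_iff[OF right_continuous_path_shift[OF x u(1)], of B t] u(2) by (simp add: shift_path_def)
  finally show ?thesis .
qed

lemma regionD:
  assumes "t \<in> region A s"
  shows "t \<in> A \<rightarrow>\<^sub>E {0..}" "\<forall>c\<in>set s. \<forall>k\<in>c. \<forall>l\<in>c. t k = t l"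
    "\<And>m n. m < n \<Longrightarrow> n < length s \<Longrightarrow> t (first_elem (s ! m)) < t (first_elem (s ! n))"
  using assms unfolding region_def by (elim CollectE conjE; simp only: simp_thms)+

text \<open>A witness \<open>t\<close> can only be the vector of real values of the
  \<open>f k\<close>, so the existential becomes finiteness of all components together with a
  measurable condition on that vector.\<close>

lemma sets_ex_vector_eq:
  fixes f :: "'k \<Rightarrow> 'x \<Rightarrow> ereal"
  assumes A: "finite A" and U: "U \<in> sets (\<Pi>\<^sub>M k\<in>A. borel)"
    and f: "\<And>k. k \<in> A \<Longrightarrow> f k \<in> borel_measurable N"
  shows "{x\<in>space N. \<exists>t\<in>U. \<forall>k\<in>A. f k x = ereal (t k)} \<in> sets N"
proof -
  define V where "V x = (\<lambda>k\<in>A. real_of_ereal (f k x))" for x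
  have V: "V \<in> N \<rightarrow>\<^sub>M (\<Pi>\<^sub>M k\<in>A. borel)"
    unfolding V_def by (intro measurable_restrict borel_measurable_real_of_ereal f)
  have "{x\<in>space N. \<forall>k\<in>A. f k x = ereal (V x k)} \<in> sets N"
  proof (intro sets.sets_Collect_finite_All A measurable_equality_set borel_measurable_ereal f)
    show "(\<lambda>x. V x k) \<in> borel_measurable N" if "k \<in> A" for k
      using that f by (simp add: V_def)
  qed
  moreover have "{x\<in>space N. \<exists>t\<in>U. \<forall>k\<in>A. f k x = ereal (t k)} =
      {x\<in>space N. \<forall>k\<in>A. f k x = ereal (V x k)} \<inter> (V -` U \<inter> space N)"
  proof (intro set_eqI iffI)
    fix x assume "x \<in> {x\<in>space N. \<exists>t\<in>U. \<forall>k\<in>A. f k x = ereal (t k)}"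
    then obtain t where t: "x \<in> space N" "t \<in> U" "\<And>k. k \<in> A \<Longrightarrow> f k x = ereal (t k)" by blast
    have "t \<in> A \<rightarrow>\<^sub>E UNIV" using sets.sets_into_space[OF U] t(2) by (auto simp: space_PiM)
    then have "V x = t" using t(3) by (auto simp: V_def fun_eq_iff PiE_def extensional_def)
    then show "x \<in> {x\<in>space N. \<forall>k\<in>A. f k x = ereal (V x k)} \<inter> (V -` U \<inter> space N)"
      using t by simp
  qed auto
  ultimately show ?thesis using sets.Int[OF _ measurable_sets[OF V U]] by simp
qed

lemma path_event_hits:
  assumes "finite A" "U \<in> sets (\<Pi>\<^sub>M k\<in>A. borel)"
  shows "path_event (\<lambda>x. \<exists>t\<in>U. \<forall>k\<in>A. hit (G k) x = ereal (t k))"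
proof (rule path_eventI[OF _ sets_ex_vector_eq[OF assms measurable_rat_hit]])
  show "(\<exists>t\<in>U. \<forall>k\<in>A. hit (G k) x = ereal (t k)) = (\<exists>t\<in>U. \<forall>k\<in>A. hit (G k) y = ereal (t k))"
    if "\<And>u. 0 \<le> u \<Longrightarrow> x u = y u" for x y
    using hit_cong[of x y] that by simp
qed (simp add: rat_hit_eq)

lemma AE_PiM_lborel_nth_neq:
  assumes "finite I" "n \<in> I"
  shows "AE r in (\<Pi>\<^sub>M n\<in>I. lborel :: real measure). r n \<noteq> c"
proof (rule AE_I')
  interpret finite_product_sigma_finite "\<lambda>_. lborel :: real measure" I
    by standard (rule assms)
  let ?Z = "Pi\<^sub>E I (\<lambda>k. if k = n then {c} else UNIV)"
  have "emeasure (\<Pi>\<^sub>M n\<in>I. lborel :: real measure) ?Z = (\<Prod>k\<in>I. emeasure lborel (if k = n then {c} else UNIV))"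
    by (rule measure_times) simp
  also have "\<dots> = 0" using assms by (intro prod_zero) auto
  finally show "?Z \<in> null_sets (\<Pi>\<^sub>M n\<in>I. lborel)"
    using assms(1) by (intro null_setsI sets_PiM_I_finite) auto
  show "{r\<in>space (\<Pi>\<^sub>M n\<in>I. lborel :: real measure). \<not> r n \<noteq> c} \<subseteq> ?Z"
    by (auto simp: space_PiM PiE_def Pi_def)
qed

text \<open>The cone in the definition of \<open>region_measure\<close> and \<open>open_cone\<close>
  differ only in vectors with first coordinate 0, a Lebesgue null set.\<close>

lemma nn_integral_region_measure:
  assumes s: "finite A" "ordered_partition A s" "s \<noteq> []"
    and f: "f \<in> borel_measurable (\<Pi>\<^sub>M k\<in>A. borel)"
  shows "(\<integral>\<^sup>+t. f t \<partial>region_measure A s) =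
    (\<integral>\<^sup>+r. indicator (open_cone (length s)) r * f (\<lambda>k\<in>A. r (component_index s k)) \<partial>(\<Pi>\<^sub>M n\<in>{..<length s}. lborel))"
proof -
  define m where "m = length s"
  define N where "N = (\<Pi>\<^sub>M n\<in>{..<m}. lborel :: real measure)"
  have m: "0 < m" using s(3) by (simp add: m_def)
  have spN: "space N = {..<m} \<rightarrow>\<^sub>E UNIV" by (simp add: N_def space_PiM)
  define \<phi> where "\<phi> r = (\<lambda>k\<in>A. r (component_index s k) :: real)" for r
  have phi: "\<phi> \<in> N \<rightarrow>\<^sub>M (\<Pi>\<^sub>M k\<in>A. borel)"
    unfolding \<phi>_def N_def
  proof (rule measurable_restrict)
    fix k assume "k \<in> A"
    then show "(\<lambda>r. r (component_index s k)) \<in> borel_measurable (\<Pi>\<^sub>M n\<in>{..<m}. lborel)"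
      using component_index_lt[OF s(2)] by (simp add: m_def)
  qed
  have comp: "(\<lambda>r. r n) \<in> borel_measurable N" if "n < m" for n using that by (simp add: N_def)
  have cone: "ordered_cone m \<inter> space N \<in> sets N"
  proof -
    have "ordered_cone m \<inter> space N =
        {r\<in>space N. (\<forall>n\<in>{..<m}. 0 \<le> r n) \<and> (\<forall>j\<in>{..<m}. \<forall>i\<in>{..<j}. r i < r j)}"
      by (auto simp: ordered_cone_def spN PiE_iff extensional_def)
    also have "\<dots> \<in> sets N"
    proof (intro sets.sets_Collect_conj sets.sets_Collect_finite_All)
      fix n assume "n \<in> {..<m}"
      then have [measurable]: "(\<lambda>r. r n) \<in> borel_measurable N" by (simp add: comp)
      show "{r\<in>space N. 0 \<le> r n} \<in> sets N" by measurable
      fix i assume "i \<in> {..<n}"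
      then have "i \<in> {..<m}" using \<open>n \<in> {..<m}\<close> by simp
      then have [measurable]: "(\<lambda>r. r i) \<in> borel_measurable N" by (simp add: comp)
      show "{r\<in>space N. r i < r n} \<in> sets N" by measurable
    qed auto
    finally show ?thesis .
  qed
  have "(\<integral>\<^sup>+t. f t \<partial>region_measure A s) = (\<integral>\<^sup>+r. f (\<phi> r) \<partial>restrict_space N (ordered_cone m))"
  proof -
    have "region_measure A s = distr (restrict_space N (ordered_cone m)) (\<Pi>\<^sub>M k\<in>A. borel) \<phi>"
      by (simp add: region_measure_def N_def m_def \<phi>_def[abs_def])
    then show ?thesis using nn_integral_distr[OF measurable_restrict_space1[OF phi]] f by simp
  qed
  also have "\<dots> = (\<integral>\<^sup>+r. f (\<phi> r) * indicator (ordered_cone m) r \<partial>N)"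
    by (rule nn_integral_restrict_space[OF cone])
  also have "\<dots> = (\<integral>\<^sup>+r. indicator (open_cone m) r * f (\<phi> r) \<partial>N)"
  proof (rule nn_integral_cong_AE)
    have "AE r in N. r 0 \<noteq> 0" unfolding N_def using m by (intro AE_PiM_lborel_nth_neq) auto
    then show "AE r in N. f (\<phi> r) * indicator (ordered_cone m) r = indicator (open_cone m) r * f (\<phi> r)"
      using AE_space
    proof eventually_elim
      case (elim r)
      have "r \<in> ordered_cone m \<longleftrightarrow> r \<in> open_cone m"
      proof
        assume r: "r \<in> ordered_cone m"
        have inc: "r i < r j" if "i < j" "j < m" for i j
          using r that unfolding ordered_cone_def by blast
        have ext: "r \<in> {..<m} \<rightarrow>\<^sub>E {0..}" using r unfolding ordered_cone_def by blast
        have "window_start r n < r n" if "n < m" for n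
        proof (cases n)
          case 0
          have "r 0 \<in> {0..}" using ext m by (rule PiE_mem[OF _ lessThan_iff[THEN iffD2]])
          then show ?thesis using elim(1) 0 by (simp add: window_start_def)
        next
          case (Suc k)
          then show ?thesis using inc[of k n] that by (simp add: window_start_def)
        qed
        then show "r \<in> open_cone m" using ext by (simp add: open_cone_def PiE_iff)
      next
        assume r: "r \<in> open_cone m"
        then have ws: "window_start r n < r n" if "n < m" for n using that by (simp add: open_cone_def)
        have inc: "i < j \<longrightarrow> j < m \<longrightarrow> r i < r j" for i j
        proof (induction j)
          case (Suc j)
          then show ?case using ws[of "Suc j"] by (auto simp: window_start_def less_Suc_eq intro: less_trans)
        qed simp
        have "0 \<le> r n" if "n < m" for n
          using ws[of 0] inc[of 0 n] that m by (cases "n = 0") (simp_all add: window_start_def)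
        moreover have "r \<in> extensional {..<m}" using r by (simp add: open_cone_def PiE_iff)
        ultimately show "r \<in> ordered_cone m" using inc unfolding ordered_cone_def PiE_iff by blast
      qed
      then show ?case by (simp add: indicator_def)
    qed
  qed
  finally show ?thesis by (simp add: m_def N_def \<phi>_def)
qed

context markov_process
begin

lemma hitting_density_eq:
  "hitting_density lam G s (axis i 1) t = density_fun G s i (\<lambda>n. t (first_elem (s ! n)))"
proof -
  have row: "(axis i 1 v* Q) \<bullet> vec 1 = (\<Sum>j\<in>UNIV. Q $ i $ j)" for Q :: "real^'s^'s"
  proof -
    have "(axis i 1 v* Q) $ j = Q $ i $ j" for j
    proof -
      have "(axis i 1 v* Q) $ j = (\<Sum>k\<in>UNIV. if k = i then Q $ i $ j else 0)"
        unfolding vector_matrix_mult_def vec_lambda_beta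
        by (intro sum.cong refl) (simp add: axis_def)
      then show ?thesis by simp
    qed
    then show ?thesis by (simp add: inner_vec_def)
  qed
  have "level_time s t n = window_start (\<lambda>n. t (first_elem (s ! n))) n" for n
    by (simp add: level_time_def window_start_def)
  then show ?thesis
    unfolding hitting_density_def density_fun_def row jump_density_def stay_exp_def by simp
qed

text \<open>The map \<open>\<phi>\<close> passes from one time per component to one time per target;
  pulled back along it, the claim is \<open>measure_hit_vec\<close>. Integrability follows because
  the nonnegative integral equals a probability.\<close>

lemma hitting_times_law:
  assumes s: "finite A" "A \<noteq> {}" "ordered_partition A s"
    and U: "U \<in> sets (\<Pi>\<^sub>M k\<in>A. borel)" "U \<subseteq> region A s"
    and i: "i \<in> waiting_set G s 0"
  shows "set_integrable (region_measure A s) U (hitting_density lam G s (axis i 1))"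
    and "measure (P i) {\<omega>\<in>space M. \<exists>t\<in>U. \<forall>k\<in>A. hit (G k) (traj \<omega>) = ereal (t k)} =
      (LINT t:U|region_measure A s. hitting_density lam G s (axis i 1) t)"
proof -
  define m where "m = length s"
  define N where "N = (\<Pi>\<^sub>M n\<in>{..<m}. lborel :: real measure)"
  define \<phi> where "\<phi> r = (\<lambda>k\<in>A. r (component_index s k) :: real)" for r
  define f where "f = hitting_density lam G s (axis i 1)"
  define R where "R x \<longleftrightarrow> (\<exists>t\<in>U. \<forall>k\<in>A. hit (G k) x = ereal (t k))" for x
  have sne: "s \<noteq> []" using s(2,3) by (auto simp: ordered_partition_def)
  have fe: "first_elem (s ! n) \<in> A" if "n < m" for n
    using ordered_partition_nth[OF s(3)] that by (auto simp: m_def)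
  have f_meas: "f \<in> borel_measurable (\<Pi>\<^sub>M k\<in>A. borel)"
    unfolding f_def hitting_density_eq using fe by (intro density_fun_measurable) (simp add: m_def)
  have f_phi: "f (\<phi> r) = density_fun G s i r" for r
  proof -
    have "\<phi> r (first_elem (s ! n)) = r n" if "n < m" for n
      using component_index_eq[OF s(3), of n] ordered_partition_nth(3)[OF s(3)] fe[OF that] that
      by (simp add: \<phi>_def m_def)
    then show ?thesis
      unfolding f_def hitting_density_eq density_fun_def
      by (intro sum.cong refl arg_cong[where f = "\<lambda>Q. Q $ i $ _"] jump_density_cong) (simp add: m_def)
  qed
  have f_nonneg: "0 \<le> f t" if t: "t \<in> U" for t
    unfolding f_def hitting_density_eq
  proof (rule density_fun_nonneg[OF s(3)])
    fix n assume n: "n < length s"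
    have t': "t \<in> region A s" using t U(2) by auto
    then have "0 \<le> t (first_elem (s ! n))"
      using fe n regionD(1)[OF t'] by (auto simp: m_def PiE_iff)
    moreover have "t (first_elem (s ! k)) < t (first_elem (s ! Suc k))" if "Suc k < length s" for k
      using regionD(3)[OF t'] that by simp
    ultimately show "window_start (\<lambda>n. t (first_elem (s ! n))) n \<le> t (first_elem (s ! n))"
      using n by (cases n) (auto simp: window_start_def less_imp_le)
  qed
  define V where "V = {r \<in> open_cone m. \<phi> r \<in> U}"
  have phi: "\<phi> \<in> (\<Pi>\<^sub>M n\<in>{..<m}. borel) \<rightarrow>\<^sub>M (\<Pi>\<^sub>M k\<in>A. borel)"
    unfolding \<phi>_def
  proof (rule measurable_restrict)
    fix k assume "k \<in> A"
    then show "(\<lambda>r. r (component_index s k)) \<in> borel_measurable (\<Pi>\<^sub>M n\<in>{..<m}. borel)"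
      using component_index_lt[OF s(3)] by (simp add: m_def)
  qed
  have "V = open_cone m \<inter> (\<phi> -` U \<inter> space (\<Pi>\<^sub>M n\<in>{..<m}. borel))"
    by (auto simp: V_def open_cone_def space_PiM)
  then have V: "V \<in> sets (\<Pi>\<^sub>M n\<in>{..<length s}. borel)" "V \<subseteq> open_cone (length s)"
    using sets.Int[OF sets_open_cone measurable_sets[OF phi U(1)]] by (auto simp: m_def V_def)
  have RM: "{\<omega>\<in>space M. R (traj \<omega>)} \<in> sets M"
    unfolding R_def by (intro path_event_sets_0 path_event_hits s U)
  have eq: "\<omega> \<in> {\<omega>\<in>space M. R (traj \<omega>)} \<longleftrightarrow> \<omega> \<in> {\<omega>\<in>tied G s. hit_vec G s \<omega> \<in> V}"
    if w: "\<omega> \<in> space M" "X 0 \<omega> = i" for \<omega>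
  proof
    assume "\<omega> \<in> {\<omega>\<in>space M. R (traj \<omega>)}"
    then obtain t where t: "t \<in> U" "\<And>k. k \<in> A \<Longrightarrow> hit (G k) (traj \<omega>) = ereal (t k)" unfolding R_def by blast
    then have t': "t \<in> region A s" using U(2) by auto
    define r where "r = (\<lambda>n\<in>{..<m}. t (first_elem (s ! n)))"
    have tk: "t k = r n" if "n < m" "k \<in> s ! n" for n k
    proof -
      have n: "n < length s" using that(1) by (simp add: m_def)
      have "t k = t (first_elem (s ! n))"
        using regionD(2)[OF t'] nth_mem[OF n] that(2) ordered_partition_nth(3)[OF s(3) n] by blast
      then show ?thesis using that by (simp add: r_def)
    qed
    have hr: "hit (G k) (traj \<omega>) = ereal (r n)" if "n < length s" "k \<in> s ! n" for n k
      using t(2)[of k] tk[of n k] ordered_partition_nth(2)[OF s(3), of n] that by (auto simp: m_def)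
    \<comment> \<open>The start lies outside all targets, so the hitting times are strictly
      positive; \<open>region\<close> alone would allow the first to be 0.\<close>
    have pos: "0 < r n" if n: "n < m" for n
    proof -
      have k: "first_elem (s ! n) \<in> s ! n" using ordered_partition_nth(3)[OF s(3)] n by (simp add: m_def)
      then have "X 0 \<omega> \<notin> G (first_elem (s ! n))"
        using i w(2) n by (auto simp: waiting_set_iff m_def)
      then show ?thesis
        using hr[of n "first_elem (s ! n)"] hit_eq_iff[OF right_continuous_path[OF w(1)]] n k by (simp add: m_def)
    qed
    have "window_start r n < r n" if n: "n < m" for n
    proof (cases n)
      case 0
      then show ?thesis using pos[OF n] by (simp add: window_start_def)
    next
      case (Suc k)
      then show ?thesis using regionD(3)[OF t', of k n] n by (simp add: r_def window_start_def m_def)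
    qed
    then have "r \<in> open_cone m" by (simp add: open_cone_def r_def)
    moreover have "\<phi> r = t"
    proof
      fix k
      show "\<phi> r k = t k"
      proof (cases "k \<in> A")
        case True
        then show ?thesis using tk[of "component_index s k" k] component_index_lt[OF s(3) True]
          by (simp add: \<phi>_def m_def)
      next
        case False
        then show ?thesis using regionD(1)[OF t'] by (simp add: \<phi>_def PiE_def extensional_def)
      qed
    qed
    ultimately have "r \<in> V" using t(1) by (simp add: V_def)
    moreover have "hit_vec G s \<omega> = r"
      using hit_vec_eqI(2)[of A s \<omega> G r, OF s(3) w(1) hr]
      by (auto simp: fun_eq_iff hit_vec_def r_def m_def)
    moreover have "\<omega> \<in> tied G s" by (rule hit_vec_eqI(1)[of A s \<omega> G r, OF s(3) w(1) hr])
    ultimately show "\<omega> \<in> {\<omega>\<in>tied G s. hit_vec G s \<omega> \<in> V}" by simp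
  next
    assume h: "\<omega> \<in> {\<omega>\<in>tied G s. hit_vec G s \<omega> \<in> V}"
    have "hit (G k) (traj \<omega>) = ereal (\<phi> (hit_vec G s \<omega>) k)" if "k \<in> A" for k
      using h component_index_lt[OF s(3) that] that by (auto simp: tied_def \<phi>_def)
    then show "\<omega> \<in> {\<omega>\<in>space M. R (traj \<omega>)}"
      using h w(1) by (auto simp: R_def V_def intro!: bexI[of _ "\<phi> (hit_vec G s \<omega>)"])
  qed
  have hM: "{\<omega>\<in>tied G s. hit_vec G s \<omega> \<in> V} \<in> sets M"
  proof -
    have "{\<omega>\<in>tied G s. hit_vec G s \<omega> \<in> V} = tied G s \<inter> (hit_vec G s -` V \<inter> space M)" by (auto simp: tied_def)
    then show ?thesis using sets.Int[OF tied_sets[OF s(1,3)] measurable_sets[OF hit_vec_measurable V(1)]] by simp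
  qed
  have "ennreal (measure (P i) {\<omega>\<in>space M. R (traj \<omega>)})
      = ennreal (measure (P i) {\<omega>\<in>tied G s. hit_vec G s \<omega> \<in> V})"
    by (intro arg_cong[where f = ennreal] measure_cong_start[OF RM hM] eq)
  also have "\<dots> = (\<integral>\<^sup>+r. indicator V r * ennreal (density_fun G s i r) \<partial>N)"
    unfolding N_def m_def by (rule measure_hit_vec[OF s(1,3) i V])
  also have "\<dots> = (\<integral>\<^sup>+r. indicator (open_cone m) r * ennreal (indicator U (\<phi> r) * f (\<phi> r)) \<partial>N)"
    by (intro nn_integral_cong) (auto simp: V_def f_phi indicator_def)
  also have "\<dots> = (\<integral>\<^sup>+t. ennreal (indicator U t * f t) \<partial>region_measure A s)"
    unfolding N_def m_def \<phi>_def using U(1) f_meas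
    by (subst nn_integral_region_measure[OF s(1,3) sne]) auto
  finally have nn: "(\<integral>\<^sup>+t. ennreal (indicator U t * f t) \<partial>region_measure A s)
      = ennreal (measure (P i) {\<omega>\<in>space M. R (traj \<omega>)})" by simp
  have g_meas: "(\<lambda>t. indicator U t * f t) \<in> borel_measurable (region_measure A s)"
  proof -
    have "sets (region_measure A s) = sets (\<Pi>\<^sub>M k\<in>A. borel)" by (simp add: region_measure_def)
    then have "borel_measurable (region_measure A s) = (borel_measurable (\<Pi>\<^sub>M k\<in>A. borel) :: ((_ \<Rightarrow> real) \<Rightarrow> real) set)"
      by (intro measurable_cong_sets) auto
    then show ?thesis using U(1) f_meas by simp
  qed
  have g_nonneg: "0 \<le> indicator U t * f t" for t using f_nonneg[of t] by (simp add: indicator_def)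
  have "integrable (region_measure A s) (\<lambda>t. indicator U t * f t)"
    by (rule integrableI_nonneg[OF g_meas]) (use g_nonneg nn in auto)
  then show "set_integrable (region_measure A s) U (hitting_density lam G s (axis i 1))"
    by (simp add: set_integrable_def f_def)
  have "(LINT t|region_measure A s. indicator U t * f t) = measure (P i) {\<omega>\<in>space M. R (traj \<omega>)}"
    using integral_eq_nn_integral[OF g_meas] g_nonneg nn by (simp add: measure_nonneg)
  then show "measure (P i) {\<omega>\<in>space M. \<exists>t\<in>U. \<forall>k\<in>A. hit (G k) (traj \<omega>) = ereal (t k)} =
      (LINT t:U|region_measure A s. hitting_density lam G s (axis i 1) t)"
    by (simp add: set_lebesgue_integral_def f_def R_def)
qed

text \<open>If no earlier positive time shows the state at \<open>u\<close>, then the state at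
  \<open>u - d n\<close> differs from it for every \<open>n\<close>, an event of probability at most
  \<open>c * d n\<close>, which tends to 0.\<close>

lemma no_fixed_jump:
  assumes "0 < u"
  obtains Z where "Z \<in> sets M" "\<And>i. measure (P i) Z = 0"
    "\<And>\<omega>. \<omega> \<in> space M \<Longrightarrow> \<omega> \<notin> Z \<Longrightarrow> \<exists>v. 0 < v \<and> v < u \<and> X v \<omega> = X u \<omega>"
proof -
  obtain c h0 where c: "0 \<le> c" "0 < h0"
    "\<And>i h. 0 < h \<Longrightarrow> h < h0 \<Longrightarrow> measure (P i) {\<omega>\<in>space M. X h \<omega> \<noteq> i} \<le> c * h"
    by (rule jump_rate_bound) blast
  \<comment> \<open>A null sequence below \<open>h0\<close>, where the rate bound holds, and below
    \<open>u\<close>, so that \<open>u - d n\<close> stays positive.\<close>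
  define d where "d n = min (h0 / 2) (u / 2) / real (Suc n)" for n
  have m0: "0 < min (h0 / 2) (u / 2)" using c(2) assms by simp
  have d: "0 < d n" "d n < h0" "d n < u" for n
  proof -
    show "0 < d n" using m0 by (simp add: d_def)
    have "d n \<le> min (h0 / 2) (u / 2) / 1" unfolding d_def using m0 by (intro divide_left_mono) auto
    then show "d n < h0" "d n < u" using c(2) assms by auto
  qed
  define Z where "Z = (\<Inter>n. {\<omega>\<in>space M. X (u - d n) \<omega> \<noteq> X u \<omega>})"
  have ch: "{\<omega>\<in>space M. X (u - d n) \<omega> \<noteq> X u \<omega>} \<in> sets M" for n
    using change_sets[of "u - d n" u u] d[of n] sets_F_subset by auto
  have ZM: "Z \<in> sets M" unfolding Z_def using ch by (intro sets.countable_INT) auto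
  have "measure (P i) Z = 0" for i
  proof -
    interpret prob_space "P i" by (rule P_prob)
    have le: "measure (P i) Z \<le> c * d n" for n
    proof -
      have "measure (P i) Z \<le> measure (P i) {\<omega>\<in>space M. X (u - d n) \<omega> \<noteq> X u \<omega>}"
        by (intro finite_measure_mono) (auto simp: Z_def P_sets ch)
      also have "\<dots> = measure (P i) {\<omega>\<in>space M. X (u - d n) \<omega> \<noteq> X (u - d n + d n) \<omega>}" by simp
      also have "\<dots> \<le> c * d n * measure (P i) (space M)"
        using d[of n] c(3)[OF d(1,2)] sets.top[of "generated_filtration M X (u - d n)"]
        by (intro change_bound) auto
      finally show ?thesis by simp
    qed
    have "(\<lambda>n. c * d n) \<longlonglongrightarrow> c * 0"
      unfolding d_def by (intro tendsto_intros LIMSEQ_Suc[OF lim_const_over_n])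
    then have "measure (P i) Z \<le> c * 0" using le by (intro LIMSEQ_le_const) auto
    then show ?thesis by (simp add: antisym)
  qed
  moreover have "\<exists>v. 0 < v \<and> v < u \<and> X v \<omega> = X u \<omega>" if w: "\<omega> \<in> space M" "\<omega> \<notin> Z" for \<omega>
  proof -
    obtain n where "X (u - d n) \<omega> = X u \<omega>" using w by (auto simp: Z_def)
    then show ?thesis using d[of n] by (intro exI[of _ "u - d n"]) auto
  qed
  ultimately show thesis using ZM by (intro that[of Z]) auto
qed

section \<open>Mixed initial laws and conditioning at a fixed time\<close>

lemma prob_space_mixed_law:
  assumes "is_distribution \<alpha>"
  shows "prob_space (mixed_law M P \<alpha>)"
proof (rule prob_spaceI)
  have "emeasure (P i) (space M) = 1" for i
  proof -
    interpret prob_space "P i" by (rule P_prob)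
    show ?thesis using emeasure_space_1 by simp
  qed
  then have "emeasure (mixed_law M P \<alpha>) (space M) = (\<Sum>i\<in>UNIV. ennreal (\<alpha> $ i))"
    by (simp add: emeasure_mixed_law P_sets)
  also have "\<dots> = 1" using assms by (simp add: is_distribution_def sum_ennreal)
  finally show "emeasure (mixed_law M P \<alpha>) (space (mixed_law M P \<alpha>)) = 1" by simp
qed

lemma measure_mixed_law:
  assumes "is_distribution \<alpha>" "C \<in> sets M"
  shows "measure (mixed_law M P \<alpha>) C = (\<Sum>i\<in>UNIV. \<alpha> $ i * measure (P i) C)"
proof -
  have "emeasure (mixed_law M P \<alpha>) C = (\<Sum>i\<in>UNIV. ennreal (\<alpha> $ i) * emeasure (P i) C)"
    by (rule emeasure_mixed_law) (simp_all add: P_sets assms)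
  also have "\<dots> = (\<Sum>i\<in>UNIV. ennreal (\<alpha> $ i * measure (P i) C))"
  proof (intro sum.cong refl)
    fix i
    interpret prob_space "P i" by (rule P_prob)
    show "ennreal (\<alpha> $ i) * emeasure (P i) C = ennreal (\<alpha> $ i * measure (P i) C)"
      using assms(1) by (simp add: emeasure_eq_measure ennreal_mult is_distribution_def)
  qed
  also have "\<dots> = ennreal (\<Sum>i\<in>UNIV. \<alpha> $ i * measure (P i) C)"
    using assms(1) by (intro sum_ennreal) (simp add: is_distribution_def)
  finally show ?thesis
    using assms(1) by (simp add: measure_def sum_nonneg is_distribution_def)
qed

lemma not_hit_before_sets_F:
  assumes "finite K" "0 \<le> u"
  shows "{\<omega>\<in>space M. not_hit_before X G K u \<omega> = A} \<in> sets (generated_filtration M X u)"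
proof (cases "A \<subseteq> K")
  case True
  let ?F = "generated_filtration M X u"
  have hm: "{\<omega>\<in>space ?F. ereal u \<le> hit (G k) (traj \<omega>)} \<in> sets ?F" for k
  proof -
    have "{\<omega>\<in>space ?F. ereal u \<le> hit (G k) (traj \<omega>)} = {\<omega>\<in>space ?F. \<forall>q\<in>\<rat> \<inter> {0<..<u}. X q \<omega> \<notin> G k}"
      using le_hit_iff[OF right_continuous_path] by auto
    also have "\<dots> \<in> sets ?F"
    proof (rule sets.sets_Collect_countable_All')
      show "countable (\<rat> \<inter> {0<..<u})" using countable_rat by blast
      fix q assume "q \<in> \<rat> \<inter> {0<..<u}"
      then have "{\<omega>\<in>space M. X q \<omega> \<in> - G k} \<in> sets ?F" by (intro X_eq_sets_F) auto
      then show "{\<omega>\<in>space ?F. X q \<omega> \<notin> G k} \<in> sets ?F" by simp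
    qed
    finally show ?thesis .
  qed
  have "{\<omega>\<in>space M. not_hit_before X G K u \<omega> = A} =
      {\<omega>\<in>space ?F. \<forall>k\<in>K. (ereal u \<le> hit (G k) (traj \<omega>)) = (k \<in> A)}"
    using True by (auto simp: not_hit_before_def hitting_time_conv_hit)
  also have "\<dots> \<in> sets ?F"
  proof (rule sets.sets_Collect_finite_All[OF _ assms(1)])
    fix k
    show "{\<omega>\<in>space ?F. (ereal u \<le> hit (G k) (traj \<omega>)) = (k \<in> A)} \<in> sets ?F"
      using hm[of k] sets.sets_Collect_neg[OF hm[of k]] by (cases "k \<in> A") simp_all
  qed
  finally show ?thesis .
next
  case False
  then have "{\<omega>\<in>space M. not_hit_before X G K u \<omega> = A} = {}" by (auto simp: not_hit_before_def)
  then show ?thesis by (metis sets.empty_sets)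
qed

text \<open>At time 0 the initial law avoids every target. At a later time, a target occupied at
  \<open>u\<close> was almost surely occupied at some earlier positive time as well, which
  contradicts a hitting time of at least \<open>u\<close>.\<close>

lemma AE_not_in_unhit_targets:
  assumes \<alpha>: "is_distribution \<alpha>" "(\<Sum>i\<in>UNIV - (\<Union>k\<in>K. G k). \<alpha> $ i) = 1"
    and K: "finite K" and u: "0 \<le> u"
  shows "AE \<omega> in mixed_law M P \<alpha>. \<forall>k\<in>not_hit_before X G K u \<omega>. X u \<omega> \<notin> G k"
proof (cases "u = 0")
  case True
  let ?S = "\<Union>k\<in>K. G k"
  let ?Z = "{\<omega>\<in>space M. X 0 \<omega> \<in> ?S}"
  interpret prob_space "mixed_law M P \<alpha>" by (rule prob_space_mixed_law[OF \<alpha>(1)])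
  have out: "\<alpha> $ i = 0" if "i \<in> ?S" for i
  proof -
    have "(\<Sum>i\<in>UNIV. \<alpha> $ i) = (\<Sum>i\<in>UNIV - ?S. \<alpha> $ i) + (\<Sum>i\<in>?S. \<alpha> $ i)"
      by (rule sum.subset_diff) auto
    then have "(\<Sum>i\<in>?S. \<alpha> $ i) = 0" using \<alpha> by (simp add: is_distribution_def)
    then show ?thesis using \<alpha>(1) that by (subst (asm) sum_nonneg_eq_0_iff) (auto simp: is_distribution_def)
  qed
  have "measure (P i) ?Z = 0" if "i \<notin> ?S" for i
    using measure_cong_start[of ?Z "{}" i] X_eq_sets[of 0 ?S] that by auto
  then have "\<alpha> $ i * measure (P i) ?Z = 0" for i
    using out[of i] by (cases "i \<in> ?S") simp_all
  then have "measure (mixed_law M P \<alpha>) ?Z = 0"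
    using X_eq_sets[of 0 ?S] by (subst measure_mixed_law[OF \<alpha>(1)]) (simp_all only: order_refl sum.neutral_const)
  then have "?Z \<in> null_sets (mixed_law M P \<alpha>)"
    using X_eq_sets[of 0 ?S] by (intro null_setsI) (simp_all add: emeasure_eq_measure)
  then show ?thesis
    by (rule AE_I') (use True in \<open>auto simp: not_hit_before_def\<close>)
next
  case False
  interpret prob_space "mixed_law M P \<alpha>" by (rule prob_space_mixed_law[OF \<alpha>(1)])
  obtain Z where Z: "Z \<in> sets M" "\<And>i. measure (P i) Z = 0"
    "\<And>\<omega>. \<omega> \<in> space M \<Longrightarrow> \<omega> \<notin> Z \<Longrightarrow> \<exists>v. 0 < v \<and> v < u \<and> X v \<omega> = X u \<omega>"
    by (rule no_fixed_jump[of u]) (use False u in auto)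
  have "Z \<in> null_sets (mixed_law M P \<alpha>)"
    using Z by (intro null_setsI) (simp_all add: emeasure_eq_measure measure_mixed_law[OF \<alpha>(1)])
  then show ?thesis
  proof (rule AE_I', intro subsetI)
    fix \<omega> assume "\<omega> \<in> {\<omega>\<in>space (mixed_law M P \<alpha>). \<not> (\<forall>k\<in>not_hit_before X G K u \<omega>. X u \<omega> \<notin> G k)}"
    then obtain k where w: "\<omega> \<in> space M" and k: "ereal u \<le> hit (G k) (traj \<omega>)" "X u \<omega> \<in> G k"
      by (auto simp: not_hit_before_def hitting_time_conv_hit)
    show "\<omega> \<in> Z"
    proof (rule ccontr)
      assume "\<omega> \<notin> Z"
      then obtain v where v: "0 < v" "v < u" "X v \<omega> = X u \<omega>" using Z(3)[OF w] by blast
      then have "hit (G k) (traj \<omega>) \<le> ereal v" using k(2) by (intro hit_le) auto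
      with k(1) have "ereal u \<le> ereal v" by (rule order_trans)
      then show False using v(2) by simp
    qed
  qed
qed

text \<open>\<open>E\<close> agrees with an event of the restarted path only on \<open>B\<close>. As
  \<open>B\<close> lies in the conditioning sigma-algebra, its indicator is inserted as a factor,
  the product is conditioned by testing against sets of the filtration, and the factor is pulled out
  again.\<close>

lemma conditional_future:
  assumes \<alpha>: "is_distribution \<alpha>" and u: "0 \<le> u" and R: "path_event R"
    and B: "B \<in> sets (generated_filtration M X u)" and E: "E \<in> sets M"
    and BE: "\<And>\<omega>. \<omega> \<in> B \<Longrightarrow> \<omega> \<in> E \<longleftrightarrow> R (shift_path u (traj \<omega>))"
  shows "AE \<omega> in mixed_law M P \<alpha>. \<omega> \<in> B \<longrightarrow>
    real_cond_exp (mixed_law M P \<alpha>) (generated_filtration M X u) (indicator E) \<omega> =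
    measure (P (X u \<omega>)) {\<omega>\<in>space M. R (traj \<omega>)}"
proof -
  define N where "N = mixed_law M P \<alpha>"
  define F where "F = generated_filtration M X u"
  define g where "g l = measure (P l) {\<omega>\<in>space M. R (traj \<omega>)}" for l
  have setsN [simp]: "sets N = sets M" and spN [simp]: "space N = space M" by (simp_all add: N_def)
  interpret N: prob_space N unfolding N_def by (rule prob_space_mixed_law[OF \<alpha>])
  interpret N: finite_measure_subalgebra N F
    by unfold_locales (use sets_F_subset in \<open>auto simp: subalgebra_def F_def\<close>)
  have BM: "B \<in> sets M" and BF: "B \<in> sets F" using B sets_F_subset by (auto simp: F_def)
  have FM: "C \<in> sets F \<Longrightarrow> C \<in> sets M" for C using sets_F_subset by (auto simp: F_def)
  have Xl: "{\<omega>\<in>C. X u \<omega> = l} \<in> sets F" if "C \<in> sets F" for C l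
  proof -
    have "{\<omega>\<in>C. X u \<omega> = l} = C \<inter> {\<omega>\<in>space M. X u \<omega> \<in> {l}}"
      using sets.sets_into_space[OF FM[OF that]] by auto
    then show ?thesis using that X_eq_sets_F[OF u order_refl, of "{l}"] by (simp add: F_def sets.Int)
  qed
  \<comment> \<open>The Markov identity holds under every \<open>P i\<close> with the same function
    \<open>g\<close>, hence survives averaging with the weights of \<open>\<alpha>\<close>.\<close>
  have key: "measure N (C \<inter> B \<inter> E) = (\<Sum>l\<in>UNIV. measure N {\<omega>\<in>C \<inter> B. X u \<omega> = l} * g l)" if C: "C \<in> sets F" for C
  proof -
    have CB: "C \<inter> B \<in> sets F" using C BF by simp
    have CBE: "C \<inter> B \<inter> E \<in> sets M" using FM[OF CB] E by simp
    have "measure (P i) (C \<inter> B \<inter> E) = (\<Sum>l\<in>UNIV. measure (P i) {\<omega>\<in>C \<inter> B. X u \<omega> = l} * g l)" for i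
    proof -
      have "measure (P i) (C \<inter> B \<inter> E) = (\<Sum>l\<in>UNIV. measure (P i) {\<omega>\<in>C \<inter> B \<inter> E. X u \<omega> = l})"
        by (rule measure_split_state[OF u CBE])
      also have "\<dots> = (\<Sum>l\<in>UNIV. measure (P i) {\<omega>\<in>C \<inter> B. X u \<omega> = l \<and> R (shift_path u (traj \<omega>))})"
        using BE by (intro sum.cong refl arg_cong[where f = "measure (P i)"]) auto
      also have "\<dots> = (\<Sum>l\<in>UNIV. measure (P i) {\<omega>\<in>C \<inter> B. X u \<omega> = l} * g l)"
        unfolding g_def using CB by (intro sum.cong refl markov_path R u) (simp add: F_def)
      finally show ?thesis .
    qed
    then have "measure N (C \<inter> B \<inter> E) =
        (\<Sum>i\<in>UNIV. \<alpha> $ i * (\<Sum>l\<in>UNIV. measure (P i) {\<omega>\<in>C \<inter> B. X u \<omega> = l} * g l))"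
      unfolding N_def by (simp add: measure_mixed_law[OF \<alpha> CBE])
    also have "\<dots> = (\<Sum>l\<in>UNIV. (\<Sum>i\<in>UNIV. \<alpha> $ i * measure (P i) {\<omega>\<in>C \<inter> B. X u \<omega> = l}) * g l)"
      unfolding sum_distrib_left sum_distrib_right mult.assoc by (rule sum.swap)
    also have "\<dots> = (\<Sum>l\<in>UNIV. measure N {\<omega>\<in>C \<inter> B. X u \<omega> = l} * g l)"
      unfolding N_def using FM[OF Xl[OF CB]] by (simp add: measure_mixed_law[OF \<alpha>])
    finally show ?thesis .
  qed
  \<comment> \<open>The candidate, which is \<open>g (X u \<omega>)\<close> on \<open>B\<close> and
    0 elsewhere, written as a finite sum so that its measurability and integrability are
    immediate.\<close>
  define h where "h \<omega> = (\<Sum>l\<in>UNIV. indicator {\<omega>\<in>B. X u \<omega> = l} \<omega> * g l :: real)" for \<omega>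
  have h_eq: "h \<omega> = g (X u \<omega>)" if "\<omega> \<in> B" for \<omega>
  proof -
    have "h \<omega> = (\<Sum>l\<in>UNIV. if l = X u \<omega> then g (X u \<omega>) else 0)"
      unfolding h_def using that by (intro sum.cong refl) (auto simp: indicator_def)
    then show ?thesis by simp
  qed
  have h_F: "h \<in> borel_measurable F"
    unfolding h_def using Xl[OF BF] by (intro borel_measurable_sum borel_measurable_times borel_measurable_indicator) auto
  have h_int: "integrable N h"
    unfolding h_def using FM[OF Xl[OF BF]]
    by (intro Bochner_Integration.integrable_sum integrable_mult_left integrable_real_indicator)
      (auto simp: N.emeasure_finite less_top[symmetric])
  have BE_int: "integrable N (\<lambda>\<omega>. indicator B \<omega> * indicator E \<omega> :: real)"
  proof -
    have "integrable N (indicator (B \<inter> E) :: _ \<Rightarrow> real)"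
      using BM E by (intro integrable_real_indicator) (auto simp: N.emeasure_finite less_top[symmetric])
    moreover have "(indicator (B \<inter> E) :: _ \<Rightarrow> real) = (\<lambda>\<omega>. indicator B \<omega> * indicator E \<omega>)"
      by (auto simp: indicator_def fun_eq_iff)
    ultimately show ?thesis by simp
  qed
  have "AE \<omega> in N. real_cond_exp N F (\<lambda>\<omega>. indicator B \<omega> * indicator E \<omega>) \<omega> = h \<omega>"
  proof (rule N.real_cond_exp_charact[OF _ BE_int h_int h_F])
    fix C assume C: "C \<in> sets F"
    have CM: "C \<in> sets M" by (rule FM[OF C])
    have "(LINT \<omega>:C|N. indicator B \<omega> * indicator E \<omega>) = (LINT \<omega>|N. indicator (C \<inter> B \<inter> E) \<omega> :: real)"
      unfolding set_lebesgue_integral_def by (intro Bochner_Integration.integral_cong) (auto simp: indicator_def)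
    also have "\<dots> = measure N (C \<inter> B \<inter> E)"
      using sets.sets_into_space[OF CM] by (simp add: Int_absorb2 inf.coboundedI1)
    also have "\<dots> = (\<Sum>l\<in>UNIV. measure N {\<omega>\<in>C \<inter> B. X u \<omega> = l} * g l)" by (rule key[OF C])
    also have "\<dots> = (\<Sum>l\<in>UNIV. (LINT \<omega>|N. indicator {\<omega>\<in>C \<inter> B. X u \<omega> = l} \<omega> * g l))"
    proof (intro sum.cong refl)
      fix l
      have "{\<omega>\<in>C \<inter> B. X u \<omega> = l} \<inter> space M = {\<omega>\<in>C \<inter> B. X u \<omega> = l}"
        using sets.sets_into_space[OF CM] by auto
      then show "measure N {\<omega>\<in>C \<inter> B. X u \<omega> = l} * g l = (LINT \<omega>|N. indicator {\<omega>\<in>C \<inter> B. X u \<omega> = l} \<omega> * g l)" by simp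
    qed
    also have "\<dots> = (LINT \<omega>|N. (\<Sum>l\<in>UNIV. indicator {\<omega>\<in>C \<inter> B. X u \<omega> = l} \<omega> * g l))"
    proof (rule Bochner_Integration.integral_sum[symmetric])
      fix l
      have "{\<omega>\<in>C \<inter> B. X u \<omega> = l} \<in> sets N" using FM[OF Xl[OF sets.Int[OF C BF]]] by simp
      then show "integrable N (\<lambda>\<omega>. indicator {\<omega>\<in>C \<inter> B. X u \<omega> = l} \<omega> * g l)"
        by (intro integrable_mult_left integrable_real_indicator) (auto simp: N.emeasure_finite less_top[symmetric])
    qed
    also have "\<dots> = (LINT \<omega>:C|N. h \<omega>)"
      unfolding set_lebesgue_integral_def h_def
      by (intro Bochner_Integration.integral_cong refl) (auto simp: indicator_def sum_distrib_left intro!: sum.cong)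
    finally show "(LINT \<omega>:C|N. indicator B \<omega> * indicator E \<omega>) = (LINT \<omega>:C|N. h \<omega>)" .
  qed
  moreover have "AE \<omega> in N. real_cond_exp N F (\<lambda>\<omega>. indicator B \<omega> * indicator E \<omega>) \<omega>
      = indicator B \<omega> * real_cond_exp N F (indicator E) \<omega>"
    by (rule N.real_cond_exp_mult[OF borel_measurable_indicator[OF BF] borel_measurable_indicator BE_int])
      (simp add: E)
  ultimately have "AE \<omega> in N. \<omega> \<in> B \<longrightarrow> real_cond_exp N F (indicator E) \<omega> = g (X u \<omega>)"
  proof eventually_elim
    case (elim \<omega>)
    then show ?case using h_eq[of \<omega>] by auto
  qed
  then show ?thesis unfolding N_def F_def g_def .
qed

lemma hits_after_iff:
  assumes w: "\<omega> \<in> space M" and u: "0 \<le> u"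
    and before: "\<And>k. k \<in> A \<Longrightarrow> ereal u \<le> hitting_time X G k \<omega>"
    and out: "\<And>k. k \<in> A \<Longrightarrow> X u \<omega> \<notin> G k"
  shows "(\<exists>t\<in>U. \<forall>k\<in>A. hitting_time X G k \<omega> - ereal u = ereal (t k)) \<longleftrightarrow>
    (\<exists>t\<in>U. \<forall>k\<in>A. hit (G k) (shift_path u (traj \<omega>)) = ereal (t k))"
proof (intro bex_cong refl ball_cong)
  fix t k assume k: "k \<in> A"
  \<comment> \<open>An infinite hitting time makes both sides false, since it stays infinite after
    subtracting \<open>u\<close>.\<close>
  have "hitting_time X G k \<omega> - ereal u = ereal (t k) \<longleftrightarrow> hit (G k) (traj \<omega>) = ereal (u + t k)"
    unfolding hitting_time_conv_hit by (cases "hit (G k) (traj \<omega>)") auto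
  also have "\<dots> \<longleftrightarrow> hit (G k) (shift_path u (traj \<omega>)) = ereal (t k)"
    using before[OF k] out[OF k]
    by (intro hit_shift_iff right_continuous_path w u) (simp_all add: hitting_time_conv_hit)
  finally show "hitting_time X G k \<omega> - ereal u = ereal (t k) \<longleftrightarrow>
      hit (G k) (shift_path u (traj \<omega>)) = ereal (t k)" .
qed

lemma hitting_event_sets:
  assumes "finite A" "U \<in> sets (\<Pi>\<^sub>M k\<in>A. borel)"
  shows "{\<omega>\<in>space M. \<exists>t\<in>U. \<forall>k\<in>A. hitting_time X G k \<omega> - ereal u = ereal (t k)} \<in> sets M"
  unfolding hitting_time_conv_hit by (rule sets_ex_vector_eq[OF assms]) measurable

end

theorem proposition3p2:
  fixes M :: "'w measure"
    and X :: "real \<Rightarrow> 'w \<Rightarrow> 's::finite"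
    and P :: "'s \<Rightarrow> 'w measure"
    and lam :: "real^'s^'s"
    and K :: "'k set"
    and G :: "'k \<Rightarrow> 's set"
    and \<alpha> :: "real^'s"
    and u0 :: real
    and A :: "'k set"
    and s :: "'k set list"
    and U :: "('k \<Rightarrow> real) set"
  assumes "markov_process M X P lam"
    and "finite K" and "K \<noteq> {}"
    and "UNIV - (\<Union>k\<in>K. G k) \<noteq> {}"
    and "is_distribution \<alpha>"
    and "(\<Sum>i\<in>UNIV - (\<Union>k\<in>K. G k). \<alpha> $ i) = 1"
    and "0 \<le> u0"
    and "A \<noteq> {}" and "A \<subseteq> K"
    and "ordered_partition A s"
    and "U \<in> sets (\<Pi>\<^sub>M k\<in>A. borel)" and "U \<subseteq> region A s"
  shows "AE \<omega> in mixed_law M P \<alpha>. not_hit_before X G K u0 \<omega> = A \<longrightarrow>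
     set_integrable (region_measure A s) U (hitting_density lam G s (axis (X u0 \<omega>) 1)) \<and>
     real_cond_exp (mixed_law M P \<alpha>) (generated_filtration M X u0)
         (indicator {\<omega>'\<in>space M. \<exists>t\<in>U. \<forall>k\<in>A. hitting_time X G k \<omega>' - ereal u0 = ereal (t k)}) \<omega>
       = (LINT t:U|region_measure A s. hitting_density lam G s (axis (X u0 \<omega>) 1) t)"
proof -
  interpret markov_process M X P lam by fact
  have A: "finite A" using assms(2,9) finite_subset by blast
  define R where "R x \<longleftrightarrow> (\<exists>t\<in>U. \<forall>k\<in>A. hit (G k) x = ereal (t k))" for x
  define E where "E = {\<omega>'\<in>space M. \<exists>t\<in>U. \<forall>k\<in>A. hitting_time X G k \<omega>' - ereal u0 = ereal (t k)}"
  define W where "W = waiting_set G s 0"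
  \<comment> \<open>The condition on the state at \<open>u0\<close> ensures that no target in
    \<open>A\<close> is occupied at the restart; almost surely it removes nothing from the event
    that \<open>A\<close> is the unhit set.\<close>
  define B where "B = {\<omega>\<in>space M. not_hit_before X G K u0 \<omega> = A} \<inter> {\<omega>\<in>space M. X u0 \<omega> \<in> W}"
  have W: "i \<in> W \<longleftrightarrow> (\<forall>k\<in>A. i \<notin> G k)" for i
  proof -
    have "\<Union>(set s) = A" using assms(10) by (simp add: ordered_partition_def)
    then show ?thesis by (auto simp: W_def waiting_set_def target_union_def)
  qed
  have R: "path_event R" unfolding R_def by (rule path_event_hits[OF A assms(11)])
  have "AE \<omega> in mixed_law M P \<alpha>. \<omega> \<in> B \<longrightarrow>
      real_cond_exp (mixed_law M P \<alpha>) (generated_filtration M X u0) (indicator E) \<omega> =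
      measure (P (X u0 \<omega>)) {\<omega>\<in>space M. R (traj \<omega>)}"
  proof (rule conditional_future[OF assms(5,7) R])
    show "B \<in> sets (generated_filtration M X u0)"
      unfolding B_def using assms(7)
      by (intro sets.Int not_hit_before_sets_F assms(2) X_eq_sets_F) auto
    show "E \<in> sets M" unfolding E_def by (rule hitting_event_sets[OF A assms(11)])
    fix \<omega> assume w: "\<omega> \<in> B"
    then have "\<omega> \<in> space M" "\<And>k. k \<in> A \<Longrightarrow> ereal u0 \<le> hitting_time X G k \<omega>" "\<And>k. k \<in> A \<Longrightarrow> X u0 \<omega> \<notin> G k"
      by (auto simp: B_def W not_hit_before_def)
    then show "\<omega> \<in> E \<longleftrightarrow> R (shift_path u0 (traj \<omega>))"
      using hits_after_iff[of \<omega> u0 A G U] assms(7) by (simp add: E_def R_def)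
  qed
  moreover have "AE \<omega> in mixed_law M P \<alpha>. \<forall>k\<in>not_hit_before X G K u0 \<omega>. X u0 \<omega> \<notin> G k"
    by (rule AE_not_in_unhit_targets[OF assms(5,6,2,7)])
  ultimately show ?thesis
    unfolding E_def[symmetric] using AE_space
  proof eventually_elim
    case (elim \<omega>)
    show ?case
    proof
      assume nh: "not_hit_before X G K u0 \<omega> = A"
      then have XW: "X u0 \<omega> \<in> W" using elim(2) by (simp add: W)
      then have "\<omega> \<in> B" using nh elim(3) by (simp add: B_def)
      then show "set_integrable (region_measure A s) U (hitting_density lam G s (axis (X u0 \<omega>) 1)) \<and>
          real_cond_exp (mixed_law M P \<alpha>) (generated_filtration M X u0) (indicator E) \<omega>
          = (LINT t:U|region_measure A s. hitting_density lam G s (axis (X u0 \<omega>) 1) t)"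
        using hitting_times_law[OF A assms(8,10,11,12) XW[unfolded W_def]] elim(1) by (simp add: R_def)
    qed
  qed
qed

end
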